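(* Let $p$ be a prime, let $k$ be a field of characteristic $p$, and let $A=C_{p^r}\times C_{p^{r_1}}\times \cdots \times C_{p^{r_l}}$ be a non-trivial abelian $p$-group, where all cyclic factors are non-trivial and $p^r$ is the order of the smallest cyclic summand. Let $m$ be the nilpotency index of the Jacobson radical $J(kA)$, i.e. the smallest integer with $J(kA)^m=0$. Then \[ m-p^r+\left\lceil \frac{p^r-1}{2}\right\rceil \le \text{ghost number of } kA \le \text{generating number of } kA \le m-1. \]
   Context: $C_n$ denotes the cyclic group of order $n$. Let $G$ be a finite group and $k$ a field whose characteristic divides $|G|$. $\mathrm{StMod}(kG)$ is the stable module category: objects are left $kG$-modules, morphisms are $[M,N] = \mathrm{Hom}_{kG}(M,N)$ modulo maps factoring through a projective. It is triangulated, with desuspension $\Omega M$ the kernel of a surjection from a projective onto $M$, and $\Sigma=\Omega^{-1}$. $\mathrm{Thick}\langle k\rangle$ is the smallest full triangulated subcategory closed under retracts and containing the trivial module $k$. A ghost is a map $f$ in $\mathrm{StMod}(kG)$ with $[\Omega^n k,f]=0$ for all $n\in\mathbb{Z}$ (i.e. $f$ induces zero on Tate cohomology). The ghost length of $M\in\mathrm{Thick}\langle k\rangle$ is the smallest $n\ge 0$ such that every composite of $n$ ghosts between objects of $\mathrm{Thick}\langle k\rangle$ with domain $M$ is zero in $\mathrm{StMod}(kG)$ (a composite of $0$ ghosts being any map). The generating length of $M$ is the smallest $n\ge 0$ with $M\in\mathcal{F}_n$, where $\mathcal{F}_0$ consists of the zero objects of $\mathrm{StMod}(kG)$, $\mathcal{F}_1$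 consists of retracts of (arbitrary) direct sums of modules $\Omega^i k$, $i\in\mathbb{Z}$, and $X\in\mathcal{F}_n$ iff $X$ is a retract of some $Y$ in a triangle $P\to Y\to Q\to\Sigma P$ with $P\in\mathcal{F}_1$, $Q\in\mathcal{F}_{n-1}$; equivalently it is the smallest $n$ such that every composite of $n$ ghosts in $\mathrm{StMod}(kG)$ with domain $M$ is zero. The ghost number (respectively generating number) of $kG$ is the least upper bound of the ghost lengths (respectively generating lengths) of modules in $\mathrm{Thick}\langle k\rangle$. *)

theory Defs
  imports "HOL-Library.Extended_Nat" "HOL-Computational_Algebra.Primes"
    "HOL-Algebra.Elementary_Groups" "HOL-Algebra.Product_Groups"
    "HOL-Algebra.Ideal_Product" "HOL-Algebra.Module"
begin

section \<open>Group algebras of abelian groups\<close>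

text \<open>
  Elements of \<open>kG\<close> are the functions \<open>G \<rightarrow> k\<close> vanishing off the carrier, with convolution as
  product. Only finite abelian \<open>G\<close> are of interest here, so that \<open>kG\<close> is commutative and left
  \<open>kG\<close>-modules are modules in the sense of the locale \<^locale>\<open>module\<close>, which presupposes a
  commutative ring.
\<close>

definition group_algebra :: "'g monoid \<Rightarrow> ('g \<Rightarrow> 'k::field) ring" where
  "group_algebra G =
    \<lparr>carrier = {a. \<forall>x. x \<notin> carrier G \<longrightarrow> a x = 0},
     monoid.mult = (\<lambda>a b z. if z \<in> carrier G
        then \<Sum>x\<in>carrier G. a x * b (inv\<^bsub>G\<^esub> x \<otimes>\<^bsub>G\<^esub> z) else 0),
     monoid.one = (\<lambda>x. if x = \<one>\<^bsub>G\<^esub> then 1 else 0),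
     ring.zero = (\<lambda>x. 0),
     ring.add = (\<lambda>a b x. a x + b x)\<rparr>"

text \<open>
  \<open>T\<close> is a copy of the trivial module \<open>k\<close>: the field \<open>k\<close>, transported along a bijection \<open>\<phi>\<close>, with
  \<open>kG\<close> acting through the augmentation.
\<close>

definition trivial_module :: "'g monoid \<Rightarrow> ('g \<Rightarrow> 'k::field, 'u) module \<Rightarrow> bool" where
  "trivial_module G T \<longleftrightarrow>
     module (group_algebra G) T \<and>
     (\<exists>\<phi> :: 'k \<Rightarrow> 'u. bij_betw \<phi> UNIV (carrier T) \<and>
        (\<forall>c d. \<phi> (c + d) = \<phi> c \<oplus>\<^bsub>T\<^esub> \<phi> d) \<and>
        (\<forall>a\<in>carrier (group_algebra G). \<forall>c.
           a \<odot>\<^bsub>T\<^esub> \<phi> c = \<phi> ((\<Sum>x\<in>carrier G. a x) * c)))"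

section \<open>Jacobson radical and nilpotency index of an ideal (commutative rings)\<close>

definition jacobson_radical :: "('r, 'c) ring_scheme \<Rightarrow> 'r set" where
  "jacobson_radical R = carrier R \<inter> \<Inter> {I. maximalideal I R}"

primrec ideal_power :: "('r, 'c) ring_scheme \<Rightarrow> 'r set \<Rightarrow> nat \<Rightarrow> 'r set" where
  "ideal_power R I 0 = carrier R"
| "ideal_power R I (Suc n) = ideal_prod R I (ideal_power R I n)"

definition nilpotency_index :: "('r, 'c) ring_scheme \<Rightarrow> 'r set \<Rightarrow> nat" where
  "nilpotency_index R I = (LEAST n. ideal_power R I n = {\<zero>\<^bsub>R\<^esub>})"

section \<open>The stable module category\<close>

text \<open>
  The objects are the modules \<open>M :: ('r, 'u) module\<close> with \<open>module R M\<close>. The type \<open>'u\<close> plays the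
  role of a universe: it has to be infinite and to admit an injection from \<open>R\<close>, and then every
  module of cardinality at most that of \<open>'u\<close> has an isomorphic copy. Morphisms of the stable
  category are represented by module homomorphisms, and \<open>stab_eq\<close> is equality of morphisms there.
  The fields \<^const>\<open>monoid.mult\<close> and \<^const>\<open>one\<close> of the record type of modules carry no meaning.
\<close>

definition mod_hom ::
    "('r, 'c) ring_scheme \<Rightarrow> ('r, 'u) module \<Rightarrow> ('r, 'u) module \<Rightarrow> ('u \<Rightarrow> 'u) set" where
  "mod_hom R M N = {f \<in> carrier M \<rightarrow> carrier N.
     (\<forall>x\<in>carrier M. \<forall>y\<in>carrier M. f (x \<oplus>\<^bsub>M\<^esub> y) = f x \<oplus>\<^bsub>N\<^esub> f y) \<and>
     (\<forall>a\<in>carrier R. \<forall>x\<in>carrier M. f (a \<odot>\<^bsub>M\<^esub> x) = a \<odot>\<^bsub>N\<^esub> f x)}"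

definition projective :: "('r, 'c) ring_scheme \<Rightarrow> ('r, 'u) module \<Rightarrow> bool" where
  "projective R P \<longleftrightarrow> module R P \<and>
     (\<forall>(M :: ('r, 'u) module) (N :: ('r, 'u) module). module R M \<and> module R N \<longrightarrow>
        (\<forall>g\<in>mod_hom R M N. \<forall>f\<in>mod_hom R P N. g ` carrier M = carrier N \<longrightarrow>
           (\<exists>h\<in>mod_hom R P M. \<forall>x\<in>carrier P. g (h x) = f x)))"

definition stab_eq ::
    "('r, 'c) ring_scheme \<Rightarrow> ('r, 'u) module \<Rightarrow> ('r, 'u) module \<Rightarrow> ('u \<Rightarrow> 'u) \<Rightarrow> ('u \<Rightarrow> 'u) \<Rightarrow> bool"
  where
  "stab_eq R M N f g \<longleftrightarrow>
     (\<exists>P :: ('r, 'u) module. projective R P \<and>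
        (\<exists>a\<in>mod_hom R M P. \<exists>b\<in>mod_hom R P N. \<forall>x\<in>carrier M. f x \<ominus>\<^bsub>N\<^esub> g x = b (a x)))"

definition stab_zero ::
    "('r, 'c) ring_scheme \<Rightarrow> ('r, 'u) module \<Rightarrow> ('r, 'u) module \<Rightarrow> ('u \<Rightarrow> 'u) \<Rightarrow> bool" where
  "stab_zero R M N f \<longleftrightarrow> stab_eq R M N f (\<lambda>_. \<zero>\<^bsub>N\<^esub>)"

definition zero_object :: "('r, 'c) ring_scheme \<Rightarrow> ('r, 'u) module \<Rightarrow> bool" where
  "zero_object R Z \<longleftrightarrow> module R Z \<and>
     (\<forall>M :: ('r, 'u) module. module R M \<longrightarrow>
        (\<forall>f\<in>mod_hom R M Z. \<forall>g\<in>mod_hom R M Z. stab_eq R M Z f g) \<and>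
        (\<forall>f\<in>mod_hom R Z M. \<forall>g\<in>mod_hom R Z M. stab_eq R Z M f g))"

definition stab_iso ::
    "('r, 'c) ring_scheme \<Rightarrow> ('r, 'u) module \<Rightarrow> ('r, 'u) module \<Rightarrow> ('u \<Rightarrow> 'u) \<Rightarrow> bool" where
  "stab_iso R M N f \<longleftrightarrow> f \<in> mod_hom R M N \<and>
     (\<exists>g\<in>mod_hom R N M. stab_eq R M M (g \<circ> f) id \<and> stab_eq R N N (f \<circ> g) id)"

text \<open>\<open>X\<close> is a retract of \<open>Y\<close> in the stable category.\<close>

definition stab_retract ::
    "('r, 'c) ring_scheme \<Rightarrow> ('r, 'u) module \<Rightarrow> ('r, 'u) module \<Rightarrow> bool" where
  "stab_retract R X Y \<longleftrightarrow> module R X \<and> module R Y \<and>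
     (\<exists>s\<in>mod_hom R X Y. \<exists>t\<in>mod_hom R Y X. stab_eq R X X (t \<circ> s) id)"

text \<open>\<open>S\<close> is isomorphic to the external direct sum of the modules \<open>N j\<close> for \<open>j \<in> I\<close>.\<close>

definition direct_sum ::
    "('r, 'c) ring_scheme \<Rightarrow> 'i set \<Rightarrow> ('i \<Rightarrow> ('r, 'u) module) \<Rightarrow> ('r, 'u) module \<Rightarrow> bool" where
  "direct_sum R I N S \<longleftrightarrow> module R S \<and> (\<forall>j\<in>I. module R (N j)) \<and>
     (\<exists>\<iota>. (\<forall>j\<in>I. \<iota> j \<in> mod_hom R (N j) S) \<and>
       bij_betw (\<lambda>x. finsum S (\<lambda>j. \<iota> j (x j)) {j\<in>I. x j \<noteq> \<zero>\<^bsub>N j\<^esub>})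
         {x \<in> \<Pi>\<^sub>E j\<in>I. carrier (N j). finite {j\<in>I. x j \<noteq> \<zero>\<^bsub>N j\<^esub>}}
         (carrier S))"

section \<open>Triangulated structure\<close>

definition short_exact ::
    "('r, 'c) ring_scheme \<Rightarrow> ('r, 'u) module \<Rightarrow> ('u \<Rightarrow> 'u) \<Rightarrow> ('r, 'u) module \<Rightarrow> ('u \<Rightarrow> 'u) \<Rightarrow>
      ('r, 'u) module \<Rightarrow> bool" where
  "short_exact R X f Y g Z \<longleftrightarrow>
     module R X \<and> module R Y \<and> module R Z \<and> f \<in> mod_hom R X Y \<and> g \<in> mod_hom R Y Z \<and>
     inj_on f (carrier X) \<and> f ` carrier X = {y \<in> carrier Y. g y = \<zero>\<^bsub>Z\<^esub>} \<and>
     g ` carrier Y = carrier Z"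

text \<open>
  \<open>\<Omega> M\<close> is the kernel of a chosen surjection from a projective module onto \<open>M\<close>.
\<close>

definition Omega :: "('r, 'c) ring_scheme \<Rightarrow> ('r, 'u) module \<Rightarrow> ('r, 'u) module" where
  "Omega R M = (SOME N. \<exists>P i q. projective R P \<and> short_exact R N i P q M)"

text \<open>
  The inverse \<open>\<Sigma>\<close>, by a chosen exact sequence \<open>0 \<rightarrow> X \<rightarrow> P \<rightarrow> \<Sigma> X \<rightarrow> 0\<close> with \<open>P\<close> projective.
  It exists because projective and injective modules over the group algebra of a finite group
  coincide. The whole sequence is fixed, since it is needed for the action of \<open>\<Sigma>\<close> on morphisms
  and for the connecting morphisms.
\<close>

definition Sigma_seq :: "('r, 'c) ring_scheme \<Rightarrow> ('r, 'u) module \<Rightarrow>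
      ('r, 'u) module \<times> ('u \<Rightarrow> 'u) \<times> ('u \<Rightarrow> 'u) \<times> ('r, 'u) module" where
  "Sigma_seq R X = (SOME (P, i, q, W). projective R P \<and> short_exact R X i P q W)"

definition Sig :: "('r, 'c) ring_scheme \<Rightarrow> ('r, 'u) module \<Rightarrow> ('r, 'u) module" where
  "Sig R X = (case Sigma_seq R X of (P, i, q, W) \<Rightarrow> W)"

text \<open>The homomorphism \<open>b : \<Sigma> X \<rightarrow> \<Sigma> X'\<close> represents \<open>\<Sigma> a\<close> for \<open>a : X \<rightarrow> X'\<close>.\<close>

definition represents_Sigma :: "('r, 'c) ring_scheme \<Rightarrow> ('r, 'u) module \<Rightarrow> ('r, 'u) module \<Rightarrow>
      ('u \<Rightarrow> 'u) \<Rightarrow> ('u \<Rightarrow> 'u) \<Rightarrow> bool" where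
  "represents_Sigma R X X' a b \<longleftrightarrow>
     (case Sigma_seq R X of (P, i, q, W) \<Rightarrow> case Sigma_seq R X' of (P', i', q', W') \<Rightarrow>
        b \<in> mod_hom R W W' \<and>
        (\<exists>c\<in>mod_hom R P P'. (\<forall>x\<in>carrier X. c (i x) = i' (a x)) \<and>
                              (\<forall>y\<in>carrier P. q' (c y) = b (q y))))"

text \<open>
  A short exact sequence \<open>0 \<rightarrow> X \<rightarrow> Y \<rightarrow> Z \<rightarrow> 0\<close> gives a standard triangle: extend the embedding
  \<open>i : X \<rightarrow> P\<close> to \<open>u : Y \<rightarrow> P\<close> and let \<open>h : Z \<rightarrow> \<Sigma> X\<close> be the induced map on cokernels. Some authors
  use \<open>-h\<close> instead; the class of triples of objects occurring in triangles is the same.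
\<close>

definition standard_triangle :: "('r, 'c) ring_scheme \<Rightarrow> ('r, 'u) module \<Rightarrow> ('r, 'u) module \<Rightarrow>
      ('r, 'u) module \<Rightarrow> ('u \<Rightarrow> 'u) \<Rightarrow> ('u \<Rightarrow> 'u) \<Rightarrow> ('u \<Rightarrow> 'u) \<Rightarrow> bool" where
  "standard_triangle R X Y Z f g h \<longleftrightarrow>
     short_exact R X f Y g Z \<and> h \<in> mod_hom R Z (Sig R X) \<and>
     (case Sigma_seq R X of (P, i, q, W) \<Rightarrow>
        \<exists>u\<in>mod_hom R Y P. (\<forall>x\<in>carrier X. u (f x) = i x) \<and> (\<forall>y\<in>carrier Y. h (g y) = q (u y)))"

text \<open>The triangles \<open>X \<rightarrow> Y \<rightarrow> Z \<rightarrow> \<Sigma> X\<close> are those isomorphic to a standard triangle.\<close>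

definition triangle :: "('r, 'c) ring_scheme \<Rightarrow> ('r, 'u) module \<Rightarrow> ('r, 'u) module \<Rightarrow>
      ('r, 'u) module \<Rightarrow> ('u \<Rightarrow> 'u) \<Rightarrow> ('u \<Rightarrow> 'u) \<Rightarrow> ('u \<Rightarrow> 'u) \<Rightarrow> bool" where
  "triangle R X Y Z f g h \<longleftrightarrow>
     module R X \<and> module R Y \<and> module R Z \<and>
     f \<in> mod_hom R X Y \<and> g \<in> mod_hom R Y Z \<and> h \<in> mod_hom R Z (Sig R X) \<and>
     (\<exists>X' Y' Z' f' g' h' a b c s.
        standard_triangle R X' Y' Z' f' g' h' \<and>
        stab_iso R X X' a \<and> stab_iso R Y Y' b \<and> stab_iso R Z Z' c \<and>
        represents_Sigma R X X' a s \<and>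
        stab_eq R X Y' (b \<circ> f) (f' \<circ> a) \<and>
        stab_eq R Y Z' (c \<circ> g) (g' \<circ> b) \<and>
        stab_eq R Z (Sig R X') (s \<circ> h) (h' \<circ> c))"

definition Omega_power ::
    "('r, 'c) ring_scheme \<Rightarrow> int \<Rightarrow> ('r, 'u) module \<Rightarrow> ('r, 'u) module" where
  "Omega_power R n M =
     (if n \<ge> 0 then (Omega R ^^ nat n) M else (Sig R ^^ nat (- n)) M)"

text \<open>
  Full triangulated subcategories closed under retracts, given by their classes of objects.
  Closure under retracts includes closure under isomorphism.
\<close>

definition thick_subcategory :: "('r, 'c) ring_scheme \<Rightarrow> ('r, 'u) module set \<Rightarrow> bool" where
  "thick_subcategory R C \<longleftrightarrow>
     (\<forall>X\<in>C. module R X) \<and>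
     (\<forall>X. zero_object R X \<longrightarrow> X \<in> C) \<and>
     (\<forall>X\<in>C. Omega R X \<in> C \<and> Sig R X \<in> C) \<and>
     (\<forall>X Y Z f g h. triangle R X Y Z f g h \<longrightarrow>
        (X \<in> C \<and> Y \<in> C \<longrightarrow> Z \<in> C) \<and> (Y \<in> C \<and> Z \<in> C \<longrightarrow> X \<in> C) \<and> (X \<in> C \<and> Z \<in> C \<longrightarrow> Y \<in> C)) \<and>
     (\<forall>X. \<forall>Y\<in>C. stab_retract R X Y \<longrightarrow> X \<in> C)"

definition Thick :: "('r, 'c) ring_scheme \<Rightarrow> ('r, 'u) module \<Rightarrow> ('r, 'u) module set" where
  "Thick R T = \<Inter> {C. thick_subcategory R C \<and> T \<in> C}"

section \<open>Ghosts, ghost length and generating length\<close>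

text \<open>In this section \<open>T\<close> stands for the trivial module.\<close>

definition ghost :: "('r, 'c) ring_scheme \<Rightarrow> ('r, 'u) module \<Rightarrow> ('r, 'u) module \<Rightarrow>
      ('r, 'u) module \<Rightarrow> ('u \<Rightarrow> 'u) \<Rightarrow> bool" where
  "ghost R T M N f \<longleftrightarrow> f \<in> mod_hom R M N \<and>
     (\<forall>n :: int. \<forall>u\<in>mod_hom R (Omega_power R n T) M.
        stab_zero R (Omega_power R n T) N (f \<circ> u))"

text \<open>\<open>f : M \<rightarrow> N\<close> is a composite of \<open>n\<close> ghosts, all intermediate objects lying in \<open>C\<close>.\<close>

fun ghost_composite :: "('r, 'c) ring_scheme \<Rightarrow> ('r, 'u) module \<Rightarrow> ('r, 'u) module set \<Rightarrow> nat \<Rightarrow>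
      ('r, 'u) module \<Rightarrow> ('r, 'u) module \<Rightarrow> ('u \<Rightarrow> 'u) \<Rightarrow> bool" where
  "ghost_composite R T C 0 M N f \<longleftrightarrow> f \<in> mod_hom R M N"
| "ghost_composite R T C (Suc 0) M N f \<longleftrightarrow> ghost R T M N f"
| "ghost_composite R T C (Suc (Suc n)) M N f \<longleftrightarrow>
     (\<exists>L\<in>C. \<exists>g h. ghost R T M L g \<and> ghost_composite R T C (Suc n) L N h \<and> f = h \<circ> g)"

text \<open>
  The lengths live in \<^typ>\<open>enat\<close>, the infimum of the empty set being \<open>\<infinity>\<close>.
\<close>

definition ghost_length ::
    "('r, 'c) ring_scheme \<Rightarrow> ('r, 'u) module \<Rightarrow> ('r, 'u) module \<Rightarrow> enat" where
  "ghost_length R T M = Inf {enat n | n.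
     \<forall>N\<in>Thick R T. \<forall>f. ghost_composite R T (Thick R T) n M N f \<longrightarrow> stab_zero R M N f}"

text \<open>
  The classes \<open>F\<^sub>n\<close>. Direct sums are indexed by subsets of the universe \<open>'u\<close> itself; a direct sum of
  nonzero modules that exists in the universe never needs a larger index set.
\<close>

fun gen_class :: "('r, 'c) ring_scheme \<Rightarrow> ('r, 'u) module \<Rightarrow> nat \<Rightarrow> ('r, 'u) module set" where
  "gen_class R T 0 = {X. zero_object R X}"
| "gen_class R T (Suc 0) =
     {X. \<exists>(I :: 'u set) (e :: 'u \<Rightarrow> int) S.
        direct_sum R I (\<lambda>j. Omega_power R (e j) T) S \<and> stab_retract R X S}"
| "gen_class R T (Suc (Suc n)) =
     {X. \<exists>P Y Q f g h. P \<in> gen_class R T (Suc 0) \<and> Q \<in> gen_class R T (Suc n) \<and>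
        triangle R P Y Q f g h \<and> stab_retract R X Y}"

definition generating_length ::
    "('r, 'c) ring_scheme \<Rightarrow> ('r, 'u) module \<Rightarrow> ('r, 'u) module \<Rightarrow> enat" where
  "generating_length R T M = Inf {enat n | n. M \<in> gen_class R T n}"

definition ghost_number :: "('r, 'c) ring_scheme \<Rightarrow> ('r, 'u) module \<Rightarrow> enat" where
  "ghost_number R T = (SUP M\<in>Thick R T. ghost_length R T M)"

definition generating_number :: "('r, 'c) ring_scheme \<Rightarrow> ('r, 'u) module \<Rightarrow> enat" where
  "generating_number R T = (SUP M\<in>Thick R T. generating_length R T M)"

end

theory Submission
  imports Defs "HOL-Computational_Algebra.Polynomial"
begin

text \<open>
  Write \<open>R = kA\<close>, let \<open>I\<close> be its augmentation ideal and let \<open>g\<^sub>0, g\<^sub>1, \<dots>\<close> generate the cyclic factors,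
  of orders \<open>q\<^sub>0 = p\<^sup>r, q\<^sub>1, \<dots>\<close>. The elements \<open>X\<^sub>i = g\<^sub>i - 1\<close> generate \<open>I\<close>, the \<open>q\<^sub>i\<close>-th power of \<open>X\<^sub>i\<close> is zero, and the
  product of the \<open>(q\<^sub>i - 1)\<close>-th powers is not. Hence \<open>I\<close> is nilpotent, it is the only maximal ideal, and
  its nilpotency index \<open>m\<close> is at most \<open>1 + \<Sum>(q\<^sub>i - 1)\<close>.

  The stable category enters only through three facts: in the given universe every module is a
  quotient of a projective module, every module embeds in a projective module, and projective modules
  are injective. The coinduced module \<open>coind V\<close> of all functions \<open>A \<rightarrow> V\<close> provides them, since a linear
  map out of \<open>V\<close> or into \<open>V\<close> determines a unique equivariant map out of or into \<open>coind V\<close>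
  (\<open>projective_coind\<close>, \<open>coind_extend\<close>). The linear algebra over \<open>k\<close> that this needs is obtained by
  letting \<open>A\<close> act trivially: such modules are direct sums of copies of the trivial module
  (\<open>trivial_action_direct_sum\<close>).

  The middle inequality is the ghost lemma \<open>ghost_composite_vanishes\<close>. A ghost vanishes on sums of
  modules \<open>\<Omega>\<^sup>n k\<close>, so on the middle term of a triangle \<open>P \<rightarrow> Y \<rightarrow> Q\<close> with \<open>P\<close> such a sum it factors through
  \<open>Q\<close>, and the remaining ghosts of the composite are dealt with by induction.

  Upper bound. The socle of \<open>R\<close> is spanned by the norm element \<open>N\<close>, the sum of all group elements. A
  vector \<open>v\<close> with \<open>N v \<noteq> 0\<close> generates a free module, which is injective and splits off. Splitting off
  all of them at once makes any module stably a retract of a module killed by \<open>N\<close>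
  (\<open>retract_of_norm_killed\<close>). As \<open>I\<close> annihilates the \<open>(m - 1)\<close>-st power of \<open>I\<close>, this power consists of
  multiples of \<open>N\<close>, so it kills the module as well, and the socle filtration has at most \<open>m - 1\<close> layers,
  each of them a sum of copies of \<open>k\<close>.

  Lower bound. Multiplication by an element of \<open>I\<close> is a ghost on every module: it is natural and it is
  zero on \<open>k\<close>, hence stably zero on all \<open>\<Omega>\<^sup>n k\<close>. With \<open>y\<close> the \<open>s\<close>-th power of \<open>X\<^sub>0\<close> for the least \<open>s \<ge> q\<^sub>0 / 2\<close>
  consider the module \<open>M = y R\<close> and the product \<open>w\<close> of \<open>X\<^sub>0\<close>, taken \<open>\<lfloor>q\<^sub>0 / 2\<rfloor> - 1\<close> times, and of all
  \<open>X\<^sub>i\<close> with \<open>i > 0\<close>, taken \<open>q\<^sub>i - 1\<close> times. If multiplication by \<open>w\<close> on \<open>M\<close> were stably zero, it would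
  extend to a map \<open>R \<rightarrow> M\<close>, because projectives are injective, and \<open>w y\<close> would be a multiple of
  \<open>y\<^sup>2 = 0\<close>. But \<open>w y\<close> is the nonzero product of all the \<open>(q\<^sub>i - 1)\<close>-th powers. So \<open>M\<close>, which lies in
  \<open>Thick\<langle>k\<rangle>\<close> like every finite-dimensional module, supports a nonzero composite of
  \<open>\<lfloor>q\<^sub>0 / 2\<rfloor> - 1 + \<Sum>\<^bsub>i > 0\<^esub> (q\<^sub>i - 1)\<close> ghosts (\<open>ghost_number_ge\<close>, \<open>ghost_number_bound\<close>), and
  \<open>m - q\<^sub>0 \<le> \<Sum>\<^bsub>i > 0\<^esub> (q\<^sub>i - 1)\<close>.
\<close>

section \<open>Homomorphisms, submodules and quotients\<close>

lemma (in abelian_group) minus_eq_zero_iff: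
  "x \<in> carrier G \<Longrightarrow> y \<in> carrier G \<Longrightarrow> x \<ominus> y = \<zero> \<longleftrightarrow> x = y"
  by (metis a_minus_def add.inv_closed minus_equality minus_minus r_neg)

lemma (in abelian_group) minus_zero_right: "x \<in> carrier G \<Longrightarrow> x \<ominus> \<zero> = x"
  using add.inv_one by (simp add: minus_eq a_inv_def)

lemma (in abelian_monoid) finsum_swap:
  assumes "finite S" "finite S'" and f: "\<And>x y. x \<in> S \<Longrightarrow> y \<in> S' \<Longrightarrow> f x y \<in> carrier G"
  shows "finsum G (\<lambda>x. finsum G (\<lambda>y. f x y) S') S = finsum G (\<lambda>y. finsum G (\<lambda>x. f x y) S) S'"
  using assms(1) f
proof (induction rule: finite_induct)
  case (insert x S)
  then have "finsum G (\<lambda>y. finsum G (\<lambda>x. f x y) (insert x S)) S'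
      = finsum G (\<lambda>y. f x y \<oplus> finsum G (\<lambda>x. f x y) S) S'"
    by (intro finsum_cong') auto
  also have "\<dots> = finsum G (\<lambda>y. f x y) S' \<oplus> finsum G (\<lambda>y. finsum G (\<lambda>x. f x y) S) S'"
    using insert.prems by (intro finsum_addf) auto
  finally show ?case using insert by (simp add: Pi_def)
qed simp

lemma additive_map_finsum:
  assumes M: "abelian_monoid M" and N: "abelian_monoid N"
    and cl: "\<And>x. x \<in> carrier M \<Longrightarrow> f x \<in> carrier N"
    and zero: "f \<zero>\<^bsub>M\<^esub> = \<zero>\<^bsub>N\<^esub>"
    and add: "\<And>x y. x \<in> carrier M \<Longrightarrow> y \<in> carrier M \<Longrightarrow> f (x \<oplus>\<^bsub>M\<^esub> y) = f x \<oplus>\<^bsub>N\<^esub> f y"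
    and "finite S" "t \<in> S \<rightarrow> carrier M"
  shows "f (finsum M t S) = finsum N (\<lambda>s. f (t s)) S"
  using assms(6,7)
proof (induction rule: finite_induct)
  case empty
  show ?case by (simp add: abelian_monoid.finsum_empty[OF M] abelian_monoid.finsum_empty[OF N] zero)
next
  case (insert s S)
  interpret M: abelian_monoid M by fact
  interpret N: abelian_monoid N by fact
  have "t \<in> S \<rightarrow> carrier M" "t s \<in> carrier M" using insert.prems by auto
  then show ?case using insert by (simp add: add cl Pi_def)
qed

lemma mod_homI:
  assumes "\<And>x. x \<in> carrier M \<Longrightarrow> f x \<in> carrier N"
    and "\<And>x y. x \<in> carrier M \<Longrightarrow> y \<in> carrier M \<Longrightarrow> f (x \<oplus>\<^bsub>M\<^esub> y) = f x \<oplus>\<^bsub>N\<^esub> f y"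
    and "\<And>a x. a \<in> carrier R \<Longrightarrow> x \<in> carrier M \<Longrightarrow> f (a \<odot>\<^bsub>M\<^esub> x) = a \<odot>\<^bsub>N\<^esub> f x"
  shows "f \<in> mod_hom R M N"
  using assms by (simp add: mod_hom_def)

lemma mod_hom_closed: "f \<in> mod_hom R M N \<Longrightarrow> x \<in> carrier M \<Longrightarrow> f x \<in> carrier N"
  by (auto simp: mod_hom_def)

lemma mod_hom_plus:
  "f \<in> mod_hom R M N \<Longrightarrow> x \<in> carrier M \<Longrightarrow> y \<in> carrier M \<Longrightarrow> f (x \<oplus>\<^bsub>M\<^esub> y) = f x \<oplus>\<^bsub>N\<^esub> f y"
  by (simp add: mod_hom_def)

lemma mod_hom_smult:
  "f \<in> mod_hom R M N \<Longrightarrow> a \<in> carrier R \<Longrightarrow> x \<in> carrier M \<Longrightarrow> f (a \<odot>\<^bsub>M\<^esub> x) = a \<odot>\<^bsub>N\<^esub> f x"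
  by (simp add: mod_hom_def)

lemmas mod_hom_simps = mod_hom_closed mod_hom_plus mod_hom_smult

lemma mod_hom_zero:
  assumes "module R M" "module R N" "f \<in> mod_hom R M N"
  shows "f \<zero>\<^bsub>M\<^esub> = \<zero>\<^bsub>N\<^esub>"
proof -
  interpret M: module R M by fact
  interpret N: module R N by fact
  have "f (\<zero>\<^bsub>R\<^esub> \<odot>\<^bsub>M\<^esub> \<zero>\<^bsub>M\<^esub>) = \<zero>\<^bsub>R\<^esub> \<odot>\<^bsub>N\<^esub> f \<zero>\<^bsub>M\<^esub>"
    using assms(3) by (intro mod_hom_smult) auto
  then show ?thesis
    using mod_hom_closed[OF assms(3)] by simp
qed

lemma mod_hom_uminus:
  assumes "module R M" "module R N" "f \<in> mod_hom R M N" "x \<in> carrier M"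
  shows "f (\<ominus>\<^bsub>M\<^esub> x) = \<ominus>\<^bsub>N\<^esub> f x"
proof -
  interpret M: module R M by fact
  interpret N: module R N by fact
  have "f (\<ominus>\<^bsub>M\<^esub> x) \<oplus>\<^bsub>N\<^esub> f x = \<zero>\<^bsub>N\<^esub>"
    using assms(4) by (simp add: mod_hom_plus[OF assms(3), symmetric] M.M.l_neg
        mod_hom_zero[OF assms(1-3)])
  then show ?thesis
    using assms(4) mod_hom_closed[OF assms(3)] by (metis M.M.a_inv_closed N.M.minus_equality)
qed

lemma mod_hom_minus:
  assumes "module R M" "module R N" "f \<in> mod_hom R M N" "x \<in> carrier M" "y \<in> carrier M"
  shows "f (x \<ominus>\<^bsub>M\<^esub> y) = f x \<ominus>\<^bsub>N\<^esub> f y"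
proof -
  interpret M: module R M by fact
  interpret N: module R N by fact
  show ?thesis
    using assms(4,5) by (simp add: a_minus_def mod_hom_plus[OF assms(3)] mod_hom_uminus[OF assms(1-3)])
qed

lemma mod_hom_finsum:
  assumes M: "module R M" and N: "module R N" and f: "f \<in> mod_hom R M N"
    and "finite S" "t \<in> S \<rightarrow> carrier M"
  shows "f (finsum M t S) = finsum N (\<lambda>s. f (t s)) S"
proof -
  interpret M: module R M by (rule M)
  interpret N: module R N by (rule N)
  show ?thesis
    by (rule additive_map_finsum[OF M.M.abelian_monoid_axioms N.M.abelian_monoid_axioms mod_hom_closed[OF f]
          mod_hom_zero[OF M N f] mod_hom_plus[OF f] assms(4,5)])
qed

lemma mod_hom_comp:
  "f \<in> mod_hom R M N \<Longrightarrow> g \<in> mod_hom R N L \<Longrightarrow> g \<circ> f \<in> mod_hom R M L"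
  by (auto simp: mod_hom_def Pi_def)

lemma mod_hom_comp':
  "f \<in> mod_hom R M N \<Longrightarrow> g \<in> mod_hom R N L \<Longrightarrow> (\<lambda>x. g (f x)) \<in> mod_hom R M L"
  by (auto simp: mod_hom_def Pi_def)

lemma mod_hom_ident: "id \<in> mod_hom R M M" "(\<lambda>x. x) \<in> mod_hom R M M"
  by (auto simp: mod_hom_def)

lemma mod_hom_zero_map:
  assumes "module R N" shows "(\<lambda>_. \<zero>\<^bsub>N\<^esub>) \<in> mod_hom R M N"
proof -
  interpret N: module R N by fact
  show ?thesis by (auto simp: mod_hom_def)
qed

lemma mod_hom_diff_map:
  assumes "module R N" "f \<in> mod_hom R M N" "g \<in> mod_hom R M N"
  shows "(\<lambda>x. f x \<ominus>\<^bsub>N\<^esub> g x) \<in> mod_hom R M N"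
proof -
  interpret N: module R N by fact
  note [simp] = mod_hom_simps[OF assms(2)] mod_hom_simps[OF assms(3)]
  show ?thesis
    by (rule mod_homI)
      (simp_all add: a_minus_def N.M.minus_add N.M.a_ac N.smult_r_distr N.smult_r_minus)
qed

lemma mod_hom_add_map:
  assumes "module R N" "f \<in> mod_hom R M N" "g \<in> mod_hom R M N"
  shows "(\<lambda>x. f x \<oplus>\<^bsub>N\<^esub> g x) \<in> mod_hom R M N"
proof -
  interpret N: module R N by fact
  note [simp] = mod_hom_simps[OF assms(2)] mod_hom_simps[OF assms(3)]
  show ?thesis
    by (rule mod_homI)
      (simp_all add: N.M.a_ac N.smult_r_distr)
qed

lemma mod_hom_scale:
  assumes "module R M" "r \<in> carrier R" shows "(\<lambda>x. r \<odot>\<^bsub>M\<^esub> x) \<in> mod_hom R M M"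
proof -
  interpret M: module R M by fact
  show ?thesis using assms(2)
    by (intro mod_homI) (simp_all add: M.smult_r_distr M.smult_assoc1[symmetric] M.R.m_comm)
qed

text \<open>The module axioms are equational up to the existence of additive inverses, so they pass to
  the image of any map that respects the operations.\<close>

lemma module_image:
  assumes M: "module R M"
    and car: "carrier Q = \<pi> ` carrier M"
    and zero: "\<zero>\<^bsub>Q\<^esub> = \<pi> \<zero>\<^bsub>M\<^esub>"
    and add: "\<And>x y. x \<in> carrier M \<Longrightarrow> y \<in> carrier M \<Longrightarrow> \<pi> x \<oplus>\<^bsub>Q\<^esub> \<pi> y = \<pi> (x \<oplus>\<^bsub>M\<^esub> y)"
    and smult: "\<And>a x. a \<in> carrier R \<Longrightarrow> x \<in> carrier M \<Longrightarrow> a \<odot>\<^bsub>Q\<^esub> \<pi> x = \<pi> (a \<odot>\<^bsub>M\<^esub> x)"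
  shows "module R Q"
proof -
  interpret M: module R M by fact
  show ?thesis
  proof (rule moduleI)
    show "cring R" by (rule M.R.cring_axioms)
    show "abelian_group Q"
    proof (rule abelian_groupI)
      fix x assume "x \<in> carrier Q"
      then obtain u where u: "u \<in> carrier M" "x = \<pi> u" using car by auto
      show "\<exists>y\<in>carrier Q. y \<oplus>\<^bsub>Q\<^esub> x = \<zero>\<^bsub>Q\<^esub>"
        using u by (intro bexI[of _ "\<pi> (\<ominus>\<^bsub>M\<^esub> u)"]) (auto simp: car zero add M.M.l_neg)
    qed (auto simp: car zero add M.M.a_ac)
  qed (auto simp: car add smult M.smult_l_distr M.smult_r_distr M.smult_assoc1)
qed

lemma module_restrict:
  assumes "module R M" "submodule H R M"
  shows "module R (M\<lparr>carrier := H\<rparr>)"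
  using submodule.submodule_is_module assms by blast

lemma mod_hom_inclusion:
  assumes "module R M" "submodule H R M"
  shows "(\<lambda>x. x) \<in> mod_hom R (M\<lparr>carrier := H\<rparr>) M"
  using module.submoduleE(1)[OF assms] by (intro mod_homI) auto

lemma mod_hom_into_restrict:
  assumes "f \<in> mod_hom R L M" "f ` carrier L \<subseteq> H"
  shows "f \<in> mod_hom R L (M\<lparr>carrier := H\<rparr>)"
  using assms by (auto simp: mod_hom_def)

lemma submodule_kernel:
  assumes "module R M" "module R N" "f \<in> mod_hom R M N"
  shows "submodule {x \<in> carrier M. f x = \<zero>\<^bsub>N\<^esub>} R M"
proof -
  interpret M: module R M by fact
  interpret N: module R N by fact
  show ?thesis
    using assms by (intro M.submoduleI)
      (auto simp: mod_hom_simps mod_hom_zero mod_hom_uminus)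
qed

lemma submodule_image:
  assumes "module R M" "module R N" "f \<in> mod_hom R M N"
  shows "submodule (f ` carrier M) R N"
proof -
  interpret M: module R M by fact
  interpret N: module R N by fact
  note f = assms(3)
  show ?thesis
  proof (rule N.submoduleI)
    show "f ` carrier M \<subseteq> carrier N" using f by (auto simp: mod_hom_closed)
    show "\<zero>\<^bsub>N\<^esub> \<in> f ` carrier M"
      using mod_hom_zero[OF assms] by (metis M.M.zero_closed imageI)
  next
    fix a assume "a \<in> f ` carrier M"
    then show "\<ominus>\<^bsub>N\<^esub> a \<in> f ` carrier M"
      using mod_hom_uminus[OF assms] by (metis (no_types, lifting) M.M.a_inv_closed image_iff)
  next
    fix a b assume "a \<in> f ` carrier M" "b \<in> f ` carrier M"
    then show "a \<oplus>\<^bsub>N\<^esub> b \<in> f ` carrier M"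
      using mod_hom_plus[OF f] by (metis (no_types, lifting) M.M.add.m_closed image_iff)
  next
    fix a x assume "a \<in> carrier R" "x \<in> f ` carrier M"
    then show "a \<odot>\<^bsub>N\<^esub> x \<in> f ` carrier M"
      using mod_hom_smult[OF f] by (metis (no_types, lifting) M.smult_closed image_iff)
  qed
qed

lemma mod_hom_inj_onI:
  assumes "module R M" "module R N" "f \<in> mod_hom R M N"
    and "\<And>x. x \<in> carrier M \<Longrightarrow> f x = \<zero>\<^bsub>N\<^esub> \<Longrightarrow> x = \<zero>\<^bsub>M\<^esub>"
  shows "inj_on f (carrier M)"
proof (rule inj_onI)
  interpret M: module R M by fact
  interpret N: module R N by fact
  fix x y assume xy: "x \<in> carrier M" "y \<in> carrier M" "f x = f y"
  then have "f (x \<ominus>\<^bsub>M\<^esub> y) = \<zero>\<^bsub>N\<^esub>"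
    using assms(3) by (simp add: mod_hom_minus[OF assms(1-3)] mod_hom_closed N.M.minus_eq_zero_iff)
  then show "x = y" using assms(4)[of "x \<ominus>\<^bsub>M\<^esub> y"] xy by (simp add: M.M.minus_eq_zero_iff)
qed

lemma mod_hom_eq_iff_minus:
  assumes "module R M" "module R N" "f \<in> mod_hom R M N" "x \<in> carrier M" "y \<in> carrier M"
  shows "f x = f y \<longleftrightarrow> f (x \<ominus>\<^bsub>M\<^esub> y) = \<zero>\<^bsub>N\<^esub>"
proof -
  interpret N: module R N by fact
  show ?thesis using assms by (simp add: mod_hom_minus mod_hom_closed N.M.minus_eq_zero_iff)
qed

text \<open>The quotient is carried by a set of coset representatives, so that it lives in the same
  universe as the module itself.\<close>

lemma quotient_exists:
  fixes M :: "('r, 'u) module"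
  assumes M: "module R M" and H: "submodule H R M"
  obtains Q :: "('r, 'u) module" and \<pi> where "module R Q" "\<pi> \<in> mod_hom R M Q"
    "\<pi> ` carrier M = carrier Q" "\<And>x. x \<in> carrier M \<Longrightarrow> \<pi> x = \<zero>\<^bsub>Q\<^esub> \<longleftrightarrow> x \<in> H"
proof -
  interpret M: module R M by fact
  note HE = M.submoduleE[OF H]
  have H0: "\<zero>\<^bsub>M\<^esub> \<in> H" using HE(1,2,3,5) by (metis M.M.r_neg ex_in_conv subsetD)
  define rel where "rel x y \<longleftrightarrow> x \<in> carrier M \<and> y \<in> carrier M \<and> x \<ominus>\<^bsub>M\<^esub> y \<in> H" for x y
  define \<pi> where "\<pi> x = (SOME y. rel x y)" for x
  have refl: "rel x x" if "x \<in> carrier M" for x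
    using that H0 by (simp add: rel_def M.M.r_neg a_minus_def)
  have sym: "rel y x" if "rel x y" for x y
  proof -
    have "\<ominus>\<^bsub>M\<^esub> (x \<ominus>\<^bsub>M\<^esub> y) = y \<ominus>\<^bsub>M\<^esub> x"
      using that by (simp add: rel_def a_minus_def M.M.minus_add M.M.a_ac)
    then show ?thesis using that HE(3)[of "x \<ominus>\<^bsub>M\<^esub> y"] by (simp add: rel_def)
  qed
  have trans: "rel x z" if "rel x y" "rel y z" for x y z
  proof -
    have "(x \<ominus>\<^bsub>M\<^esub> y) \<oplus>\<^bsub>M\<^esub> (y \<ominus>\<^bsub>M\<^esub> z) = x \<ominus>\<^bsub>M\<^esub> z"
      using that by (simp add: rel_def a_minus_def M.M.a_assoc M.M.r_neg1)
    then show ?thesis using that HE(5)[of "x \<ominus>\<^bsub>M\<^esub> y" "y \<ominus>\<^bsub>M\<^esub> z"] by (simp add: rel_def)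
  qed
  have rel\<pi>: "rel x (\<pi> x)" if "x \<in> carrier M" for x
    unfolding \<pi>_def using refl[OF that] by (rule someI)
  have \<pi>_eq: "\<pi> x = \<pi> y" if "rel x y" for x y
  proof -
    have "rel x z \<longleftrightarrow> rel y z" for z using that sym trans by blast
    then show ?thesis by (simp add: \<pi>_def)
  qed
  have \<pi>c: "\<pi> x \<in> carrier M" if "x \<in> carrier M" for x using rel\<pi>[OF that] by (simp add: rel_def)
  define Q where "Q = \<lparr>carrier = \<pi> ` carrier M, monoid.mult = (\<lambda>a b. a), one = \<zero>\<^bsub>M\<^esub>,
     zero = \<pi> \<zero>\<^bsub>M\<^esub>, add = (\<lambda>a b. \<pi> (a \<oplus>\<^bsub>M\<^esub> b)), module.smult = (\<lambda>r a. \<pi> (r \<odot>\<^bsub>M\<^esub> a))\<rparr>"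
  have add: "\<pi> x \<oplus>\<^bsub>Q\<^esub> \<pi> y = \<pi> (x \<oplus>\<^bsub>M\<^esub> y)" if "x \<in> carrier M" "y \<in> carrier M" for x y
  proof -
    have "(x \<ominus>\<^bsub>M\<^esub> \<pi> x) \<oplus>\<^bsub>M\<^esub> (y \<ominus>\<^bsub>M\<^esub> \<pi> y) = (x \<oplus>\<^bsub>M\<^esub> y) \<ominus>\<^bsub>M\<^esub> (\<pi> x \<oplus>\<^bsub>M\<^esub> \<pi> y)"
      using that \<pi>c by (simp add: a_minus_def M.M.minus_add M.M.a_ac)
    then have "rel (x \<oplus>\<^bsub>M\<^esub> y) (\<pi> x \<oplus>\<^bsub>M\<^esub> \<pi> y)"
      using that rel\<pi>[of x] rel\<pi>[of y] HE(5)[of "x \<ominus>\<^bsub>M\<^esub> \<pi> x" "y \<ominus>\<^bsub>M\<^esub> \<pi> y"] \<pi>c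
      by (simp add: rel_def)
    then show ?thesis using \<pi>_eq by (simp add: Q_def)
  qed
  have smult: "a \<odot>\<^bsub>Q\<^esub> \<pi> x = \<pi> (a \<odot>\<^bsub>M\<^esub> x)" if "a \<in> carrier R" "x \<in> carrier M" for a x
  proof -
    have "a \<odot>\<^bsub>M\<^esub> (x \<ominus>\<^bsub>M\<^esub> \<pi> x) = (a \<odot>\<^bsub>M\<^esub> x) \<ominus>\<^bsub>M\<^esub> (a \<odot>\<^bsub>M\<^esub> \<pi> x)"
      using that \<pi>c by (simp add: a_minus_def M.smult_r_distr M.smult_r_minus)
    then have "rel (a \<odot>\<^bsub>M\<^esub> x) (a \<odot>\<^bsub>M\<^esub> \<pi> x)"
      using that rel\<pi>[of x] HE(4)[of a "x \<ominus>\<^bsub>M\<^esub> \<pi> x"] \<pi>c by (simp add: rel_def)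
    then show ?thesis using \<pi>_eq by (simp add: Q_def)
  qed
  have "module R Q"
    by (rule module_image[OF M, of Q \<pi>]) (simp_all add: add smult, simp_all add: Q_def)
  moreover have "\<pi> \<in> mod_hom R M Q"
    by (rule mod_homI) (simp_all add: add smult, simp add: Q_def)
  moreover have "\<pi> ` carrier M = carrier Q" by (simp add: Q_def)
  moreover have "\<pi> x = \<zero>\<^bsub>Q\<^esub> \<longleftrightarrow> x \<in> H" if "x \<in> carrier M" for x
  proof
    assume "\<pi> x = \<zero>\<^bsub>Q\<^esub>"
    then have "\<pi> x = \<pi> \<zero>\<^bsub>M\<^esub>" by (simp add: Q_def)
    then have "rel x \<zero>\<^bsub>M\<^esub>" using rel\<pi>[OF that] rel\<pi>[OF M.M.zero_closed] sym trans by metis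
    then show "x \<in> H" using that by (simp add: rel_def M.M.minus_zero_right)
  next
    assume "x \<in> H"
    then have "rel x \<zero>\<^bsub>M\<^esub>" using that by (simp add: rel_def M.M.minus_zero_right)
    then show "\<pi> x = \<zero>\<^bsub>Q\<^esub>" using \<pi>_eq by (simp add: Q_def)
  qed
  ultimately show thesis using that by blast
qed

lemma mod_hom_factor_through_surjection:
  assumes M: "module R M" and Q: "module R Q" and N: "module R N"
    and \<pi>: "\<pi> \<in> mod_hom R M Q" "\<pi> ` carrier M = carrier Q"
    and f: "f \<in> mod_hom R M N"
    and ker: "\<And>x. x \<in> carrier M \<Longrightarrow> \<pi> x = \<zero>\<^bsub>Q\<^esub> \<Longrightarrow> f x = \<zero>\<^bsub>N\<^esub>"
  obtains h where "h \<in> mod_hom R Q N" "\<forall>x\<in>carrier M. h (\<pi> x) = f x"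
proof -
  interpret M: module R M by fact
  define h where "h = f \<circ> inv_into (carrier M) \<pi>"
  have h: "h (\<pi> x) = f x" if x: "x \<in> carrier M" for x
  proof -
    let ?y = "inv_into (carrier M) \<pi> (\<pi> x)"
    have y: "?y \<in> carrier M" "\<pi> ?y = \<pi> x" using x by (auto intro: inv_into_into f_inv_into_f)
    then have "f (?y \<ominus>\<^bsub>M\<^esub> x) = \<zero>\<^bsub>N\<^esub>"
      using mod_hom_eq_iff_minus[OF M Q \<pi>(1) y(1) x] by (intro ker) (auto simp: x)
    then show ?thesis using mod_hom_eq_iff_minus[OF M N f y(1) x] by (simp add: h_def)
  qed
  have Qc: "\<exists>u\<in>carrier M. y = \<pi> u" if "y \<in> carrier Q" for y using that \<pi>(2) by auto
  have "h \<in> mod_hom R Q N"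
  proof (rule mod_homI)
    fix x assume "x \<in> carrier Q"
    then show "h x \<in> carrier N" using Qc h mod_hom_closed[OF f] by metis
  next
    fix x y assume "x \<in> carrier Q" "y \<in> carrier Q"
    then obtain u v where "u \<in> carrier M" "x = \<pi> u" "v \<in> carrier M" "y = \<pi> v" using Qc by metis
    then show "h (x \<oplus>\<^bsub>Q\<^esub> y) = h x \<oplus>\<^bsub>N\<^esub> h y"
      by (simp add: mod_hom_plus[OF \<pi>(1), symmetric] h mod_hom_plus[OF f])
  next
    fix a x assume "a \<in> carrier R" "x \<in> carrier Q"
    then show "h (a \<odot>\<^bsub>Q\<^esub> x) = a \<odot>\<^bsub>N\<^esub> h x"
      using Qc[of x] by (auto simp: mod_hom_smult[OF \<pi>(1), symmetric] h mod_hom_smult[OF f])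
  qed
  then show thesis using h that by blast
qed

lemma mod_hom_factor_through_injection:
  assumes M: "module R M" and K: "module R K" and N: "module R N"
    and i: "i \<in> mod_hom R K N" "inj_on i (carrier K)"
    and f: "f \<in> mod_hom R M N"
    and im: "\<And>x. x \<in> carrier M \<Longrightarrow> f x \<in> i ` carrier K"
  obtains h where "h \<in> mod_hom R M K" "\<forall>x\<in>carrier M. i (h x) = f x"
proof -
  interpret M: module R M by fact
  interpret K: module R K by fact
  define h where "h = inv_into (carrier K) i \<circ> f"
  have h: "h x \<in> carrier K" "i (h x) = f x" if "x \<in> carrier M" for x
    using im[OF that] by (auto simp: h_def inv_into_into f_inv_into_f)
  note inj = inj_onD[OF i(2)]
  have "h \<in> mod_hom R M K"
    by (rule mod_homI; (rule inj)?)
      (simp_all add: h mod_hom_plus[OF i(1)] mod_hom_plus[OF f] mod_hom_smult[OF i(1)] mod_hom_smult[OF f])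
  then show thesis using h that by blast
qed

lemma short_exactD:
  assumes "short_exact R X f Y g Z"
  shows "module R X" "module R Y" "module R Z" "f \<in> mod_hom R X Y" "g \<in> mod_hom R Y Z"
    "inj_on f (carrier X)" "f ` carrier X = {y \<in> carrier Y. g y = \<zero>\<^bsub>Z\<^esub>}" "g ` carrier Y = carrier Z"
    "\<And>x. x \<in> carrier X \<Longrightarrow> g (f x) = \<zero>\<^bsub>Z\<^esub>"
  using assms by (auto simp: short_exact_def)

lemma short_exact_kernel:
  assumes "module R M" "module R N" "f \<in> mod_hom R M N" "f ` carrier M = carrier N"
  shows "short_exact R (M\<lparr>carrier := {x \<in> carrier M. f x = \<zero>\<^bsub>N\<^esub>}\<rparr>) (\<lambda>x. x) M f N"
  using assms module_restrict[OF assms(1) submodule_kernel[OF assms(1-3)]]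
    mod_hom_inclusion[OF assms(1) submodule_kernel[OF assms(1-3)]]
  by (auto simp: short_exact_def)

lemma short_exact_quotient:
  fixes M :: "('r, 'u) module"
  assumes "module R K" "module R M" "i \<in> mod_hom R K M" "inj_on i (carrier K)"
  obtains Q :: "('r, 'u) module" and \<pi> where "short_exact R K i M \<pi> Q"
proof -
  obtain Q :: "('r, 'u) module" and \<pi> where "module R Q" "\<pi> \<in> mod_hom R M Q"
    "\<pi> ` carrier M = carrier Q" "\<And>x. x \<in> carrier M \<Longrightarrow> \<pi> x = \<zero>\<^bsub>Q\<^esub> \<longleftrightarrow> x \<in> i ` carrier K"
    using quotient_exists[OF assms(2) submodule_image[OF assms(1-3)]] by blast
  then have "short_exact R K i M \<pi> Q"
    using assms mod_hom_closed[OF assms(3)] by (auto simp: short_exact_def)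
  then show thesis using that by blast
qed

lemma short_exact_preimage:
  assumes "short_exact R X f Y g Z" "y \<in> carrier Y" "g y = \<zero>\<^bsub>Z\<^esub>"
  obtains x where "x \<in> carrier X" "y = f x"
proof -
  have "y \<in> f ` carrier X" unfolding short_exactD(7)[OF assms(1)] using assms(2,3) by simp
  then show thesis using that by (rule imageE)
qed

section \<open>Direct sums\<close>

text \<open>The ingredients of the bijection that defines a direct sum, for an arbitrary family \<open>t\<close> of
  homomorphisms \<open>N j \<rightarrow> L\<close> in place of the injections.\<close>

definition fam_supp :: "'i set \<Rightarrow> ('i \<Rightarrow> ('r, 'u) module) \<Rightarrow> ('i \<Rightarrow> 'u) \<Rightarrow> 'i set" where
  "fam_supp I N x = {j \<in> I. x j \<noteq> \<zero>\<^bsub>N j\<^esub>}"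

definition fam_sum ::
    "('r, 'u) module \<Rightarrow> 'i set \<Rightarrow> ('i \<Rightarrow> ('r, 'u) module) \<Rightarrow> ('i \<Rightarrow> 'u \<Rightarrow> 'u) \<Rightarrow> ('i \<Rightarrow> 'u) \<Rightarrow> 'u" where
  "fam_sum L I N t x = finsum L (\<lambda>j. t j (x j)) (fam_supp I N x)"

definition fin_families :: "'i set \<Rightarrow> ('i \<Rightarrow> ('r, 'u) module) \<Rightarrow> ('i \<Rightarrow> 'u) set" where
  "fin_families I N = {x \<in> \<Pi>\<^sub>E j\<in>I. carrier (N j). finite (fam_supp I N x)}"

lemma direct_sum_iff:
  "direct_sum R I N S \<longleftrightarrow> module R S \<and> (\<forall>j\<in>I. module R (N j)) \<and>
     (\<exists>\<iota>. (\<forall>j\<in>I. \<iota> j \<in> mod_hom R (N j) S) \<and>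
        bij_betw (fam_sum S I N \<iota>) (fin_families I N) (carrier S))"
  by (simp add: direct_sum_def fam_sum_def[abs_def] fin_families_def fam_supp_def)

locale hom_family =
  fixes R :: "('r, 'c) ring_scheme" and I :: "'i set" and N :: "'i \<Rightarrow> ('r, 'u) module"
    and L :: "('r, 'u) module" and t :: "'i \<Rightarrow> 'u \<Rightarrow> 'u"
  assumes modL: "module R L" and modN: "\<And>j. j \<in> I \<Longrightarrow> module R (N j)"
    and hom: "\<And>j. j \<in> I \<Longrightarrow> t j \<in> mod_hom R (N j) L"
begin

sublocale L: module R L by (rule modL)

lemma N_zero: "j \<in> I \<Longrightarrow> \<zero>\<^bsub>N j\<^esub> \<in> carrier (N j)"
  using modN[unfolded module_def] abelian_group.axioms(1) abelian_monoid.zero_closed by blast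

text \<open>The index set of the sum depends on the family \<open>x\<close>; over a common finite superset of the supports the
  sum is additive term by term.\<close>

lemma fam_sum_superset:
  assumes "x \<in> fin_families I N" "finite F" "fam_supp I N x \<subseteq> F" "F \<subseteq> I"
  shows "fam_sum L I N t x = finsum L (\<lambda>j. t j (x j)) F"
  unfolding fam_sum_def
proof (rule L.M.add.finprod_mono_neutral_cong_left)
  show "t j (x j) = \<zero>\<^bsub>L\<^esub>" if "j \<in> F - fam_supp I N x" for j
    using that assms(4) mod_hom_zero[OF modN modL hom, of j] by (auto simp: fam_supp_def)
  show "(\<lambda>j. t j (x j)) \<in> F \<rightarrow> carrier L"
    using assms(1,4) mod_hom_closed[OF hom] by (fastforce simp: fin_families_def PiE_iff)
qed (use assms in auto)

lemma fam_sum_closed: "x \<in> fin_families I N \<Longrightarrow> fam_sum L I N t x \<in> carrier L"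
  unfolding fam_sum_def using mod_hom_closed[OF hom]
  by (intro L.M.finsum_closed) (fastforce simp: fin_families_def fam_supp_def PiE_iff)

lemma fam_sum_add:
  assumes x: "x \<in> fin_families I N" and y: "y \<in> fin_families I N"
  defines "z \<equiv> \<lambda>j\<in>I. x j \<oplus>\<^bsub>N j\<^esub> y j"
  shows "z \<in> fin_families I N" "fam_sum L I N t z = fam_sum L I N t x \<oplus>\<^bsub>L\<^esub> fam_sum L I N t y"
proof -
  let ?F = "fam_supp I N x \<union> fam_supp I N y"
  have xc: "x j \<in> carrier (N j)" and yc: "y j \<in> carrier (N j)" if "j \<in> I" for j
    using that x y by (auto simp: fin_families_def PiE_iff)
  have ab: "abelian_group (N j)" if "j \<in> I" for j using modN[OF that] by (simp add: module_def)
  have F: "finite ?F" "?F \<subseteq> I" using x y by (auto simp: fin_families_def fam_supp_def)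
  have supp: "fam_supp I N z \<subseteq> ?F"
    using abelian_monoid.l_zero[OF abelian_group.axioms(1)[OF ab] N_zero]
    by (auto simp: fam_supp_def z_def)
  show z: "z \<in> fin_families I N"
    using finite_subset[OF supp F(1)] xc yc ab
    by (auto simp: fin_families_def z_def intro!: abelian_monoid.a_closed abelian_group.axioms(1))
  have "fam_sum L I N t z = finsum L (\<lambda>j. t j (x j) \<oplus>\<^bsub>L\<^esub> t j (y j)) ?F"
    unfolding fam_sum_superset[OF z F(1) supp F(2)]
  proof (rule L.M.finsum_cong')
    show "(\<lambda>j. t j (x j) \<oplus>\<^bsub>L\<^esub> t j (y j)) \<in> ?F \<rightarrow> carrier L"
      using F(2) xc yc mod_hom_closed[OF hom] by (auto intro!: L.M.add.m_closed)
    show "t j (z j) = t j (x j) \<oplus>\<^bsub>L\<^esub> t j (y j)" if "j \<in> ?F" for j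
      using that F(2) xc yc mod_hom_plus[OF hom] by (auto simp: z_def)
  qed simp
  also have "\<dots> = finsum L (\<lambda>j. t j (x j)) ?F \<oplus>\<^bsub>L\<^esub> finsum L (\<lambda>j. t j (y j)) ?F"
    using F(2) xc yc mod_hom_closed[OF hom] by (intro L.M.finsum_addf) auto
  finally show "fam_sum L I N t z = fam_sum L I N t x \<oplus>\<^bsub>L\<^esub> fam_sum L I N t y"
    using fam_sum_superset[OF x F(1) _ F(2)] fam_sum_superset[OF y F(1) _ F(2)] by simp
qed

lemma fam_sum_smult:
  assumes x: "x \<in> fin_families I N" and a: "a \<in> carrier R"
  defines "z \<equiv> \<lambda>j\<in>I. a \<odot>\<^bsub>N j\<^esub> x j"
  shows "z \<in> fin_families I N" "fam_sum L I N t z = a \<odot>\<^bsub>L\<^esub> fam_sum L I N t x"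
proof -
  let ?F = "fam_supp I N x"
  have xc: "x j \<in> carrier (N j)" if "j \<in> I" for j
    using that x by (auto simp: fin_families_def PiE_iff)
  have F: "finite ?F" "?F \<subseteq> I" using x by (auto simp: fin_families_def fam_supp_def)
  have supp: "fam_supp I N z \<subseteq> ?F"
    using module.smult_r_null[OF modN a] by (auto simp: fam_supp_def z_def)
  show z: "z \<in> fin_families I N"
    using finite_subset[OF supp F(1)] xc a
    by (auto simp: fin_families_def z_def intro!: module.smult_closed[OF modN])
  have "fam_sum L I N t z = finsum L (\<lambda>j. a \<odot>\<^bsub>L\<^esub> t j (x j)) ?F"
    unfolding fam_sum_superset[OF z F(1) supp F(2)]
  proof (rule L.M.finsum_cong')
    show "(\<lambda>j. a \<odot>\<^bsub>L\<^esub> t j (x j)) \<in> ?F \<rightarrow> carrier L"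
      using F(2) xc a mod_hom_closed[OF hom] by auto
    show "t j (z j) = a \<odot>\<^bsub>L\<^esub> t j (x j)" if "j \<in> ?F" for j
      using that F(2) xc a mod_hom_smult[OF hom] by (auto simp: z_def)
  qed simp
  also have "\<dots> = a \<odot>\<^bsub>L\<^esub> fam_sum L I N t x"
    unfolding fam_sum_def using F xc a mod_hom_closed[OF hom]
    by (intro L.finsum_smult_ldistr[symmetric]) auto
  finally show "fam_sum L I N t z = a \<odot>\<^bsub>L\<^esub> fam_sum L I N t x" .
qed

lemma fam_sum_single:
  assumes j: "j \<in> I" and v: "v \<in> carrier (N j)"
  defines "z \<equiv> \<lambda>i\<in>I. if i = j then v else \<zero>\<^bsub>N i\<^esub>"
  shows "z \<in> fin_families I N" "fam_sum L I N t z = t j v"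
proof -
  have supp: "fam_supp I N z \<subseteq> {j}" by (auto simp: fam_supp_def z_def)
  show z: "z \<in> fin_families I N"
    using finite_subset[OF supp] v N_zero by (auto simp: fin_families_def z_def)
  show "fam_sum L I N t z = t j v"
    using fam_sum_superset[OF z _ supp] j mod_hom_closed[OF hom[OF j] v] by (simp add: z_def)
qed

end

text \<open>The homomorphism with components \<open>h j\<close> sends the element with coordinate family \<open>x\<close> to the sum of the
  \<open>h j (x j)\<close>.\<close>

lemma direct_sum_universal:
  fixes N :: "'i \<Rightarrow> ('r, 'u) module"
  assumes "direct_sum R I N S"
  obtains \<iota> where "\<forall>j\<in>I. \<iota> j \<in> mod_hom R (N j) S"
    "\<forall>(L :: ('r, 'u) module) h. module R L \<longrightarrow> (\<forall>j\<in>I. h j \<in> mod_hom R (N j) L) \<longrightarrow>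
        (\<exists>H\<in>mod_hom R S L. \<forall>j\<in>I. \<forall>x\<in>carrier (N j). H (\<iota> j x) = h j x)"
    "\<forall>(L :: ('r, 'u) module) f g. module R L \<longrightarrow> f \<in> mod_hom R S L \<longrightarrow> g \<in> mod_hom R S L \<longrightarrow>
        (\<forall>j\<in>I. \<forall>x\<in>carrier (N j). f (\<iota> j x) = g (\<iota> j x)) \<longrightarrow> (\<forall>x\<in>carrier S. f x = g x)"
proof -
  obtain \<iota> where S: "module R S" and N: "\<And>j. j \<in> I \<Longrightarrow> module R (N j)"
    and \<iota>: "\<And>j. j \<in> I \<Longrightarrow> \<iota> j \<in> mod_hom R (N j) S"
    and bij: "bij_betw (fam_sum S I N \<iota>) (fin_families I N) (carrier S)"
    using assms by (auto simp: direct_sum_iff)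
  interpret S: hom_family R I N S \<iota> by (rule hom_family.intro) (use S N \<iota> in auto)
  let ?\<beta> = "fam_sum S I N \<iota>"
  have surj: "\<exists>u\<in>fin_families I N. x = ?\<beta> u" if "x \<in> carrier S" for x
    using bij that by (auto simp: bij_betw_def)
  show thesis
  proof (rule that[of \<iota>]; (intro allI impI ballI)?)
    show "\<iota> j \<in> mod_hom R (N j) S" if "j \<in> I" for j by (rule \<iota>[OF that])
  next
    fix L :: "('r, 'u) module" and h
    assume L: "module R L" and h: "\<forall>j\<in>I. h j \<in> mod_hom R (N j) L"
    interpret L: hom_family R I N L h by (rule hom_family.intro) (use L N h in auto)
    define H where "H = fam_sum L I N h \<circ> inv_into (fin_families I N) ?\<beta>"
    have H: "H (?\<beta> u) = fam_sum L I N h u" if "u \<in> fin_families I N" for u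
      using bij that by (simp add: H_def bij_betw_def)
    have "H \<in> mod_hom R S L"
    proof (rule mod_homI)
      fix x assume "x \<in> carrier S"
      then show "H x \<in> carrier L" using surj[of x] H L.fam_sum_closed by auto
    next
      fix x y assume "x \<in> carrier S" "y \<in> carrier S"
      then obtain u v where uv: "u \<in> fin_families I N" "x = ?\<beta> u" "v \<in> fin_families I N" "y = ?\<beta> v"
        using surj by metis
      show "H (x \<oplus>\<^bsub>S\<^esub> y) = H x \<oplus>\<^bsub>L\<^esub> H y"
        unfolding uv(2,4) S.fam_sum_add(2)[OF uv(1,3), symmetric] H[OF S.fam_sum_add(1)[OF uv(1,3)]]
          H[OF uv(1)] H[OF uv(3)] by (rule L.fam_sum_add(2)[OF uv(1,3)])
    next
      fix a x assume a: "a \<in> carrier R" and "x \<in> carrier S"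
      then obtain u where u: "u \<in> fin_families I N" "x = ?\<beta> u" using surj by metis
      show "H (a \<odot>\<^bsub>S\<^esub> x) = a \<odot>\<^bsub>L\<^esub> H x"
        unfolding u(2) S.fam_sum_smult(2)[OF u(1) a, symmetric] H[OF S.fam_sum_smult(1)[OF u(1) a]]
          H[OF u(1)] by (rule L.fam_sum_smult(2)[OF u(1) a])
    qed
    moreover have "H (\<iota> j x) = h j x" if "j \<in> I" "x \<in> carrier (N j)" for j x
      unfolding S.fam_sum_single(2)[OF that, symmetric] H[OF S.fam_sum_single(1)[OF that]]
      by (rule L.fam_sum_single(2)[OF that])
    ultimately show "\<exists>H\<in>mod_hom R S L. \<forall>j\<in>I. \<forall>x\<in>carrier (N j). H (\<iota> j x) = h j x" by blast
  next
    fix L :: "('r, 'u) module" and f g x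
    assume L: "module R L" and f: "f \<in> mod_hom R S L" and g: "g \<in> mod_hom R S L"
      and eq: "\<forall>j\<in>I. \<forall>x\<in>carrier (N j). f (\<iota> j x) = g (\<iota> j x)"
      and x: "x \<in> carrier S"
    obtain u where u: "u \<in> fin_families I N" "x = ?\<beta> u" using surj[OF x] by metis
    have fin: "finite (fam_supp I N u)" and c: "(\<lambda>j. \<iota> j (u j)) \<in> fam_supp I N u \<rightarrow> carrier S"
      using u(1) mod_hom_closed[OF \<iota>] by (auto simp: fin_families_def fam_supp_def PiE_iff)
    interpret L: module R L by fact
    have "finsum L (\<lambda>j. f (\<iota> j (u j))) (fam_supp I N u) = finsum L (\<lambda>j. g (\<iota> j (u j))) (fam_supp I N u)"
      using u(1) c mod_hom_closed[OF g]
      by (intro L.M.finsum_cong') (auto simp: fin_families_def fam_supp_def PiE_iff eq)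
    then show "f x = g x"
      unfolding u(2) fam_sum_def
      by (simp add: mod_hom_finsum[OF S L f fin c] mod_hom_finsum[OF S L g fin c])
  qed
qed

section \<open>The stable category when projectives are injective\<close>

text \<open>Stable vanishing as a property of a single map, without a second map to compare with.\<close>

definition proj_null ::
    "('r, 'c) ring_scheme \<Rightarrow> ('r, 'u) module \<Rightarrow> ('r, 'u) module \<Rightarrow> ('u \<Rightarrow> 'u) \<Rightarrow> bool" where
  "proj_null R M N d \<longleftrightarrow> (\<exists>P :: ('r, 'u) module. projective R P \<and>
     (\<exists>a\<in>mod_hom R M P. \<exists>b\<in>mod_hom R P N. \<forall>x\<in>carrier M. d x = b (a x)))"

lemma stab_eq_iff: "stab_eq R M N f g \<longleftrightarrow> proj_null R M N (\<lambda>x. f x \<ominus>\<^bsub>N\<^esub> g x)"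
  by (simp add: stab_eq_def proj_null_def)

lemma proj_null_cong:
  "proj_null R M N d \<Longrightarrow> (\<And>x. x \<in> carrier M \<Longrightarrow> d' x = d x) \<Longrightarrow> proj_null R M N d'"
  unfolding proj_null_def by simp

lemma stab_zero_iff:
  assumes "module R N" "f \<in> mod_hom R M N"
  shows "stab_zero R M N f \<longleftrightarrow> proj_null R M N f"
proof -
  interpret N: module R N by fact
  have eq: "f x \<ominus>\<^bsub>N\<^esub> \<zero>\<^bsub>N\<^esub> = f x" if "x \<in> carrier M" for x
    using mod_hom_closed[OF assms(2) that] by (rule N.M.minus_zero_right)
  show ?thesis unfolding stab_zero_def stab_eq_iff
    by (rule iffI; erule proj_null_cong) (simp_all add: eq)
qed

lemma projective_module: "projective R P \<Longrightarrow> module R P"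
  by (simp add: projective_def)

lemma projective_lift:
  fixes P X N :: "('r, 'u) module"
  assumes "projective R P" "module R X" "module R N" "g \<in> mod_hom R X N"
    "g ` carrier X = carrier N" "f \<in> mod_hom R P N"
  obtains h where "h \<in> mod_hom R P X" "\<And>x. x \<in> carrier P \<Longrightarrow> g (h x) = f x"
proof -
  have "\<forall>g\<in>mod_hom R X N. \<forall>f\<in>mod_hom R P N. g ` carrier X = carrier N \<longrightarrow>
      (\<exists>h\<in>mod_hom R P X. \<forall>x\<in>carrier P. g (h x) = f x)"
    using assms(1-3) unfolding projective_def by simp
  then have "\<exists>h\<in>mod_hom R P X. \<forall>x\<in>carrier P. g (h x) = f x"
    using assms(4-6) by blast
  then show thesis using that by blast
qed

lemma proj_null_comp_left:
  fixes M N L :: "('r, 'u) module"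
  shows "proj_null R M N d \<Longrightarrow> g \<in> mod_hom R N L \<Longrightarrow> proj_null R M L (\<lambda>x. g (d x))"
proof -
  assume "proj_null R M N d" and g: "g \<in> mod_hom R N L"
  then obtain P :: "('r, 'u) module" and a b where P: "projective R P" "a \<in> mod_hom R M P"
    "b \<in> mod_hom R P N" "\<And>x. x \<in> carrier M \<Longrightarrow> d x = b (a x)" unfolding proj_null_def by blast
  show ?thesis unfolding proj_null_def
    using P mod_hom_comp'[OF P(3) g]
    by (intro exI[of _ P] conjI bexI[of _ a] bexI[of _ "\<lambda>x. g (b x)"] ballI) auto
qed

lemma proj_null_comp_right:
  fixes M N L :: "('r, 'u) module"
  shows "proj_null R M N d \<Longrightarrow> f \<in> mod_hom R L M \<Longrightarrow> proj_null R L N (\<lambda>x. d (f x))"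
proof -
  assume "proj_null R M N d" and f: "f \<in> mod_hom R L M"
  then obtain P :: "('r, 'u) module" and a b where P: "projective R P" "a \<in> mod_hom R M P"
    "b \<in> mod_hom R P N" "\<And>x. x \<in> carrier M \<Longrightarrow> d x = b (a x)" unfolding proj_null_def by blast
  show ?thesis unfolding proj_null_def
    using P mod_hom_closed[OF f] mod_hom_comp'[OF f P(2)]
    by (intro exI[of _ P] conjI bexI[of _ "\<lambda>x. a (f x)"] bexI[of _ b] ballI) auto
qed

lemma proj_null_uminus:
  fixes M N :: "('r, 'u) module"
  assumes "module R N" "proj_null R M N d"
  shows "proj_null R M N (\<lambda>x. \<ominus>\<^bsub>N\<^esub> d x)"
proof -
  interpret N: module R N by fact
  have neg: "(\<lambda>x. \<ominus>\<^bsub>R\<^esub> \<one>\<^bsub>R\<^esub> \<odot>\<^bsub>N\<^esub> x) \<in> mod_hom R N N" by (rule mod_hom_scale[OF assms(1)]) simp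
  have dN: "d x \<in> carrier N" if "x \<in> carrier M" for x
  proof -
    obtain P :: "('r, 'u) module" and a b where "a \<in> mod_hom R M P" "b \<in> mod_hom R P N"
      "\<forall>x\<in>carrier M. d x = b (a x)" using assms(2) unfolding proj_null_def by blast
    then show ?thesis using that by (simp add: mod_hom_closed[of b R P] mod_hom_closed[of a R M])
  qed
  show ?thesis
    by (rule proj_null_cong[OF proj_null_comp_left[OF assms(2) neg]])
      (simp add: N.smult_l_minus dN)
qed

text \<open>The properties of the group algebra on which the formal part rests.\<close>

locale frobenius_modules =
  fixes R :: "('r, 'c) ring_scheme" and U :: "'u itself"
  assumes enough_projectives: "module R (M :: ('r, 'u) module) \<Longrightarrow>
      \<exists>P q. projective R P \<and> q \<in> mod_hom R P M \<and> q ` carrier P = carrier M"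
    and enough_injectives: "module R (M :: ('r, 'u) module) \<Longrightarrow>
      \<exists>P i. projective R P \<and> i \<in> mod_hom R M P \<and> inj_on i (carrier M)"
    and projective_extend: "projective R (P :: ('r, 'u) module) \<Longrightarrow> module R X \<Longrightarrow> module R Y \<Longrightarrow>
      i \<in> mod_hom R X Y \<Longrightarrow> inj_on i (carrier X) \<Longrightarrow> f \<in> mod_hom R X P \<Longrightarrow>
      \<exists>h\<in>mod_hom R Y P. \<forall>x\<in>carrier X. h (i x) = f x"
begin

text \<open>Since projectives lift, one projective module over the target serves for all stably trivial maps. This
  makes them closed under addition without forming direct sums of projectives.\<close>

lemma proj_null_iff_lift:
  fixes M N E :: "('r, 'u) module"
  assumes N: "module R N" and E: "projective R E"
    and q: "q \<in> mod_hom R E N" "q ` carrier E = carrier N"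
  shows "proj_null R M N d \<longleftrightarrow> (\<exists>h\<in>mod_hom R M E. \<forall>x\<in>carrier M. d x = q (h x))"
proof
  assume "proj_null R M N d"
  then obtain P :: "('r, 'u) module" and a b where P: "projective R P" "a \<in> mod_hom R M P"
    "b \<in> mod_hom R P N" "\<And>x. x \<in> carrier M \<Longrightarrow> d x = b (a x)" by (auto simp: proj_null_def)
  obtain c where c: "c \<in> mod_hom R P E" "\<And>x. x \<in> carrier P \<Longrightarrow> q (c x) = b x"
    using projective_lift[OF P(1) projective_module[OF E] N q P(3)] by blast
  show "\<exists>h\<in>mod_hom R M E. \<forall>x\<in>carrier M. d x = q (h x)"
    by (rule bexI[OF _ mod_hom_comp'[OF P(2) c(1)]]) (simp add: c(2) P(4) mod_hom_closed[OF P(2)])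
next
  assume "\<exists>h\<in>mod_hom R M E. \<forall>x\<in>carrier M. d x = q (h x)"
  then obtain h where h: "h \<in> mod_hom R M E" "\<forall>x\<in>carrier M. d x = q (h x)" ..
  show "proj_null R M N d" unfolding proj_null_def
    by (intro exI[of _ E] conjI E bexI[OF _ h(1)] bexI[OF _ q(1)] h(2))
qed

lemma proj_null_add:
  fixes M N :: "('r, 'u) module"
  assumes M: "module R M" and N: "module R N" and d: "proj_null R M N d" "proj_null R M N d'"
  shows "proj_null R M N (\<lambda>x. d x \<oplus>\<^bsub>N\<^esub> d' x)"
proof -
  obtain E :: "('r, 'u) module" and q where E: "projective R E" "q \<in> mod_hom R E N"
    "q ` carrier E = carrier N" using enough_projectives[OF N] by blast
  note iff = proj_null_iff_lift[OF N E]
  obtain h h' where h: "h \<in> mod_hom R M E" "\<And>x. x \<in> carrier M \<Longrightarrow> d x = q (h x)"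
    "h' \<in> mod_hom R M E" "\<And>x. x \<in> carrier M \<Longrightarrow> d' x = q (h' x)"
    using d unfolding iff by auto
  show ?thesis unfolding iff
  proof (rule bexI[of _ "\<lambda>x. h x \<oplus>\<^bsub>E\<^esub> h' x"])
    show "\<forall>x\<in>carrier M. d x \<oplus>\<^bsub>N\<^esub> d' x = q (h x \<oplus>\<^bsub>E\<^esub> h' x)"
      using mod_hom_plus[OF E(2) mod_hom_closed[OF h(1)] mod_hom_closed[OF h(3)]] h(2,4) by simp
  qed (rule mod_hom_add_map[OF projective_module[OF E(1)] h(1,3)])
qed

lemma proj_null_zero:
  fixes M N :: "('r, 'u) module"
  assumes M: "module R M" and N: "module R N"
  shows "proj_null R M N (\<lambda>_. \<zero>\<^bsub>N\<^esub>)"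
proof -
  obtain E :: "('r, 'u) module" and q where E: "projective R E" "q \<in> mod_hom R E N"
    "q ` carrier E = carrier N" using enough_projectives[OF N] by blast
  show ?thesis unfolding proj_null_iff_lift[OF N E]
    by (intro bexI[of _ "\<lambda>_. \<zero>\<^bsub>E\<^esub>"] ballI mod_hom_zero_map projective_module[OF E(1)])
      (rule mod_hom_zero[OF projective_module[OF E(1)] N E(2), symmetric])
qed

lemma stab_eq_on_carrier:
  fixes M N :: "('r, 'u) module"
  assumes M: "module R M" and N: "module R N" and f: "f \<in> mod_hom R M N"
    and eq: "\<And>x. x \<in> carrier M \<Longrightarrow> f x = g x"
  shows "stab_eq R M N f g"
proof -
  interpret N: module R N by fact
  show ?thesis unfolding stab_eq_iff
    by (rule proj_null_cong[OF proj_null_zero[OF M N]])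
      (simp add: eq[symmetric] mod_hom_closed[OF f] N.M.minus_eq_zero_iff)
qed

lemma stab_eq_sym:
  fixes M N :: "('r, 'u) module"
  assumes N: "module R N" and f: "f \<in> mod_hom R M N" "g \<in> mod_hom R M N"
    and fg: "stab_eq R M N f g"
  shows "stab_eq R M N g f"
proof -
  interpret N: module R N by fact
  show ?thesis using proj_null_uminus[OF N fg[unfolded stab_eq_iff]] unfolding stab_eq_iff
    by (rule proj_null_cong)
      (simp add: a_minus_def N.M.minus_add N.M.a_comm mod_hom_closed[OF f(1)] mod_hom_closed[OF f(2)])
qed

lemma stab_eq_trans:
  fixes M N :: "('r, 'u) module"
  assumes M: "module R M" and N: "module R N"
    and f: "f \<in> mod_hom R M N" "g \<in> mod_hom R M N" "h \<in> mod_hom R M N"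
    and fg: "stab_eq R M N f g" and gh: "stab_eq R M N g h"
  shows "stab_eq R M N f h"
proof -
  interpret N: module R N by fact
  show ?thesis using proj_null_add[OF M N fg[unfolded stab_eq_iff] gh[unfolded stab_eq_iff]]
    unfolding stab_eq_iff
    by (rule proj_null_cong)
      (simp add: a_minus_def N.M.a_assoc N.M.r_neg1 mod_hom_closed[OF f(1)] mod_hom_closed[OF f(2)]
        mod_hom_closed[OF f(3)])
qed

lemma proj_null_stab_eq:
  fixes M N :: "('r, 'u) module"
  assumes M: "module R M" and N: "module R N" and f: "f \<in> mod_hom R M N" "g \<in> mod_hom R M N"
    and fg: "stab_eq R M N f g" and g: "proj_null R M N g"
  shows "proj_null R M N f"
proof -
  interpret N: module R N by fact
  show ?thesis using proj_null_add[OF M N fg[unfolded stab_eq_iff] g]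
    by (rule proj_null_cong)
      (simp add: a_minus_def N.M.a_assoc N.M.l_neg mod_hom_closed[OF f(1)] mod_hom_closed[OF f(2)])
qed

lemma stab_eq_comp_left:
  fixes M N L :: "('r, 'u) module"
  assumes N: "module R N" and L: "module R L"
    and f: "f \<in> mod_hom R M N" "g \<in> mod_hom R M N" and h: "h \<in> mod_hom R N L"
    and fg: "stab_eq R M N f g"
  shows "stab_eq R M L (h \<circ> f) (h \<circ> g)"
  using proj_null_comp_left[OF fg[unfolded stab_eq_iff] h] unfolding stab_eq_iff
  by (rule proj_null_cong) (simp add: mod_hom_minus[OF N L h] mod_hom_closed[OF f(1)] mod_hom_closed[OF f(2)])

lemma stab_eq_comp_right:
  fixes M N L :: "('r, 'u) module"
  assumes "h \<in> mod_hom R L M" and fg: "stab_eq R M N f g"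
  shows "stab_eq R L N (f \<circ> h) (g \<circ> h)"
  using proj_null_comp_right[OF fg[unfolded stab_eq_iff] assms(1)] by (simp add: stab_eq_iff)

lemma Omega_exact:
  fixes M :: "('r, 'u) module"
  assumes M: "module R M"
  obtains P :: "('r, 'u) module" and i q where "projective R P" "short_exact R (Omega R M) i P q M"
proof -
  obtain P :: "('r, 'u) module" and q where P: "projective R P" "q \<in> mod_hom R P M"
    "q ` carrier P = carrier M" using enough_projectives[OF M] by (elim exE conjE)
  have "\<exists>N P i q. projective R P \<and> short_exact R (N :: ('r, 'u) module) i P q M"
    by (intro exI conjI, rule P(1), rule short_exact_kernel[OF projective_module[OF P(1)] M P(2,3)])
  then have "\<exists>P i q. projective R P \<and> short_exact R (Omega R M) i P q M"
    unfolding Omega_def by (rule someI_ex)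
  then show thesis using that by (elim exE conjE)
qed

lemma Sigma_exact:
  fixes X :: "('r, 'u) module"
  assumes X: "module R X"
  obtains P i q where "Sigma_seq R X = (P, i, q, Sig R X)" "projective R P"
    "short_exact R X i P q (Sig R X)"
proof -
  obtain P :: "('r, 'u) module" and i where P: "projective R P" "i \<in> mod_hom R X P"
    "inj_on i (carrier X)" using enough_injectives[OF X] by (elim exE conjE)
  obtain W :: "('r, 'u) module" and q where "short_exact R X i P q W"
    using short_exact_quotient[OF X projective_module[OF P(1)] P(2,3)] .
  then have "case (P, i, q, W) of (P, i, q, W) \<Rightarrow> projective R P \<and> short_exact R X i P q W"
    using P(1) by simp
  then have *: "case Sigma_seq R X of (P, i, q, W) \<Rightarrow> projective R P \<and> short_exact R X i P q W"
    unfolding Sigma_seq_def by (rule someI)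
  obtain P' i' q' W' where S: "Sigma_seq R X = (P', i', q', W')" by (rule prod_cases4)
  then have "Sig R X = W'" by (simp add: Sig_def)
  with S * show thesis using that by simp
qed

lemma module_Omega: "module R (M :: ('r, 'u) module) \<Longrightarrow> module R (Omega R M)"
  by (rule Omega_exact) (auto dest: short_exactD(1))

lemma module_Sig: "module R (M :: ('r, 'u) module) \<Longrightarrow> module R (Sig R M)"
  by (rule Sigma_exact) (auto dest: short_exactD(3))

section \<open>Triangles and thick subcategories\<close>

lemma stab_iso_ident:
  fixes X :: "('r, 'u) module"
  assumes X: "module R X" shows "stab_iso R X X id"
  unfolding stab_iso_def using stab_eq_on_carrier[OF X X mod_hom_ident(1)]
  by (intro conjI bexI[of _ id] mod_hom_ident(1)) simp_all

text \<open>The embedding of \<open>X\<close> into a projective module extends to \<open>Y\<close> because that module is also injective, and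
  the extension induces the third map.\<close>

lemma triangle_of_short_exact:
  fixes X Y Z :: "('r, 'u) module"
  assumes se: "short_exact R X f Y g Z"
  obtains h where "triangle R X Y Z f g h"
proof -
  note D = short_exactD[OF se]
  obtain P i q where S: "Sigma_seq R X = (P, i, q, Sig R X)" "projective R P"
    "short_exact R X i P q (Sig R X)" using Sigma_exact[OF D(1)] .
  note SD = short_exactD[OF S(3)]
  obtain u where u: "u \<in> mod_hom R Y P" "\<forall>x\<in>carrier X. u (f x) = i x"
    using projective_extend[OF S(2) D(1,2,4,6) SD(4)] by (elim bexE)
  have ker: "q (u y) = \<zero>\<^bsub>Sig R X\<^esub>" if y: "y \<in> carrier Y" "g y = \<zero>\<^bsub>Z\<^esub>" for y
  proof -
    obtain x where "x \<in> carrier X" "y = f x" using short_exact_preimage[OF se y] .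
    then show ?thesis using u(2) SD(9) by simp
  qed
  obtain h where h: "h \<in> mod_hom R Z (Sig R X)" "\<forall>y\<in>carrier Y. h (g y) = q (u y)"
    using mod_hom_factor_through_surjection[OF D(2,3) SD(3) D(5,8) mod_hom_comp'[OF u(1) SD(5)] ker] .
  have st: "standard_triangle R X Y Z f g h"
    unfolding standard_triangle_def S(1) prod.case by (intro conjI se h(1) bexI[OF _ u(1)] u(2) h(2))
  have rep: "represents_Sigma R X X id id"
    unfolding represents_Sigma_def S(1) by (auto intro!: mod_hom_ident bexI[of _ id])
  have 1: "stab_eq R X Y (id \<circ> f) (f \<circ> id)"
    by (rule stab_eq_on_carrier[OF D(1,2) mod_hom_comp[OF D(4) mod_hom_ident(1)]]) simp
  have 2: "stab_eq R Y Z (id \<circ> g) (g \<circ> id)"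
    by (rule stab_eq_on_carrier[OF D(2,3) mod_hom_comp[OF D(5) mod_hom_ident(1)]]) simp
  have 3: "stab_eq R Z (Sig R X) (id \<circ> h) (h \<circ> id)"
    by (rule stab_eq_on_carrier[OF D(3) SD(3) mod_hom_comp[OF h(1) mod_hom_ident(1)]]) simp
  have "triangle R X Y Z f g h"
    unfolding triangle_def
    by (intro conjI D(1-5) h(1), rule exI[of _ X], rule exI[of _ Y], rule exI[of _ Z],
        rule exI[of _ f], rule exI[of _ g], rule exI[of _ h], rule exI[of _ id], rule exI[of _ id],
        rule exI[of _ id], rule exI[of _ id])
      (intro conjI st rep stab_iso_ident D(1-3) 1 2 3)
  then show thesis by (rule that)
qed

lemma triangle_modules:
  assumes "triangle R X Y Z f g h"
  shows "module R X" "module R Y" "module R Z" "f \<in> mod_hom R X Y" "g \<in> mod_hom R Y Z"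
  using assms unfolding triangle_def by simp_all

text \<open>This keeps \<open>Thick\<close> inside the modules, being an intersection to which the class of all modules
  contributes.\<close>

lemma thick_all_modules: "thick_subcategory R {M :: ('r, 'u) module. module R M}"
  unfolding thick_subcategory_def
proof (intro conjI ballI allI impI; (unfold mem_Collect_eq)?)
  show "module R X" if "zero_object R X" for X :: "('r, 'u) module"
    using that unfolding zero_object_def by simp
  show "module R X" if "stab_retract R X Y" for X Y :: "('r, 'u) module"
    using that unfolding stab_retract_def by simp
qed (simp_all add: module_Omega module_Sig triangle_modules)

lemma Thick_module:
  fixes T X :: "('r, 'u) module"
  assumes "X \<in> Thick R T" "module R T" shows "module R X"
  using InterD[OF assms(1)[unfolded Thick_def], of "{M. module R M}"] thick_all_modules assms(2) by simp

lemma thick_extension: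
  fixes X Y Z :: "('r, 'u) module"
  assumes C: "thick_subcategory R C" and se: "short_exact R X f Y g Z" and XZ: "X \<in> C" "Z \<in> C"
  shows "Y \<in> C"
proof -
  obtain h where "triangle R X Y Z f g h" using triangle_of_short_exact[OF se] .
  note this = C[unfolded thick_subcategory_def, THEN conjunct2, THEN conjunct2, THEN conjunct2,
      THEN conjunct1, THEN spec, THEN spec, THEN spec, THEN spec, THEN spec, THEN spec, THEN mp, OF this]
  then show ?thesis using XZ by simp
qed

lemma thick_zero_object:
  assumes "thick_subcategory R C" "zero_object R X" shows "X \<in> C"
  by (rule assms(1)[unfolded thick_subcategory_def, THEN conjunct2, THEN conjunct1, THEN spec, THEN mp, OF assms(2)])

lemma zero_object_trivial_carrier:
  fixes Z :: "('r, 'u) module"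
  assumes Z: "module R Z" and c: "carrier Z = {\<zero>\<^bsub>Z\<^esub>}"
  shows "zero_object R Z"
  unfolding zero_object_def
proof (intro conjI allI impI ballI Z)
  fix M :: "('r, 'u) module" and f g
  assume M: "module R M" and f: "f \<in> mod_hom R M Z" and g: "g \<in> mod_hom R M Z"
  show "stab_eq R M Z f g"
    by (rule stab_eq_on_carrier[OF M Z f]) (use mod_hom_closed[OF f] mod_hom_closed[OF g] c in simp)
next
  fix M :: "('r, 'u) module" and f g
  assume M: "module R M" and f: "f \<in> mod_hom R Z M" and g: "g \<in> mod_hom R Z M"
  show "stab_eq R Z M f g"
    by (rule stab_eq_on_carrier[OF Z M f]) (simp add: c mod_hom_zero[OF Z M f] mod_hom_zero[OF Z M g])
qed

text \<open>Extend the first factor of \<open>\<phi> f\<close> from \<open>X\<close> to \<open>Y\<close>, by injectivity of the projective module in the middle.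
  Subtracting the resulting stably trivial map from \<open>\<phi>\<close> leaves a map that vanishes on \<open>X\<close> and so descends
  to \<open>Z\<close>.\<close>

lemma short_exact_stab_factor:
  fixes X Y Z L :: "('r, 'u) module"
  assumes se: "short_exact R X f Y g Z" and L: "module R L" and \<phi>: "\<phi> \<in> mod_hom R Y L"
    and null: "proj_null R X L (\<phi> \<circ> f)"
  obtains \<psi> where "\<psi> \<in> mod_hom R Z L" "stab_eq R Y L \<phi> (\<psi> \<circ> g)"
proof -
  note D = short_exactD[OF se]
  interpret L: module R L by (rule L)
  obtain P :: "('r, 'u) module" and a b where P: "projective R P" "a \<in> mod_hom R X P"
    "b \<in> mod_hom R P L" "\<forall>x\<in>carrier X. (\<phi> \<circ> f) x = b (a x)" 
    using null unfolding proj_null_def by (elim exE conjE bexE)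
  obtain a' where a': "a' \<in> mod_hom R Y P" "\<forall>x\<in>carrier X. a' (f x) = a x"
    using projective_extend[OF P(1) D(1,2,4,6) P(2)] by (elim bexE)
  note ba' = mod_hom_comp'[OF a'(1) P(3)]
  have ker: "\<phi> y \<ominus>\<^bsub>L\<^esub> b (a' y) = \<zero>\<^bsub>L\<^esub>" if y: "y \<in> carrier Y" "g y = \<zero>\<^bsub>Z\<^esub>" for y
  proof -
    obtain x where "x \<in> carrier X" "y = f x" using short_exact_preimage[OF se y] .
    then show ?thesis
      using a'(2) P(4) mod_hom_closed[OF P(3) mod_hom_closed[OF P(2)]] by (simp add: L.M.minus_eq_zero_iff)
  qed
  obtain \<psi> where \<psi>: "\<psi> \<in> mod_hom R Z L" "\<forall>y\<in>carrier Y. \<psi> (g y) = \<phi> y \<ominus>\<^bsub>L\<^esub> b (a' y)"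
    using mod_hom_factor_through_surjection[OF D(2,3) L D(5,8) mod_hom_diff_map[OF L \<phi> ba'] ker] .
  have "\<phi> y \<ominus>\<^bsub>L\<^esub> (\<psi> \<circ> g) y = b (a' y)" if "y \<in> carrier Y" for y
    using that \<psi>(2)[rule_format, OF that] mod_hom_closed[OF \<phi> that] mod_hom_closed[OF ba' that]
    by (simp add: a_minus_def L.M.minus_add L.M.r_neg2)
  then have "stab_eq R Y L \<phi> (\<psi> \<circ> g)"
    unfolding stab_eq_def by (intro exI[of _ P] conjI P(1) bexI[OF _ a'(1)] bexI[OF _ P(3)] ballI)
  then show thesis using that[OF \<psi>(1)] by simp
qed

text \<open>Transport of the preceding lemma along the isomorphism with a standard triangle.\<close>

lemma triangle_stab_factor:
  fixes X Y Z L :: "('r, 'u) module"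
  assumes tri: "triangle R X Y Z f g h" and L: "module R L" and \<phi>: "\<phi> \<in> mod_hom R Y L"
    and null: "proj_null R X L (\<phi> \<circ> f)"
  obtains \<psi> where "\<psi> \<in> mod_hom R Z L" "stab_eq R Y L \<phi> (\<psi> \<circ> g)"
proof -
  note m = triangle_modules[OF tri]
  obtain X' Y' Z' f' g' h' a b c s where
    st: "standard_triangle R X' Y' Z' f' g' h'" and
    iso: "stab_iso R X X' a" "stab_iso R Y Y' b" "stab_iso R Z Z' c" and
    comm: "stab_eq R X Y' (b \<circ> f) (f' \<circ> a)" "stab_eq R Y Z' (c \<circ> g) (g' \<circ> b)"
    using tri unfolding triangle_def by (elim exE conjE)
  have se: "short_exact R X' f' Y' g' Z'" using st unfolding standard_triangle_def by simp
  note m' = short_exactD(1-5)[OF se]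
  obtain a' where a: "a \<in> mod_hom R X X'" "a' \<in> mod_hom R X' X" "stab_eq R X' X' (a \<circ> a') id"
    using iso(1) unfolding stab_iso_def by (elim conjE bexE)
  obtain b' where b: "b \<in> mod_hom R Y Y'" "b' \<in> mod_hom R Y' Y" "stab_eq R Y Y (b' \<circ> b) id"
    using iso(2) unfolding stab_iso_def by (elim conjE bexE)
  have c: "c \<in> mod_hom R Z Z'" using iso(3) unfolding stab_iso_def by (rule conjunct1)
  define \<phi>' where "\<phi>' = \<phi> \<circ> b'"
  have \<phi>': "\<phi>' \<in> mod_hom R Y' L" unfolding \<phi>'_def by (rule mod_hom_comp[OF b(2) \<phi>])
  \<comment> \<open>\<open>\<phi>' f' \<sim> \<phi>' f' a a' \<sim> \<phi>' b f a' \<sim> \<phi> f a' \<sim> 0\<close>\<close>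
  have 1: "proj_null R X' L ((\<phi> \<circ> f) \<circ> a')"
    using proj_null_comp_right[OF null a(2)] by (simp add: o_def)
  have 2: "stab_eq R X' L ((\<phi>' \<circ> b \<circ> f) \<circ> a') ((\<phi> \<circ> f) \<circ> a')"
    using stab_eq_comp_right[OF mod_hom_comp[OF a(2) m(4)]
        stab_eq_comp_left[OF m(2) L mod_hom_comp[OF b(1,2)] mod_hom_ident(1) \<phi> b(3)]]
    by (simp add: \<phi>'_def o_assoc)
  have 3: "stab_eq R X' L ((\<phi>' \<circ> f' \<circ> a) \<circ> a') ((\<phi>' \<circ> b \<circ> f) \<circ> a')"
    using stab_eq_comp_right[OF a(2) stab_eq_comp_left[OF m'(2) L mod_hom_comp[OF a(1) m'(4)]
          mod_hom_comp[OF m(4) b(1)] \<phi>' stab_eq_sym[OF m'(2) mod_hom_comp[OF m(4) b(1)]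
            mod_hom_comp[OF a(1) m'(4)] comm(1)]]]
    by (simp add: o_assoc)
  have 4: "stab_eq R X' L (\<phi>' \<circ> f') ((\<phi>' \<circ> f' \<circ> a) \<circ> a')"
    using stab_eq_comp_left[OF m'(1) L mod_hom_ident(1) mod_hom_comp[OF a(2,1)] mod_hom_comp[OF m'(4) \<phi>']
        stab_eq_sym[OF m'(1) mod_hom_comp[OF a(2,1)] mod_hom_ident(1) a(3)]]
    by (simp add: o_assoc)
  have h1: "(\<phi> \<circ> f) \<circ> a' \<in> mod_hom R X' L" by (rule mod_hom_comp[OF a(2) mod_hom_comp[OF m(4) \<phi>]])
  have h2: "(\<phi>' \<circ> b \<circ> f) \<circ> a' \<in> mod_hom R X' L"
    by (rule mod_hom_comp[OF a(2) mod_hom_comp[OF m(4) mod_hom_comp[OF b(1) \<phi>']]])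
  have h3: "(\<phi>' \<circ> f' \<circ> a) \<circ> a' \<in> mod_hom R X' L"
    by (rule mod_hom_comp[OF a(2) mod_hom_comp[OF a(1) mod_hom_comp[OF m'(4) \<phi>']]])
  have h4: "\<phi>' \<circ> f' \<in> mod_hom R X' L" by (rule mod_hom_comp[OF m'(4) \<phi>'])
  note p2 = proj_null_stab_eq[OF m'(1) L h2 h1 2 1]
  note p3 = proj_null_stab_eq[OF m'(1) L h3 h2 3 p2]
  note p4 = proj_null_stab_eq[OF m'(1) L h4 h3 4 p3]
  obtain \<psi>' where \<psi>': "\<psi>' \<in> mod_hom R Z' L" "stab_eq R Y' L \<phi>' (\<psi>' \<circ> g')"
    using short_exact_stab_factor[OF se L \<phi>' p4] .
  have 5: "stab_eq R Y L \<phi> (\<phi>' \<circ> b)"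
    using stab_eq_comp_left[OF m(2) L mod_hom_ident(1) mod_hom_comp[OF b(1,2)] \<phi>
        stab_eq_sym[OF m(2) mod_hom_comp[OF b(1,2)] mod_hom_ident(1) b(3)]]
    by (simp add: \<phi>'_def o_assoc)
  have 6: "stab_eq R Y L (\<phi>' \<circ> b) (\<psi>' \<circ> g' \<circ> b)"
    by (rule stab_eq_comp_right[OF b(1) \<psi>'(2)])
  have 7: "stab_eq R Y L (\<psi>' \<circ> g' \<circ> b) (\<psi>' \<circ> c \<circ> g)"
    using stab_eq_comp_left[OF m'(3) L mod_hom_comp[OF b(1) m'(5)] mod_hom_comp[OF m(5) c] \<psi>'(1)
        stab_eq_sym[OF m'(3) mod_hom_comp[OF m(5) c] mod_hom_comp[OF b(1) m'(5)] comm(2)]]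
    by (simp add: o_assoc)
  note k = mod_hom_comp[OF b(1) \<phi>'] mod_hom_comp[OF b(1) mod_hom_comp[OF m'(5) \<psi>'(1)]]
    mod_hom_comp[OF m(5) mod_hom_comp[OF c \<psi>'(1)]]
  show thesis
    by (rule that[OF mod_hom_comp[OF c \<psi>'(1)]])
      (rule stab_eq_trans[OF m(2) L \<phi> k(1,3) 5 stab_eq_trans[OF m(2) L k 6 7]])
qed

end

section \<open>Ghosts\<close>

primrec scale_word :: "('r, 'u) module \<Rightarrow> 'r list \<Rightarrow> 'u \<Rightarrow> 'u" where
  "scale_word M [] = id"
| "scale_word M (r # rs) = scale_word M rs \<circ> (\<lambda>v. r \<odot>\<^bsub>M\<^esub> v)"

lemma scale_word_hom:
  assumes M: "module R M" and "set rs \<subseteq> carrier R"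
  shows "scale_word M rs \<in> mod_hom R M M"
  using assms(2)
proof (induction rs)
  case (Cons r rs)
  show ?case unfolding scale_word.simps(2)
    by (rule mod_hom_comp[OF mod_hom_scale[OF M] Cons.IH]) (use Cons.prems in simp_all)
qed (simp add: mod_hom_ident)

lemma scale_word_append: "scale_word M (rs @ ss) = scale_word M ss \<circ> scale_word M rs"
  by (induction rs) (simp_all add: o_assoc)

lemma ghost_hom: "ghost R T M N f \<Longrightarrow> f \<in> mod_hom R M N"
  by (simp add: ghost_def)

lemma ghost_composite_hom:
  "ghost_composite R T C n M N f \<Longrightarrow> f \<in> mod_hom R M N"
proof (induction R T C n M N f rule: ghost_composite.induct)
  case (3 R T C n M N f)
  obtain L g h where L: "L \<in> C" "ghost R T M L g" "ghost_composite R T C (Suc n) L N h" "f = h \<circ> g"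
    using 3(2) unfolding ghost_composite.simps by (elim bexE exE conjE)
  show ?case unfolding L(4) by (rule mod_hom_comp[OF ghost_hom[OF L(2)] 3(1)[OF L(1,3)]])
qed (simp_all add: ghost_def)

context frobenius_modules
begin

text \<open>If multiplication by \<open>r\<close> on \<open>X\<close> lifts to \<open>h : X \<rightarrow> P\<close>, where \<open>q : P \<rightarrow> X\<close> has kernel \<open>\<Omega> X\<close>, then \<open>r - h q\<close>
  maps \<open>P\<close> into \<open>\<Omega> X\<close> and restricts to multiplication by \<open>r\<close> there.\<close>

lemma proj_null_scale_Omega:
  fixes X :: "('r, 'u) module"
  assumes X: "module R X" and r: "r \<in> carrier R" and null: "proj_null R X X (\<lambda>x. r \<odot>\<^bsub>X\<^esub> x)"
  shows "proj_null R (Omega R X) (Omega R X) (\<lambda>x. r \<odot>\<^bsub>Omega R X\<^esub> x)"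
proof -
  let ?K = "Omega R X"
  obtain P :: "('r, 'u) module" and i q where P: "projective R P" and se: "short_exact R ?K i P q X"
    using Omega_exact[OF X] .
  note D = short_exactD[OF se]
  interpret P: module R P by (rule D(2))
  interpret X: module R X by (rule X)
  obtain h where h: "h \<in> mod_hom R X P" "\<forall>x\<in>carrier X. r \<odot>\<^bsub>X\<^esub> x = q (h x)"
    using null unfolding proj_null_iff_lift[OF X P D(5,8)] by (elim bexE)
  define d where "d y = r \<odot>\<^bsub>P\<^esub> y \<ominus>\<^bsub>P\<^esub> h (q y)" for y
  have hq: "(\<lambda>y. h (q y)) \<in> mod_hom R P P" by (rule mod_hom_comp'[OF D(5) h(1)])
  have d: "d \<in> mod_hom R P P" unfolding d_def
    by (rule mod_hom_diff_map[OF D(2) mod_hom_scale[OF D(2) r] hq])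
  have qd: "q (d y) = \<zero>\<^bsub>X\<^esub>" if y: "y \<in> carrier P" for y
  proof -
    have "q (d y) = q (r \<odot>\<^bsub>P\<^esub> y) \<ominus>\<^bsub>X\<^esub> q (h (q y))" unfolding d_def
      by (rule mod_hom_minus[OF D(2) X D(5)]) (use y r mod_hom_closed[OF hq y] in simp_all)
    also have "q (r \<odot>\<^bsub>P\<^esub> y) = q (h (q y))"
      using h(2) mod_hom_closed[OF D(5) y] by (simp add: mod_hom_smult[OF D(5) r y])
    finally show ?thesis
      using mod_hom_closed[OF D(5) mod_hom_closed[OF hq y]] by (simp add: X.M.minus_eq_zero_iff)
  qed
  have im: "d y \<in> i ` carrier ?K" if "y \<in> carrier P" for y
    unfolding D(7) using qd[OF that] mod_hom_closed[OF d that] by simp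
  obtain t where t: "t \<in> mod_hom R P ?K" "\<forall>y\<in>carrier P. i (t y) = d y"
    using mod_hom_factor_through_injection[OF D(2,1,2,4,6) d im] .
  interpret K: module R ?K by (rule D(1))
  have "r \<odot>\<^bsub>?K\<^esub> x = t (i x)" if x: "x \<in> carrier ?K" for x
  proof (rule inj_onD[OF D(6)])
    have ix: "i x \<in> carrier P" by (rule mod_hom_closed[OF D(4) x])
    have "i (t (i x)) = r \<odot>\<^bsub>P\<^esub> i x \<ominus>\<^bsub>P\<^esub> \<zero>\<^bsub>P\<^esub>"
      by (simp add: t(2)[rule_format, OF ix] d_def D(9)[OF x] mod_hom_zero[OF X D(2) h(1)])
    then show "i (r \<odot>\<^bsub>?K\<^esub> x) = i (t (i x))"
      using r ix by (simp add: mod_hom_smult[OF D(4) r x] P.M.minus_zero_right)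
    show "t (i x) \<in> carrier ?K" by (rule mod_hom_closed[OF t(1) ix])
  qed (use r x in simp)
  then show ?thesis
    unfolding proj_null_def by (intro exI[of _ P] conjI P bexI[OF _ D(4)] bexI[OF _ t(1)] ballI)
qed

text \<open>Dually, \<open>r - i h\<close> vanishes on \<open>X\<close> for an extension \<open>h : P \<rightarrow> X\<close> of multiplication by \<open>r\<close> along
  \<open>i : X \<rightarrow> P\<close>, and so it induces a map \<open>\<Sigma> X \<rightarrow> P\<close> that lifts multiplication by \<open>r\<close>.\<close>

lemma proj_null_scale_Sig:
  fixes X :: "('r, 'u) module"
  assumes X: "module R X" and r: "r \<in> carrier R" and null: "proj_null R X X (\<lambda>x. r \<odot>\<^bsub>X\<^esub> x)"
  shows "proj_null R (Sig R X) (Sig R X) (\<lambda>x. r \<odot>\<^bsub>Sig R X\<^esub> x)"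
proof -
  let ?W = "Sig R X"
  obtain P i q where P: "projective R P" and se: "short_exact R X i P q ?W"
    using Sigma_exact[OF X] .
  note D = short_exactD[OF se]
  interpret P: module R P by (rule D(2))
  interpret X: module R X by (rule X)
  interpret W: module R ?W by (rule D(3))
  obtain P0 :: "('r, 'u) module" and a b where P0: "projective R P0" "a \<in> mod_hom R X P0"
    "b \<in> mod_hom R P0 X" "\<forall>x\<in>carrier X. r \<odot>\<^bsub>X\<^esub> x = b (a x)" 
    using null unfolding proj_null_def by (elim exE conjE bexE)
  obtain a' where a': "a' \<in> mod_hom R P P0" "\<forall>x\<in>carrier X. a' (i x) = a x"
    using projective_extend[OF P0(1) D(1,2,4,6) P0(2)] by (elim bexE)
  note h = mod_hom_comp'[OF a'(1) P0(3)]
  note ih = mod_hom_comp'[OF h D(4)]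
  define d where "d y = r \<odot>\<^bsub>P\<^esub> y \<ominus>\<^bsub>P\<^esub> i (b (a' y))" for y
  have d: "d \<in> mod_hom R P P" unfolding d_def
    by (rule mod_hom_diff_map[OF D(2) mod_hom_scale[OF D(2) r] ih])
  have ker: "d y = \<zero>\<^bsub>P\<^esub>" if y: "y \<in> carrier P" "q y = \<zero>\<^bsub>?W\<^esub>" for y
  proof -
    obtain x where x: "x \<in> carrier X" "y = i x" using short_exact_preimage[OF se y] .
    have "i (b (a' y)) = r \<odot>\<^bsub>P\<^esub> y"
      using a'(2) P0(4) x by (simp add: mod_hom_smult[OF D(4) r, symmetric])
    then show ?thesis using r y by (simp add: d_def P.M.minus_eq_zero_iff)
  qed
  obtain t where t: "t \<in> mod_hom R ?W P" "\<forall>y\<in>carrier P. t (q y) = d y"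
    using mod_hom_factor_through_surjection[OF D(2,3,2,5,8) d ker] .
  have "r \<odot>\<^bsub>?W\<^esub> w = q (t w)" if "w \<in> carrier ?W" for w
  proof -
    have "w \<in> q ` carrier P" unfolding D(8) by (rule that)
    then obtain y where y: "w = q y" "y \<in> carrier P" by (rule imageE)
    have "q (d y) = q (r \<odot>\<^bsub>P\<^esub> y) \<ominus>\<^bsub>?W\<^esub> q (i (b (a' y)))" unfolding d_def
      by (rule mod_hom_minus[OF D(2,3,5)]) (use y r mod_hom_closed[OF ih y(2)] in simp_all)
    also have "\<dots> = q (r \<odot>\<^bsub>P\<^esub> y)"
      using mod_hom_closed[OF D(5), of "r \<odot>\<^bsub>P\<^esub> y"] r y(2)
      by (simp add: D(9)[OF mod_hom_closed[OF h y(2)]] W.M.minus_zero_right)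
    finally show ?thesis using y by (simp add: t(2) mod_hom_smult[OF D(5) r])
  qed
  then show ?thesis
    unfolding proj_null_def by (intro exI[of _ P] conjI P bexI[OF _ t(1)] bexI[OF _ D(5)] ballI)
qed

lemma proj_null_scale_Omega_power:
  fixes X :: "('r, 'u) module"
  assumes X: "module R X" and r: "r \<in> carrier R" and null: "proj_null R X X (\<lambda>x. r \<odot>\<^bsub>X\<^esub> x)"
  shows "proj_null R (Omega_power R n X) (Omega_power R n X) (\<lambda>x. r \<odot>\<^bsub>Omega_power R n X\<^esub> x)"
proof -
  have mod: "module R ((Omega R ^^ k) X)" "module R ((Sig R ^^ k) X)" for k
    by (induction k) (simp_all add: X module_Omega module_Sig)
  have 1: "proj_null R ((Omega R ^^ k) X) ((Omega R ^^ k) X) (\<lambda>x. r \<odot>\<^bsub>(Omega R ^^ k) X\<^esub> x)" for k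
    by (induction k) (simp_all add: null proj_null_scale_Omega[OF mod(1) r])
  have 2: "proj_null R ((Sig R ^^ k) X) ((Sig R ^^ k) X) (\<lambda>x. r \<odot>\<^bsub>(Sig R ^^ k) X\<^esub> x)" for k
    by (induction k) (simp_all add: null proj_null_scale_Sig[OF mod(2) r])
  show ?thesis unfolding Omega_power_def by (cases "n \<ge> 0") (simp_all add: 1 2)
qed

lemma ghost_iff:
  fixes T M N :: "('r, 'u) module"
  assumes N: "module R N"
  shows "ghost R T M N f \<longleftrightarrow> f \<in> mod_hom R M N \<and>
    (\<forall>n. \<forall>u\<in>mod_hom R (Omega_power R n T) M. proj_null R (Omega_power R n T) N (f \<circ> u))"
  unfolding ghost_def using stab_zero_iff[OF N mod_hom_comp] by (auto simp del: o_apply)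

text \<open>The composite with \<open>u : \<Omega>\<^sup>n T \<rightarrow> M\<close> is also \<open>u\<close> after multiplication by \<open>r\<close> on \<open>\<Omega>\<^sup>n T\<close>.\<close>

lemma ghost_scale:
  fixes T M :: "('r, 'u) module"
  assumes T: "module R T" and r: "r \<in> carrier R" and null: "proj_null R T T (\<lambda>x. r \<odot>\<^bsub>T\<^esub> x)"
    and M: "module R M"
  shows "ghost R T M M (\<lambda>v. r \<odot>\<^bsub>M\<^esub> v)"
  unfolding ghost_iff[OF M]
proof (intro conjI allI ballI)
  show "(\<lambda>v. r \<odot>\<^bsub>M\<^esub> v) \<in> mod_hom R M M" by (rule mod_hom_scale[OF M r])
  fix n u assume u: "u \<in> mod_hom R (Omega_power R n T) M"
  show "proj_null R (Omega_power R n T) M ((\<lambda>v. r \<odot>\<^bsub>M\<^esub> v) \<circ> u)"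
    by (rule proj_null_cong[OF proj_null_comp_left[OF proj_null_scale_Omega_power[OF T r null] u]])
      (simp add: mod_hom_smult[OF u r])
qed

lemma ghost_comp_right:
  fixes T K M N :: "('r, 'u) module"
  assumes "ghost R T M N f" "g \<in> mod_hom R K M"
  shows "ghost R T K N (f \<circ> g)"
  unfolding ghost_def
proof (intro conjI allI ballI)
  show "f \<circ> g \<in> mod_hom R K N" by (rule mod_hom_comp[OF assms(2) ghost_hom[OF assms(1)]])
  fix n u assume "u \<in> mod_hom R (Omega_power R n T) K"
  from mod_hom_comp[OF this assms(2)] show "stab_zero R (Omega_power R n T) N (f \<circ> g \<circ> u)"
    using assms(1) unfolding ghost_def by (simp add: comp_assoc)
qed

lemma ghost_composite_comp_right:
  fixes T K M N :: "('r, 'u) module"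
  assumes "ghost_composite R T C (Suc n) M N f" "g \<in> mod_hom R K M"
  shows "ghost_composite R T C (Suc n) K N (f \<circ> g)"
proof (cases n)
  case 0
  then show ?thesis using assms ghost_comp_right by simp
next
  case (Suc k)
  obtain L a b where L: "L \<in> C" "ghost R T M L a" "ghost_composite R T C (Suc k) L N b" "f = b \<circ> a"
    using assms(1) unfolding Suc ghost_composite.simps by (elim bexE exE conjE)
  show ?thesis unfolding Suc ghost_composite.simps L(4)
    by (rule bexI[OF _ L(1)], rule exI, rule exI, rule conjI[OF ghost_comp_right[OF L(2) assms(2)]],
        rule conjI[OF L(3)], rule comp_assoc)
qed

text \<open>Lift each component to one and the same projective module over the target and assemble the lifts.\<close>

lemma direct_sum_proj_null:
  fixes N :: "'i \<Rightarrow> ('r, 'u) module" and S L :: "('r, 'u) module"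
  assumes ds: "direct_sum R I N S" and L: "module R L" and \<phi>: "\<phi> \<in> mod_hom R S L"
    and null: "\<And>j t. j \<in> I \<Longrightarrow> t \<in> mod_hom R (N j) S \<Longrightarrow> proj_null R (N j) L (\<phi> \<circ> t)"
  shows "proj_null R S L \<phi>"
proof -
  obtain \<iota> where \<iota>: "\<forall>j\<in>I. \<iota> j \<in> mod_hom R (N j) S"
    "\<forall>(L :: ('r, 'u) module) h. module R L \<longrightarrow> (\<forall>j\<in>I. h j \<in> mod_hom R (N j) L) \<longrightarrow>
        (\<exists>H\<in>mod_hom R S L. \<forall>j\<in>I. \<forall>x\<in>carrier (N j). H (\<iota> j x) = h j x)"
    "\<forall>(L :: ('r, 'u) module) f g. module R L \<longrightarrow> f \<in> mod_hom R S L \<longrightarrow> g \<in> mod_hom R S L \<longrightarrow>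
        (\<forall>j\<in>I. \<forall>x\<in>carrier (N j). f (\<iota> j x) = g (\<iota> j x)) \<longrightarrow> (\<forall>x\<in>carrier S. f x = g x)"
    using direct_sum_universal[OF ds] .
  obtain E :: "('r, 'u) module" and q where E: "projective R E" "q \<in> mod_hom R E L"
    "q ` carrier E = carrier L" using enough_projectives[OF L] by (elim exE conjE)
  note iff = proj_null_iff_lift[OF L E]
  have "\<forall>j\<in>I. \<exists>h. h \<in> mod_hom R (N j) E \<and> (\<forall>x\<in>carrier (N j). (\<phi> \<circ> \<iota> j) x = q (h x))"
    using null[OF _ \<iota>(1)[rule_format]] unfolding iff Bex_def by (rule ballI)
  from bchoice[OF this] obtain h where
    h: "\<forall>j\<in>I. h j \<in> mod_hom R (N j) E \<and> (\<forall>x\<in>carrier (N j). (\<phi> \<circ> \<iota> j) x = q (h j x))" ..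
  have hE: "\<forall>j\<in>I. h j \<in> mod_hom R (N j) E" using h by simp
  obtain H where H: "H \<in> mod_hom R S E" "\<forall>j\<in>I. \<forall>x\<in>carrier (N j). H (\<iota> j x) = h j x"
    using \<iota>(2)[THEN spec, THEN spec, THEN mp, OF projective_module[OF E(1)], THEN mp, OF hE] by (elim bexE)
  have "\<forall>j\<in>I. \<forall>x\<in>carrier (N j). \<phi> (\<iota> j x) = q (H (\<iota> j x))"
    using h H(2) by simp
  note this = \<iota>(3)[THEN spec, THEN spec, THEN spec, THEN mp, OF L, THEN mp, OF \<phi>, THEN mp,
      OF mod_hom_comp'[OF H(1) E(2)], THEN mp, OF this, rule_format]
  then show ?thesis unfolding iff by (intro bexI[OF _ H(1)] ballI)
qed

lemma stab_retractE:
  assumes "stab_retract R X Y"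
  obtains s t where "module R X" "module R Y" "s \<in> mod_hom R X Y" "t \<in> mod_hom R Y X"
    "stab_eq R X X (t \<circ> s) id"
  using assms unfolding stab_retract_def by (elim conjE bexE)

lemma proj_null_on_retract:
  fixes X Y L :: "('r, 'u) module"
  assumes X: "module R X" and L: "module R L" and s: "s \<in> mod_hom R X Y" and t: "t \<in> mod_hom R Y X"
    and ts: "stab_eq R X X (t \<circ> s) id" and f: "f \<in> mod_hom R X L" and null: "proj_null R Y L (f \<circ> t)"
  shows "proj_null R X L f"
proof -
  have 1: "stab_eq R X L f (f \<circ> t \<circ> s)"
    using stab_eq_comp_left[OF X L mod_hom_ident(1) mod_hom_comp[OF s t] f
        stab_eq_sym[OF X mod_hom_comp[OF s t] mod_hom_ident(1) ts]] by (simp add: o_assoc)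
  have 2: "proj_null R X L (f \<circ> t \<circ> s)" using proj_null_comp_right[OF null s] by (simp add: o_def)
  show ?thesis
    by (rule proj_null_stab_eq[OF X L f mod_hom_comp[OF s mod_hom_comp[OF t f]] 1 2])
qed

lemma ghost_vanishes_on_sums:
  fixes T M N X :: "('r, 'u) module"
  assumes X: "X \<in> gen_class R T (Suc 0)" and N: "module R N" and f: "ghost R T M N f"
    and u: "u \<in> mod_hom R X M"
  shows "proj_null R X N (f \<circ> u)"
proof -
  obtain I :: "'u set" and e :: "'u \<Rightarrow> int" and S where
    ds: "direct_sum R I (\<lambda>j. Omega_power R (e j) T) S" and ret: "stab_retract R X S" using X by auto
  obtain s t where st: "module R X" "module R S" "s \<in> mod_hom R X S" "t \<in> mod_hom R S X"
    "stab_eq R X X (t \<circ> s) id" using stab_retractE[OF ret] .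
  note fu = mod_hom_comp[OF u ghost_hom[OF f]]
  have "proj_null R S N (f \<circ> u \<circ> t)"
  proof (rule direct_sum_proj_null[OF ds N mod_hom_comp[OF st(4) fu]])
    fix j w assume "w \<in> mod_hom R (Omega_power R (e j) T) S"
    from mod_hom_comp[OF mod_hom_comp[OF this st(4)] u]
    show "proj_null R (Omega_power R (e j) T) N (f \<circ> u \<circ> t \<circ> w)"
      using f unfolding ghost_iff[OF N] by (simp add: comp_assoc)
  qed
  then show ?thesis by (rule proj_null_on_retract[OF st(1) N st(3-5) fu])
qed

lemma gen_class_module:
  fixes T X :: "('r, 'u) module"
  shows "X \<in> gen_class R T n \<Longrightarrow> module R X"
  by (cases "(R, T, n)" rule: gen_class.cases) (auto simp: zero_object_def stab_retract_def)

text \<open>The ghost lemma. For \<open>X\<close> a retract of \<open>Y\<close> in a triangle \<open>P \<rightarrow> Y \<rightarrow> Q\<close>, the first ghost vanishes on \<open>P\<close>, so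
  on \<open>Y\<close> it factors through some \<open>\<psi>\<close> on \<open>Q\<close>; composing \<open>\<psi>\<close> with the other ghosts gives a shorter
  composite of ghosts with domain \<open>Q\<close>.\<close>

lemma ghost_composite_vanishes:
  fixes T X N :: "('r, 'u) module"
  assumes C: "\<And>L. L \<in> C \<Longrightarrow> module R L" and N: "module R N"
  shows "X \<in> gen_class R T n \<Longrightarrow> ghost_composite R T C n X N f \<Longrightarrow> proj_null R X N f"
proof (induction n arbitrary: X f rule: less_induct)
  case (less n)
  have X: "module R X" by (rule gen_class_module[OF less.prems(1)])
  note f = ghost_composite_hom[OF less.prems(2)]
  consider "n = 0" | "n = Suc 0" | k where "n = Suc (Suc k)" by (metis not0_implies_Suc)
  then show ?case
  proof cases
    case 1
    then have "zero_object R X" using less.prems(1) by simp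
    from this[unfolded zero_object_def, THEN conjunct2, THEN spec, THEN mp, OF N, THEN conjunct2,
        THEN bspec, OF f, THEN bspec, OF mod_hom_zero_map[OF N]]
    have "stab_eq R X N f (\<lambda>_. \<zero>\<^bsub>N\<^esub>)" .
    then show ?thesis using stab_zero_iff[OF N f] unfolding stab_zero_def by simp
  next
    case 2
    then have "ghost R T X N f" using less.prems(2) by simp
    from ghost_vanishes_on_sums[OF _ N this mod_hom_ident(1)] show ?thesis
      using less.prems(1) 2 by simp
  next
    case (3 k)
    obtain P Y Q a b c where P: "P \<in> gen_class R T (Suc 0)" and Q: "Q \<in> gen_class R T (Suc k)"
      and tri: "triangle R P Y Q a b c" and ret: "stab_retract R X Y"
      using less.prems(1) unfolding 3 gen_class.simps by blast
    obtain L g h where L: "L \<in> C" and g: "ghost R T X L g" and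
      h: "ghost_composite R T C (Suc k) L N h" and fhg: "f = h \<circ> g"
      using less.prems(2) unfolding 3 ghost_composite.simps by blast
    obtain s t where st: "module R X" "module R Y" "s \<in> mod_hom R X Y" "t \<in> mod_hom R Y X"
      "stab_eq R X X (t \<circ> s) id" using stab_retractE[OF ret] .
    note tm = triangle_modules[OF tri]
    note gt = mod_hom_comp[OF st(4) ghost_hom[OF g]]
    have "proj_null R P L (g \<circ> t \<circ> a)"
      using ghost_vanishes_on_sums[OF P C[OF L] g mod_hom_comp[OF tm(4) st(4)]] by (simp add: o_assoc)
    then obtain \<psi> where \<psi>: "\<psi> \<in> mod_hom R Q L" "stab_eq R Y L (g \<circ> t) (\<psi> \<circ> b)"
      using triangle_stab_factor[OF tri C[OF L] gt] by blast
    have "proj_null R Q N (h \<circ> \<psi>)"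
      by (rule less.IH[OF _ Q ghost_composite_comp_right[OF h \<psi>(1)]]) (simp add: 3)
    then have 1: "proj_null R Y N (h \<circ> \<psi> \<circ> b)"
      using proj_null_comp_right[OF _ tm(5)] by (simp add: o_def)
    note hh = ghost_composite_hom[OF h]
    have 2: "stab_eq R Y N (f \<circ> t) (h \<circ> \<psi> \<circ> b)"
      using stab_eq_comp_left[OF C[OF L] N gt mod_hom_comp[OF tm(5) \<psi>(1)] hh \<psi>(2)]
      by (simp add: fhg o_assoc)
    have "proj_null R Y N (f \<circ> t)"
      by (rule proj_null_stab_eq[OF st(2) N mod_hom_comp[OF st(4) f]
            mod_hom_comp[OF tm(5) mod_hom_comp[OF \<psi>(1) hh]] 2 1])
    then show ?thesis by (rule proj_null_on_retract[OF st(1) N st(3-5) f])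
  qed
qed

lemma ghost_length_le_generating_length:
  fixes T M :: "('r, 'u) module"
  assumes T: "module R T"
  shows "ghost_length R T M \<le> generating_length R T M"
  unfolding generating_length_def ghost_length_def
proof (rule Inf_superset_mono, rule subsetI)
  fix x assume "x \<in> {enat n |n. M \<in> gen_class R T n}"
  then obtain n where x: "x = enat n" and n: "M \<in> gen_class R T n" by blast
  have "stab_zero R M N f"
    if N: "N \<in> Thick R T" and f: "ghost_composite R T (Thick R T) n M N f" for N f
    using ghost_composite_vanishes[OF Thick_module[OF _ T] Thick_module[OF N T] n f]
      stab_zero_iff[OF Thick_module[OF N T] ghost_composite_hom[OF f]] by simp
  then show "x \<in> {enat n |n. \<forall>N\<in>Thick R T. \<forall>f.
      ghost_composite R T (Thick R T) n M N f \<longrightarrow> stab_zero R M N f}"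
    using x by blast
qed

lemma ghost_number_le_generating_number:
  fixes T :: "('r, 'u) module"
  assumes "module R T"
  shows "ghost_number R T \<le> generating_number R T"
  unfolding ghost_number_def generating_number_def
  by (rule SUP_mono') (rule ghost_length_le_generating_length[OF assms])

lemma ghost_composite_scale_word:
  fixes T M :: "('r, 'u) module"
  assumes T: "module R T" and M: "module R M" and MC: "M \<in> C" and rs: "set rs \<subseteq> carrier R"
    and null: "\<And>r. r \<in> set rs \<Longrightarrow> proj_null R T T (\<lambda>x. r \<odot>\<^bsub>T\<^esub> x)"
  shows "ghost_composite R T C (length rs) M M (scale_word M rs)"
  using rs null
proof (induction rs)
  case Nil
  then show ?case by (simp add: mod_hom_ident)
next
  case (Cons r rs)
  have g: "ghost R T M M (\<lambda>v. r \<odot>\<^bsub>M\<^esub> v)"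
    using Cons.prems by (intro ghost_scale[OF T _ _ M]) simp_all
  have IH: "ghost_composite R T C (length rs) M M (scale_word M rs)"
    using Cons by simp
  show ?case
  proof (cases rs)
    case Nil
    then show ?thesis using g by simp
  next
    case (Cons r' rs')
    show ?thesis unfolding Cons list.size(4) add_Suc_right add_0_right
        ghost_composite.simps scale_word.simps(2)[of M r]
      by (rule bexI[OF _ MC], rule exI, rule exI, rule conjI[OF g],
          rule conjI[OF IH[unfolded Cons list.size(4) add_Suc_right add_0_right]], rule refl)
  qed
qed

text \<open>Initial segments of a composite that is not stably zero are not stably zero, so a single long
  composite bounds the ghost length from below.\<close>

lemma ghost_length_ge:
  fixes T M :: "('r, 'u) module"
  assumes T: "module R T" and M: "M \<in> Thick R T" and rs: "set rs \<subseteq> carrier R"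
    and null: "\<And>r. r \<in> set rs \<Longrightarrow> proj_null R T T (\<lambda>x. r \<odot>\<^bsub>T\<^esub> x)"
    and nonzero: "\<not> proj_null R M M (scale_word M rs)"
  shows "enat (Suc (length rs)) \<le> ghost_length R T M"
  unfolding ghost_length_def
proof (rule Inf_greatest)
  note Mm = Thick_module[OF M T]
  fix x assume "x \<in> {enat n |n. \<forall>N\<in>Thick R T. \<forall>f.
      ghost_composite R T (Thick R T) n M N f \<longrightarrow> stab_zero R M N f}"
  then obtain n where x: "x = enat n" and n: "\<forall>N\<in>Thick R T. \<forall>f.
      ghost_composite R T (Thick R T) n M N f \<longrightarrow> stab_zero R M N f" by blast
  show "enat (Suc (length rs)) \<le> x"
  proof (rule ccontr)
    assume "\<not> enat (Suc (length rs)) \<le> x"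
    then have len: "length (take n rs) = n" using x by simp
    have sub: "set (take n rs) \<subseteq> set rs" "set (drop n rs) \<subseteq> set rs"
      by (rule set_take_subset, rule set_drop_subset)
    have "ghost_composite R T (Thick R T) n M M (scale_word M (take n rs))"
      using ghost_composite_scale_word[OF T Mm M, of "take n rs"] len rs null sub(1) by auto
    then have "stab_zero R M M (scale_word M (take n rs))" using n M by blast
    then have "proj_null R M M (scale_word M (take n rs))"
      using stab_zero_iff[OF Mm scale_word_hom[OF Mm]] rs sub(1) by blast
    from proj_null_comp_left[OF this scale_word_hom[OF Mm, of "drop n rs"]]
    have "proj_null R M M (scale_word M (drop n rs) \<circ> scale_word M (take n rs))"
      using rs sub(2) by (simp add: o_def)
    then show False using nonzero by (simp flip: scale_word_append)
  qed
qed

section \<open>Closure properties of the classes of bounded generating length\<close>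

lemma stab_retract_trans:
  fixes X Y Z :: "('r, 'u) module"
  assumes "stab_retract R X Y" "stab_retract R Y Z"
  shows "stab_retract R X Z"
proof -
  obtain s t where st: "module R X" "module R Y" "s \<in> mod_hom R X Y" "t \<in> mod_hom R Y X"
    "stab_eq R X X (t \<circ> s) id" using stab_retractE[OF assms(1)] .
  obtain s' t' where st': "module R Y" "module R Z" "s' \<in> mod_hom R Y Z" "t' \<in> mod_hom R Z Y"
    "stab_eq R Y Y (t' \<circ> s') id" using stab_retractE[OF assms(2)] .
  have "stab_eq R X X ((t \<circ> t') \<circ> (s' \<circ> s)) (t \<circ> s)"
    using stab_eq_comp_right[OF st(3) stab_eq_comp_left[OF st(2,1) mod_hom_comp[OF st'(3,4)]
          mod_hom_ident(1) st(4) st'(5)]] by (simp add: o_assoc)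
  then have "stab_eq R X X ((t \<circ> t') \<circ> (s' \<circ> s)) id"
    by (rule stab_eq_trans[OF st(1,1) mod_hom_comp[OF mod_hom_comp[OF st(3) st'(3)] mod_hom_comp[OF st'(4) st(4)]]
          mod_hom_comp[OF st(3,4)] mod_hom_ident(1) _ st(5)])
  then show ?thesis unfolding stab_retract_def
    by (intro conjI st(1) st'(2) bexI[OF _ mod_hom_comp[OF st(3) st'(3)]] bexI[OF _ mod_hom_comp[OF st'(4) st(4)]])
qed

lemma stab_retract_refl:
  fixes X :: "('r, 'u) module"
  assumes X: "module R X" shows "stab_retract R X X"
  unfolding stab_retract_def
  by (intro conjI X bexI[OF _ mod_hom_ident(1)]
      stab_eq_on_carrier[OF X X mod_hom_comp[OF mod_hom_ident(1) mod_hom_ident(1)]]) simp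

lemma gen_class_retract:
  fixes T X Y :: "('r, 'u) module"
  assumes Y: "Y \<in> gen_class R T (Suc n)" and ret: "stab_retract R X Y"
  shows "X \<in> gen_class R T (Suc n)"
proof (cases n)
  case 0
  obtain I :: "'u set" and e :: "'u \<Rightarrow> int" and S where
    "direct_sum R I (\<lambda>j. Omega_power R (e j) T) S" "stab_retract R Y S" using Y 0 by auto
  then show ?thesis using stab_retract_trans[OF ret] 0 by auto
next
  case (Suc k)
  obtain P Z Q f g h where "P \<in> gen_class R T (Suc 0)" "Q \<in> gen_class R T (Suc k)"
    "triangle R P Z Q f g h" "stab_retract R Y Z"
    using Y unfolding Suc gen_class.simps by blast
  with stab_retract_trans[OF ret this(4)] show ?thesis
    unfolding Suc gen_class.simps by blast
qed

lemma gen_class_extension: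
  fixes T P Y Q :: "('r, 'u) module"
  assumes se: "short_exact R P f Y g Q" and P: "P \<in> gen_class R T (Suc 0)"
    and Q: "Q \<in> gen_class R T (Suc n)"
  shows "Y \<in> gen_class R T (Suc (Suc n))"
proof -
  obtain h where "triangle R P Y Q f g h" using triangle_of_short_exact[OF se] .
  then show ?thesis using P Q stab_retract_refl[OF short_exactD(2)[OF se]]
    unfolding gen_class.simps(3) by blast
qed

end

section \<open>The group algebra\<close>

text \<open>The multiple \<open>c g\<close> of a group element. In particular \<open>single c \<one>\<close> is the scalar \<open>c\<close>.\<close>

definition single :: "'k::zero \<Rightarrow> 'g \<Rightarrow> 'g \<Rightarrow> 'k" where
  "single c g = (\<lambda>x. if x = g then c else 0)"

locale group_algebra_modules = comm_group A for A :: "'g monoid" (structure) +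
  fixes T :: "('g \<Rightarrow> 'k::field, 'u) module"
  assumes finite_A: "finite (carrier A)" and infinite_U: "infinite (UNIV :: 'u set)"
    and triv: "trivial_module A T"
begin

abbreviation R :: "('g \<Rightarrow> 'k) ring" where "R \<equiv> group_algebra A"

definition aug :: "('g \<Rightarrow> 'k) \<Rightarrow> 'k" where "aug a = (\<Sum>x\<in>carrier A. a x)"

lemma module_T: "module R T" using triv by (simp add: trivial_module_def)

sublocale R: cring "R" by (rule module.axioms(1)[OF module_T])

lemma carrier_R: "a \<in> carrier R \<longleftrightarrow> (\<forall>x. x \<notin> carrier A \<longrightarrow> a x = 0)"
  by (simp add: group_algebra_def)

lemma mult_R: "a \<otimes>\<^bsub>R\<^esub> b = (\<lambda>z. if z \<in> carrier A then \<Sum>x\<in>carrier A. a x * b (inv x \<otimes> z) else 0)"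
  by (simp add: group_algebra_def)

lemma add_R: "a \<oplus>\<^bsub>R\<^esub> b = (\<lambda>x. a x + b x)" by (simp add: group_algebra_def)

lemma zero_R: "\<zero>\<^bsub>R\<^esub> = (\<lambda>x. 0)" by (simp add: group_algebra_def)

lemma one_R: "\<one>\<^bsub>R\<^esub> = single 1 \<one>" by (simp add: group_algebra_def single_def)

lemma uminus_R:
  assumes "a \<in> carrier R" shows "\<ominus>\<^bsub>R\<^esub> a = (\<lambda>x. - a x)"
proof (rule R.minus_equality)
  show "(\<lambda>x. - a x) \<oplus>\<^bsub>R\<^esub> a = \<zero>\<^bsub>R\<^esub>" by (simp add: add_R zero_R)
qed (use assms in \<open>simp_all add: carrier_R\<close>)

lemma minus_R:
  assumes "a \<in> carrier R" "b \<in> carrier R" shows "a \<ominus>\<^bsub>R\<^esub> b = (\<lambda>x. a x - b x)"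
  using assms by (simp add: a_minus_def uminus_R add_R)

lemma single_closed [simp]: "g \<in> carrier A \<Longrightarrow> single c g \<in> carrier R"
  by (auto simp: carrier_R single_def)

lemma single_mult_left:
  assumes g: "g \<in> carrier A"
  shows "single c g \<otimes>\<^bsub>R\<^esub> b = (\<lambda>z. if z \<in> carrier A then c * b (inv g \<otimes> z) else 0)"
proof
  fix z
  have "(\<Sum>x\<in>carrier A. single c g x * b (inv x \<otimes> z)) = c * b (inv g \<otimes> z)"
    using sum.remove[OF finite_A g, of "\<lambda>x. single c g x * b (inv x \<otimes> z)"]
    by (simp add: single_def sum.neutral)
  then show "(single c g \<otimes>\<^bsub>R\<^esub> b) z = (if z \<in> carrier A then c * b (inv g \<otimes> z) else 0)"
    by (simp add: mult_R)
qed

lemma single_mult: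
  assumes g: "g \<in> carrier A" and h: "h \<in> carrier A"
  shows "single c g \<otimes>\<^bsub>R\<^esub> single d h = single (c * d) (g \<otimes> h)"
proof
  fix z
  have "inv g \<otimes> z = h \<longleftrightarrow> z = g \<otimes> h" if "z \<in> carrier A"
    using that g h inv_solve_left' by auto
  then show "(single c g \<otimes>\<^bsub>R\<^esub> single d h) z = single (c * d) (g \<otimes> h) z"
    unfolding single_mult_left[OF g] using g h by (auto simp: single_def)
qed

lemma single_add: "single c g \<oplus>\<^bsub>R\<^esub> single d g = single (c + d) g"
  by (auto simp: add_R single_def)

lemma single_zero: "single 0 g = \<zero>\<^bsub>R\<^esub>" by (auto simp: zero_R single_def)

lemma finsum_R:
  assumes "finite F" "f \<in> F \<rightarrow> carrier R"
  shows "finsum R f F = (\<lambda>x. \<Sum>s\<in>F. f s x)"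
  using assms
proof (induction rule: finite_induct)
  case (insert s F)
  then have "f s \<in> carrier R" "f \<in> F \<rightarrow> carrier R" by auto
  then show ?case using insert by (simp add: add_R)
qed (simp add: zero_R)

lemma sum_of_singles:
  assumes a: "a \<in> carrier R"
  shows "a = finsum R (\<lambda>y. single (a y) y) (carrier A)"
proof -
  have eq: "a x = (\<Sum>y\<in>carrier A. single (a y) y x)" for x
  proof (cases "x \<in> carrier A")
    case True
    then show ?thesis using sum.remove[OF finite_A True, of "\<lambda>y. single (a y) y x"]
      by (simp add: single_def sum.neutral)
  next
    case False
    then have "(\<Sum>y\<in>carrier A. single (a y) y x) = 0" by (intro sum.neutral) (auto simp: single_def)
    then show ?thesis using False a by (simp add: carrier_R)
  qed
  have "(\<lambda>y. single (a y) y) \<in> carrier A \<rightarrow> carrier R" by simp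
  from finsum_R[OF finite_A this] have fs: "finsum R (\<lambda>y. single (a y) y) (carrier A) = (\<lambda>x. \<Sum>y\<in>carrier A. single (a y) y x)" .
  show ?thesis by (rule trans[OF ext[OF eq] fs[symmetric]])
qed

lemma module_sum_of_singles:
  assumes M: "module R M" and a: "a \<in> carrier R" and v: "v \<in> carrier M"
  shows "a \<odot>\<^bsub>M\<^esub> v = finsum M (\<lambda>y. single (a y) y \<odot>\<^bsub>M\<^esub> v) (carrier A)"
proof -
  interpret M: module R M by fact
  have "finsum R (\<lambda>y. single (a y) y) (carrier A) \<odot>\<^bsub>M\<^esub> v
      = finsum M (\<lambda>y. single (a y) y \<odot>\<^bsub>M\<^esub> v) (carrier A)"
    using v finite_A
    by (intro additive_map_finsum[OF R.abelian_monoid_axioms M.M.abelian_monoid_axioms,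
          where f = "\<lambda>r. r \<odot>\<^bsub>M\<^esub> v" and t = "\<lambda>y. single (a y) y"])
      (simp_all add: M.smult_l_distr)
  then show ?thesis unfolding sum_of_singles[OF a, symmetric] .
qed

text \<open>Equivariance needs testing on the elements \<open>c g\<close> alone, as they span the group algebra.\<close>

lemma mod_homI_group:
  assumes M: "module R M" and N: "module R N"
    and cl: "\<And>x. x \<in> carrier M \<Longrightarrow> f x \<in> carrier N"
    and add: "\<And>x y. x \<in> carrier M \<Longrightarrow> y \<in> carrier M \<Longrightarrow> f (x \<oplus>\<^bsub>M\<^esub> y) = f x \<oplus>\<^bsub>N\<^esub> f y"
    and single: "\<And>c g x. g \<in> carrier A \<Longrightarrow> x \<in> carrier M \<Longrightarrow>
        f (single c g \<odot>\<^bsub>M\<^esub> x) = single c g \<odot>\<^bsub>N\<^esub> f x"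
  shows "f \<in> mod_hom R M N"
proof (rule mod_homI[OF cl add])
  interpret M: module R M by fact
  interpret N: module R N by fact
  fix a x assume a: "a \<in> carrier R" and x: "x \<in> carrier M"
  have f0: "f \<zero>\<^bsub>M\<^esub> = \<zero>\<^bsub>N\<^esub>"
    using single[of \<one> "\<zero>\<^bsub>M\<^esub>" 0] cl[OF M.M.zero_closed] by (simp add: single_zero)
  have "f (a \<odot>\<^bsub>M\<^esub> x) = finsum N (\<lambda>y. f (single (a y) y \<odot>\<^bsub>M\<^esub> x)) (carrier A)"
    unfolding module_sum_of_singles[OF M a x] using x
    by (intro additive_map_finsum[OF M.M.abelian_monoid_axioms N.M.abelian_monoid_axioms cl f0 add finite_A])
      auto
  also have "\<dots> = finsum N (\<lambda>y. single (a y) y \<odot>\<^bsub>N\<^esub> f x) (carrier A)"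
    using x cl by (intro N.M.finsum_cong') (auto simp: single)
  also have "\<dots> = a \<odot>\<^bsub>N\<^esub> f x" by (rule module_sum_of_singles[OF N a cl[OF x], symmetric])
  finally show "f (a \<odot>\<^bsub>M\<^esub> x) = a \<odot>\<^bsub>N\<^esub> f x" .
qed

lemma smult_sum_coeff:
  assumes M: "module R M" and v: "v \<in> carrier M" and "finite F"
  shows "single (sum c F) \<one> \<odot>\<^bsub>M\<^esub> v = finsum M (\<lambda>y. single (c y) \<one> \<odot>\<^bsub>M\<^esub> v) F"
proof -
  interpret M: module R M by fact
  show ?thesis using assms(3)
  proof (induction rule: finite_induct)
    case (insert y F)
    then show ?case using v
      by (simp add: single_add[symmetric] M.smult_l_distr Pi_def)
  qed (simp add: single_zero v)
qed

section \<open>The trivial module and trivial actions\<close>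

text \<open>A chosen identification of \<open>T\<close> with \<open>k\<close> and its inverse.\<close>

definition unit_T :: "'k \<Rightarrow> 'u" where
  "unit_T = (SOME \<phi>. bij_betw \<phi> UNIV (carrier T) \<and> (\<forall>c d. \<phi> (c + d) = \<phi> c \<oplus>\<^bsub>T\<^esub> \<phi> d) \<and>
     (\<forall>a\<in>carrier R. \<forall>c. a \<odot>\<^bsub>T\<^esub> \<phi> c = \<phi> (aug a * c)))"

lemma unit_T:
  shows bij_unit_T: "bij_betw unit_T UNIV (carrier T)"
    and unit_T_add: "unit_T (c + d) = unit_T c \<oplus>\<^bsub>T\<^esub> unit_T d"
    and unit_T_smult: "a \<in> carrier R \<Longrightarrow> a \<odot>\<^bsub>T\<^esub> unit_T c = unit_T (aug a * c)"
proof -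
  have "bij_betw unit_T UNIV (carrier T) \<and> (\<forall>c d. unit_T (c + d) = unit_T c \<oplus>\<^bsub>T\<^esub> unit_T d) \<and>
     (\<forall>a\<in>carrier R. \<forall>c. a \<odot>\<^bsub>T\<^esub> unit_T c = unit_T (aug a * c))"
    unfolding unit_T_def aug_def
    by (rule someI_ex[OF conjunct2[OF triv[unfolded trivial_module_def]]])
  then show "bij_betw unit_T UNIV (carrier T)" "unit_T (c + d) = unit_T c \<oplus>\<^bsub>T\<^esub> unit_T d"
    "a \<in> carrier R \<Longrightarrow> a \<odot>\<^bsub>T\<^esub> unit_T c = unit_T (aug a * c)" by simp_all
qed

definition coord_T :: "'u \<Rightarrow> 'k" where "coord_T = inv_into UNIV unit_T"

lemma unit_T_closed [simp]: "unit_T c \<in> carrier T"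
  using bij_unit_T by (auto simp: bij_betw_def)

lemma coord_unit_T [simp]: "coord_T (unit_T c) = c"
  using bij_unit_T by (simp add: coord_T_def bij_betw_def)

lemma unit_coord_T: "t \<in> carrier T \<Longrightarrow> unit_T (coord_T t) = t"
  unfolding coord_T_def by (rule f_inv_into_f) (use bij_unit_T in \<open>simp add: bij_betw_def\<close>)

lemma unit_T_zero: "unit_T 0 = \<zero>\<^bsub>T\<^esub>"
proof -
  interpret T: module R T by (rule module_T)
  have "unit_T 0 \<oplus>\<^bsub>T\<^esub> unit_T 0 = unit_T 0" using unit_T_add[of 0 0] by simp
  then show ?thesis using T.M.add.l_cancel_one[OF unit_T_closed unit_T_closed] by simp
qed

lemma aug_add: "aug (a \<oplus>\<^bsub>R\<^esub> b) = aug a + aug b"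
  by (simp add: aug_def add_R sum.distrib)

lemma aug_single [simp]: "g \<in> carrier A \<Longrightarrow> aug (single c g) = c"
  using sum.remove[OF finite_A, of g "\<lambda>x. single c g x"] by (simp add: aug_def single_def)

text \<open>The action on \<open>T\<close> turns associativity into multiplicativity.\<close>

lemma aug_mult:
  assumes "a \<in> carrier R" "b \<in> carrier R" shows "aug (a \<otimes>\<^bsub>R\<^esub> b) = aug a * aug b"
proof -
  interpret T: module R T by (rule module_T)
  have "unit_T (aug (a \<otimes>\<^bsub>R\<^esub> b) * 1) = unit_T (aug a * (aug b * 1))"
    using assms T.smult_assoc1[OF assms, of "unit_T 1"] unit_T_smult[of "a \<otimes>\<^bsub>R\<^esub> b" 1]
      unit_T_smult[of a "aug b * 1"] unit_T_smult[of b 1] by simp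
  from arg_cong[OF this, of coord_T] show ?thesis by simp
qed

text \<open>The group elements act as the identity, expressed through the augmentation.\<close>

definition trivial_action :: "('g \<Rightarrow> 'k, 'u) module \<Rightarrow> bool" where
  "trivial_action V \<longleftrightarrow> (\<forall>a\<in>carrier R. \<forall>v\<in>carrier V. a \<odot>\<^bsub>V\<^esub> v = single (aug a) \<one> \<odot>\<^bsub>V\<^esub> v)"

lemma trivial_actionD:
  "trivial_action V \<Longrightarrow> a \<in> carrier R \<Longrightarrow> v \<in> carrier V \<Longrightarrow> a \<odot>\<^bsub>V\<^esub> v = single (aug a) \<one> \<odot>\<^bsub>V\<^esub> v"
  unfolding trivial_action_def by blast

text \<open>A vector fixed by \<open>A\<close> is the image of \<open>1\<close> under a homomorphism from the trivial module.\<close>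

lemma hom_from_T:
  assumes M: "module R M" and v: "v \<in> carrier M"
    and fixed: "\<And>a. a \<in> carrier R \<Longrightarrow> a \<odot>\<^bsub>M\<^esub> v = single (aug a) \<one> \<odot>\<^bsub>M\<^esub> v"
  shows "(\<lambda>t. single (coord_T t) \<one> \<odot>\<^bsub>M\<^esub> v) \<in> mod_hom R T M"
proof (rule mod_homI)
  interpret M: module R M by (rule M)
  interpret T: module R T by (rule module_T)
  show "single (coord_T t) \<one> \<odot>\<^bsub>M\<^esub> v \<in> carrier M" for t using v by simp
  fix t assume t: "t \<in> carrier T"
  show "single (coord_T (t \<oplus>\<^bsub>T\<^esub> s)) \<one> \<odot>\<^bsub>M\<^esub> v
      = single (coord_T t) \<one> \<odot>\<^bsub>M\<^esub> v \<oplus>\<^bsub>M\<^esub> single (coord_T s) \<one> \<odot>\<^bsub>M\<^esub> v" if "s \<in> carrier T" for s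
  proof -
    have "t \<oplus>\<^bsub>T\<^esub> s = unit_T (coord_T t + coord_T s)"
      using t that by (simp add: unit_T_add unit_coord_T)
    then show ?thesis using v by (simp add: single_add[symmetric] M.smult_l_distr)
  qed
  fix a assume a: "a \<in> carrier R"
  have "coord_T (a \<odot>\<^bsub>T\<^esub> t) = coord_T t * aug a"
    using unit_T_smult[OF a, of "coord_T t"] unit_coord_T[OF t] by simp
  then have "single (coord_T (a \<odot>\<^bsub>T\<^esub> t)) \<one> \<odot>\<^bsub>M\<^esub> v
      = single (coord_T t) \<one> \<odot>\<^bsub>M\<^esub> (single (aug a) \<one> \<odot>\<^bsub>M\<^esub> v)"
    using v by (simp add: single_mult M.smult_assoc1[symmetric])
  also have "\<dots> = single (coord_T t) \<one> \<odot>\<^bsub>M\<^esub> (a \<odot>\<^bsub>M\<^esub> v)"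
    by (simp only: fixed[OF a])
  also have "\<dots> = (single (coord_T t) \<one> \<otimes>\<^bsub>R\<^esub> a) \<odot>\<^bsub>M\<^esub> v"
    by (rule M.smult_assoc1[symmetric]) (simp_all add: a v)
  also have "\<dots> = (a \<otimes>\<^bsub>R\<^esub> single (coord_T t) \<one>) \<odot>\<^bsub>M\<^esub> v"
    by (simp only: R.m_comm[OF a single_closed[OF one_closed]])
  also have "\<dots> = a \<odot>\<^bsub>M\<^esub> (single (coord_T t) \<one> \<odot>\<^bsub>M\<^esub> v)"
    by (rule M.smult_assoc1) (simp_all add: a v)
  finally show "single (coord_T (a \<odot>\<^bsub>T\<^esub> t)) \<one> \<odot>\<^bsub>M\<^esub> v = a \<odot>\<^bsub>M\<^esub> (single (coord_T t) \<one> \<odot>\<^bsub>M\<^esub> v)" .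
qed

definition indep :: "('g \<Rightarrow> 'k, 'u) module \<Rightarrow> 'u set \<Rightarrow> bool" where
  "indep V B \<longleftrightarrow> B \<subseteq> carrier V \<and> (\<forall>F c. finite F \<longrightarrow> F \<subseteq> B \<longrightarrow>
     finsum V (\<lambda>v. single (c v) \<one> \<odot>\<^bsub>V\<^esub> v) F = \<zero>\<^bsub>V\<^esub> \<longrightarrow> (\<forall>v\<in>F. c v = 0))"

lemma indep_maximal_exists:
  obtains B where "indep V B" "\<forall>B'. indep V B' \<longrightarrow> B \<subseteq> B' \<longrightarrow> B' = B"
proof -
  have "\<exists>B\<in>{B. indep V B}. \<forall>X\<in>{B. indep V B}. B \<subseteq> X \<longrightarrow> X = B"
  proof (rule subset_Zorn')
    fix C assume C: "subset.chain {B. indep V B} C"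
    have ind: "indep V B" if "B \<in> C" for B using C that by (auto simp: subset.chain_def)
    have "indep V (\<Union>C)" unfolding indep_def
    proof (intro conjI allI impI)
      show "\<Union>C \<subseteq> carrier V" using ind by (auto simp: indep_def)
      fix F c assume F: "finite F" "F \<subseteq> \<Union>C"
        and z: "finsum V (\<lambda>v. single (c v) \<one> \<odot>\<^bsub>V\<^esub> v) F = \<zero>\<^bsub>V\<^esub>"
      show "\<forall>v\<in>F. c v = 0"
      proof (cases "C = {}")
        case True
        then show ?thesis using F by simp
      next
        case False
        obtain B where BC: "B \<in> C" "F \<subseteq> B" using finite_subset_Union_chain[OF F False C] by blast
        have "\<forall>F c. finite F \<longrightarrow> F \<subseteq> B \<longrightarrow>
            finsum V (\<lambda>v. single (c v) \<one> \<odot>\<^bsub>V\<^esub> v) F = \<zero>\<^bsub>V\<^esub> \<longrightarrow> (\<forall>v\<in>F. c v = 0)"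
          using ind[OF BC(1)] unfolding indep_def by (rule conjunct2)
        then show ?thesis using F(1) BC(2) z by simp
      qed
    qed
    then show "\<Union>C \<in> {B. indep V B}" by simp
  qed
  then show thesis using that by blast
qed

text \<open>A module with trivial action is a vector space over \<open>k\<close>; a basis splits it into copies of the
  trivial module.\<close>

lemma trivial_action_direct_sum:
  assumes V: "module R V" "trivial_action V"
  obtains B :: "'u set" where "direct_sum R B (\<lambda>_. T) V"
proof -
  interpret V: module R V by (rule V(1))
  obtain B where B: "indep V B" and max: "\<forall>B'. indep V B' \<longrightarrow> B \<subseteq> B' \<longrightarrow> B' = B"
    using indep_maximal_exists .
  have BV: "v \<in> carrier V" if "v \<in> B" for v using B that by (auto simp: indep_def)
  have indepD: "c v = 0" if "finite F" "F \<subseteq> B"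
    "finsum V (\<lambda>v. single (c v) \<one> \<odot>\<^bsub>V\<^esub> v) F = \<zero>\<^bsub>V\<^esub>" "v \<in> F" for F c v
    using B[unfolded indep_def, THEN conjunct2, THEN spec[of _ F], THEN spec[of _ c]] that by simp
  define \<iota> where "\<iota> v t = single (coord_T t) \<one> \<odot>\<^bsub>V\<^esub> v" for v t
  interpret F: hom_family R B "\<lambda>_. T" V \<iota>
    by (rule hom_family.intro[OF V(1) module_T]) (unfold \<iota>_def, rule hom_from_T[OF V(1) BV trivial_actionD[OF V(2) _ BV]])
  let ?\<beta> = "fam_sum V B (\<lambda>_. T) \<iota>" and ?X = "fin_families B (\<lambda>_. T)"
  have inj: "inj_on ?\<beta> ?X"
  proof (rule inj_onI)
    fix x y assume x: "x \<in> ?X" and y: "y \<in> ?X" and eq: "?\<beta> x = ?\<beta> y"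
    let ?F = "fam_supp B (\<lambda>_. T) x \<union> fam_supp B (\<lambda>_. T) y"
    have F: "finite ?F" "?F \<subseteq> B" using x y by (auto simp: fin_families_def fam_supp_def)
    have FV: "v \<in> carrier V" if "v \<in> ?F" for v using F(2) that BV by blast
    let ?c = "\<lambda>v. coord_T (x v) - coord_T (y v)"
    have "finsum V (\<lambda>v. single (?c v) \<one> \<odot>\<^bsub>V\<^esub> v) ?F \<oplus>\<^bsub>V\<^esub> finsum V (\<lambda>v. \<iota> v (y v)) ?F
        = finsum V (\<lambda>v. single (?c v) \<one> \<odot>\<^bsub>V\<^esub> v \<oplus>\<^bsub>V\<^esub> \<iota> v (y v)) ?F"
      using FV by (intro V.M.finsum_addf[symmetric]) (auto simp: \<iota>_def)
    also have "\<dots> = finsum V (\<lambda>v. \<iota> v (x v)) ?F"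
      using FV by (intro V.M.finsum_cong') (auto simp: \<iota>_def V.smult_l_distr[symmetric] single_add)
    also have "\<dots> = finsum V (\<lambda>v. \<iota> v (y v)) ?F"
      using eq F.fam_sum_superset[OF x F(1) _ F(2)] F.fam_sum_superset[OF y F(1) _ F(2)] by simp
    finally have z: "finsum V (\<lambda>v. single (?c v) \<one> \<odot>\<^bsub>V\<^esub> v) ?F = \<zero>\<^bsub>V\<^esub>"
      using FV by (subst (asm) V.M.add.r_cancel_one) (auto simp: \<iota>_def intro!: V.M.finsum_closed)
    have c: "?c v = 0" if "v \<in> ?F" for v by (rule indepD[OF F z that])
    have xy: "x \<in> B \<rightarrow>\<^sub>E carrier T" "y \<in> B \<rightarrow>\<^sub>E carrier T" using x y by (auto simp: fin_families_def)
    show "x = y"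
    proof (rule PiE_ext[OF xy])
      fix v assume v: "v \<in> B"
      show "x v = y v"
      proof (cases "v \<in> ?F")
        case True
        then have "unit_T (coord_T (x v)) = unit_T (coord_T (y v))" using c by simp
        then show ?thesis
          unfolding unit_coord_T[OF PiE_mem[OF xy(1) v]] unit_coord_T[OF PiE_mem[OF xy(2) v]] .
      qed (use v in \<open>auto simp: fam_supp_def\<close>)
    qed
  qed
  define W where "W = ?\<beta> ` ?X"
  have Wadd: "a \<oplus>\<^bsub>V\<^esub> b \<in> W" if "a \<in> W" "b \<in> W" for a b
  proof -
    obtain x y where xy: "x \<in> ?X" "y \<in> ?X" "a = ?\<beta> x" "b = ?\<beta> y"
      using \<open>a \<in> W\<close> \<open>b \<in> W\<close> unfolding W_def by (elim imageE)
    show ?thesis unfolding xy(3,4) F.fam_sum_add(2)[OF xy(1,2), symmetric] W_def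
      by (rule imageI[OF F.fam_sum_add(1)[OF xy(1,2)]])
  qed
  have Wsm: "r \<odot>\<^bsub>V\<^esub> a \<in> W" if r: "r \<in> carrier R" and "a \<in> W" for r a
  proof -
    obtain x where x: "x \<in> ?X" "a = ?\<beta> x" using \<open>a \<in> W\<close> unfolding W_def by (elim imageE)
    show ?thesis unfolding x(2) F.fam_sum_smult(2)[OF x(1) r, symmetric] W_def
      by (rule imageI[OF F.fam_sum_smult(1)[OF x(1) r]])
  qed
  have WV: "a \<in> carrier V" if "a \<in> W" for a using that F.fam_sum_closed by (auto simp: W_def)
  have WB: "v \<in> W" if "v \<in> B" for v
  proof -
    have "\<iota> v (unit_T 1) \<in> W"
      unfolding F.fam_sum_single(2)[OF that unit_T_closed, symmetric] W_def
      by (rule imageI[OF F.fam_sum_single(1)[OF that unit_T_closed]])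
    moreover have "\<iota> v (unit_T 1) = v" using V.smult_one[OF BV[OF that]] by (simp add: \<iota>_def one_R)
    ultimately show ?thesis by simp
  qed
  have W0: "\<zero>\<^bsub>V\<^esub> \<in> W"
  proof -
    let ?x = "\<lambda>v\<in>B. \<zero>\<^bsub>T\<^esub>"
    have s: "fam_supp B (\<lambda>_. T) ?x = {}" by (auto simp: fam_supp_def)
    then have "?x \<in> ?X" using F.N_zero by (auto simp: fin_families_def)
    moreover have "?\<beta> ?x = \<zero>\<^bsub>V\<^esub>" by (simp add: fam_sum_def s)
    ultimately show ?thesis unfolding W_def by (intro image_eqI[of _ _ ?x]) simp_all
  qed
  have Wsum: "finsum V (\<lambda>v. single (c v) \<one> \<odot>\<^bsub>V\<^esub> v) F \<in> W" if "finite F" "F \<subseteq> B" for F c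
    using that
  proof (induction rule: finite_induct)
    case (insert v F)
    have vF: "\<And>w. w \<in> F \<Longrightarrow> w \<in> carrier V" "v \<in> carrier V" using insert.prems BV by auto
    have "finsum V (\<lambda>v. single (c v) \<one> \<odot>\<^bsub>V\<^esub> v) (insert v F)
       = single (c v) \<one> \<odot>\<^bsub>V\<^esub> v \<oplus>\<^bsub>V\<^esub> finsum V (\<lambda>v. single (c v) \<one> \<odot>\<^bsub>V\<^esub> v) F"
      using insert.hyps vF by (intro V.M.finsum_insert) auto
    then show ?case using insert WB by (auto intro!: Wadd Wsm)
  qed (simp add: W0)
  have surj: "v \<in> W" if v: "v \<in> carrier V" for v
  proof (cases "v \<in> B")
    case False
    then have "\<not> indep V (insert v B)" using max by blast
    then obtain F c w where F: "finite F" "F \<subseteq> insert v B"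
      "finsum V (\<lambda>v. single (c v) \<one> \<odot>\<^bsub>V\<^esub> v) F = \<zero>\<^bsub>V\<^esub>" "w \<in> F" "c w \<noteq> 0"
      using v BV unfolding indep_def by blast
    have F': "finite (F - {v})" "F - {v} \<subseteq> B" using F by auto
    have FV: "w \<in> carrier V" if "w \<in> F - {v}" for w using F'(2) that BV by blast
    let ?s = "finsum V (\<lambda>v. single (c v) \<one> \<odot>\<^bsub>V\<^esub> v) (F - {v})"
    have sV: "?s \<in> carrier V" using FV by (intro V.M.finsum_closed) auto
    have vF: "v \<in> F"
    proof (rule ccontr)
      assume "v \<notin> F"
      then have "F \<subseteq> B" using F(2) by blast
      from indepD[OF F(1) this F(3,4)] F(5) show False by contradiction
    qed
    have ins: "finsum V (\<lambda>v. single (c v) \<one> \<odot>\<^bsub>V\<^esub> v) (insert v (F - {v})) = single (c v) \<one> \<odot>\<^bsub>V\<^esub> v \<oplus>\<^bsub>V\<^esub> ?s"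
      using F'(1) FV v by (intro V.M.finsum_insert) auto
    then have eq: "single (c v) \<one> \<odot>\<^bsub>V\<^esub> v \<oplus>\<^bsub>V\<^esub> ?s = \<zero>\<^bsub>V\<^esub>"
      using F(3) vF by (simp add: insert_absorb)
    have cv: "c v \<noteq> 0"
    proof
      assume cv: "c v = 0"
      then have s0: "?s = \<zero>\<^bsub>V\<^esub>" using eq v sV by (simp add: single_zero)
      have "w \<in> F - {v}" using F(4,5) cv by auto
      from indepD[OF F' s0 this] F(5) show False by contradiction
    qed
    have "single (c v) \<one> \<odot>\<^bsub>V\<^esub> v = \<ominus>\<^bsub>V\<^esub> ?s"
      using V.M.minus_equality[OF eq] sV v by simp
    then have "single (inverse (c v)) \<one> \<odot>\<^bsub>V\<^esub> (single (c v) \<one> \<odot>\<^bsub>V\<^esub> v)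
        = single (inverse (c v)) \<one> \<odot>\<^bsub>V\<^esub> (single (- 1) \<one> \<odot>\<^bsub>V\<^esub> ?s)"
      using sV V.smult_l_minus[of "\<one>\<^bsub>R\<^esub>" ?s]
      by (simp add: uminus_R) (simp add: one_R single_def if_distrib cong: if_cong)
    then have "v = single (inverse (c v)) \<one> \<odot>\<^bsub>V\<^esub> (single (- 1) \<one> \<odot>\<^bsub>V\<^esub> ?s)"
      using v cv V.smult_one[OF v] by (simp add: V.smult_assoc1[symmetric] single_mult one_R)
    moreover have "\<dots> \<in> W" using Wsum[OF F'] by (intro Wsm) auto
    ultimately show ?thesis by simp
  qed (rule WB)
  have "direct_sum R B (\<lambda>_. T) V" unfolding direct_sum_iff
  proof (intro conjI ballI V(1) module_T exI)
    show "\<iota> v \<in> mod_hom R T V" if "v \<in> B" for v by (rule F.hom[OF that])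
    show "bij_betw ?\<beta> ?X (carrier V)"
      using inj surj WV unfolding bij_betw_def W_def by blast
  qed
  then show thesis by (rule that)
qed

section \<open>Linear maps\<close>

text \<open>Letting \<open>A\<close> act trivially turns a module into its underlying vector space, and \<open>k\<close>-linear maps
  into homomorphisms.\<close>

definition underlying :: "('g \<Rightarrow> 'k, 'u) module \<Rightarrow> ('g \<Rightarrow> 'k, 'u) module" where
  "underlying V = V\<lparr>module.smult := \<lambda>a v. single (aug a) \<one> \<odot>\<^bsub>V\<^esub> v\<rparr>"

lemma underlying_simps [simp]:
  "carrier (underlying V) = carrier V" "x \<oplus>\<^bsub>underlying V\<^esub> y = x \<oplus>\<^bsub>V\<^esub> y"
  "\<zero>\<^bsub>underlying V\<^esub> = \<zero>\<^bsub>V\<^esub>" "a \<odot>\<^bsub>underlying V\<^esub> v = single (aug a) \<one> \<odot>\<^bsub>V\<^esub> v"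
  by (simp_all add: underlying_def)

lemma module_underlying:
  assumes "module R V" shows "module R (underlying V)"
proof -
  interpret V: module R V by fact
  show ?thesis
  proof (rule moduleI)
    show "abelian_group (underlying V)"
    proof (rule abelian_groupI)
      fix x assume "x \<in> carrier (underlying V)"
      then show "\<exists>y\<in>carrier (underlying V). y \<oplus>\<^bsub>underlying V\<^esub> x = \<zero>\<^bsub>underlying V\<^esub>"
        using V.M.l_neg by (intro bexI[of _ "\<ominus>\<^bsub>V\<^esub> x"]) simp_all
    qed (simp_all add: V.M.a_ac)
  next
    fix a b x assume "a \<in> carrier R" "b \<in> carrier R" "x \<in> carrier (underlying V)"
    then show "(a \<otimes>\<^bsub>R\<^esub> b) \<odot>\<^bsub>underlying V\<^esub> x = a \<odot>\<^bsub>underlying V\<^esub> (b \<odot>\<^bsub>underlying V\<^esub> x)"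
      by (simp add: aug_mult V.smult_assoc1[symmetric] single_mult)
  next
    fix x assume "x \<in> carrier (underlying V)"
    then show "\<one>\<^bsub>R\<^esub> \<odot>\<^bsub>underlying V\<^esub> x = x" using V.smult_one[of x] by (simp add: one_R)
  qed (simp_all add: R.cring_axioms V.smult_l_distr[symmetric] V.smult_r_distr aug_add single_add)
qed

lemma trivial_action_underlying: "trivial_action (underlying V)"
  unfolding trivial_action_def by simp

definition klin :: "('g \<Rightarrow> 'k, 'u) module \<Rightarrow> ('g \<Rightarrow> 'k, 'u) module \<Rightarrow> ('u \<Rightarrow> 'u) set" where
  "klin V W = mod_hom R (underlying V) (underlying W)"

lemma klin_closed: "f \<in> klin V W \<Longrightarrow> v \<in> carrier V \<Longrightarrow> f v \<in> carrier W"
  using mod_hom_closed[of f R "underlying V" "underlying W" v] by (simp add: klin_def)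

lemma klin_plus:
  "f \<in> klin V W \<Longrightarrow> v \<in> carrier V \<Longrightarrow> v' \<in> carrier V \<Longrightarrow> f (v \<oplus>\<^bsub>V\<^esub> v') = f v \<oplus>\<^bsub>W\<^esub> f v'"
  using mod_hom_plus[of f R "underlying V" "underlying W" v v'] by (simp add: klin_def)

lemma klin_scale:
  "f \<in> klin V W \<Longrightarrow> v \<in> carrier V \<Longrightarrow> f (single c \<one> \<odot>\<^bsub>V\<^esub> v) = single c \<one> \<odot>\<^bsub>W\<^esub> f v"
  using mod_hom_smult[of f R "underlying V" "underlying W" "single c \<one>" v] by (simp add: klin_def)

lemma klinI:
  assumes "\<And>v. v \<in> carrier V \<Longrightarrow> f v \<in> carrier W"
    and "\<And>v v'. v \<in> carrier V \<Longrightarrow> v' \<in> carrier V \<Longrightarrow> f (v \<oplus>\<^bsub>V\<^esub> v') = f v \<oplus>\<^bsub>W\<^esub> f v'"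
    and "\<And>c v. v \<in> carrier V \<Longrightarrow> f (single c \<one> \<odot>\<^bsub>V\<^esub> v) = single c \<one> \<odot>\<^bsub>W\<^esub> f v"
  shows "f \<in> klin V W"
  unfolding klin_def by (rule mod_homI) (simp_all add: assms)

lemma hom_klin: "f \<in> mod_hom R V W \<Longrightarrow> f \<in> klin V W"
  by (rule klinI) (simp_all add: mod_hom_closed mod_hom_plus mod_hom_smult)

lemma klin_comp: "f \<in> klin V W \<Longrightarrow> g \<in> klin W X \<Longrightarrow> (\<lambda>v. g (f v)) \<in> klin V X"
  unfolding klin_def by (rule mod_hom_comp')

lemma klin_zero:
  assumes "module R V" "module R W" "f \<in> klin V W" shows "f \<zero>\<^bsub>V\<^esub> = \<zero>\<^bsub>W\<^esub>"
  using mod_hom_zero[OF module_underlying[OF assms(1)] module_underlying[OF assms(2)]] assms(3)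
  by (simp add: klin_def)

text \<open>The trivial module is projective relative to modules with trivial action, and those are
  direct sums of copies of it.\<close>

lemma trivial_action_section:
  assumes X: "module R X" "trivial_action X" and N: "module R N" "trivial_action N"
    and g: "g \<in> mod_hom R X N" "g ` carrier X = carrier N"
  obtains s where "s \<in> mod_hom R N X" "\<forall>n\<in>carrier N. g (s n) = n"
proof -
  interpret T: module R T by (rule module_T)
  obtain B :: "'u set" where ds: "direct_sum R B (\<lambda>_. T) N"
    using trivial_action_direct_sum[OF N] .
  obtain \<iota> where \<iota>: "\<forall>j\<in>B. \<iota> j \<in> mod_hom R T N"
    "\<forall>(L :: ('g \<Rightarrow> 'k, 'u) module) h. module R L \<longrightarrow> (\<forall>j\<in>B. h j \<in> mod_hom R T L) \<longrightarrow>
        (\<exists>H\<in>mod_hom R N L. \<forall>j\<in>B. \<forall>x\<in>carrier T. H (\<iota> j x) = h j x)"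
    "\<forall>(L :: ('g \<Rightarrow> 'k, 'u) module) f g. module R L \<longrightarrow> f \<in> mod_hom R N L \<longrightarrow> g \<in> mod_hom R N L \<longrightarrow>
        (\<forall>j\<in>B. \<forall>x\<in>carrier T. f (\<iota> j x) = g (\<iota> j x)) \<longrightarrow> (\<forall>x\<in>carrier N. f x = g x)"
    using direct_sum_universal[OF ds] .
  have "\<forall>j\<in>B. \<exists>x. x \<in> carrier X \<and> g x = \<iota> j (unit_T 1)"
  proof
    fix j assume "j \<in> B"
    then have "\<iota> j (unit_T 1) \<in> g ` carrier X"
      unfolding g(2) using mod_hom_closed[OF \<iota>(1)[rule_format]] by simp
    then show "\<exists>x. x \<in> carrier X \<and> g x = \<iota> j (unit_T 1)" by (elim imageE) auto
  qed
  from bchoice[OF this] obtain x where x: "\<forall>j\<in>B. x j \<in> carrier X \<and> g (x j) = \<iota> j (unit_T 1)" ..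
  define h where "h j t = single (coord_T t) \<one> \<odot>\<^bsub>X\<^esub> x j" for j t
  have h: "\<forall>j\<in>B. h j \<in> mod_hom R T X"
  proof
    fix j assume "j \<in> B"
    then have xj: "x j \<in> carrier X" using x by simp
    show "h j \<in> mod_hom R T X"
      unfolding h_def by (rule hom_from_T[OF X(1) xj trivial_actionD[OF X(2) _ xj]])
  qed
  obtain s where s: "s \<in> mod_hom R N X" "\<forall>j\<in>B. \<forall>t\<in>carrier T. s (\<iota> j t) = h j t"
    using \<iota>(2)[THEN spec, THEN spec, THEN mp, OF X(1), THEN mp, OF h] by (elim bexE)
  have "g (s (\<iota> j t)) = \<iota> j t" if j: "j \<in> B" and t: "t \<in> carrier T" for j t
  proof -
    have "g (s (\<iota> j t)) = single (coord_T t) \<one> \<odot>\<^bsub>N\<^esub> \<iota> j (unit_T 1)"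
      using s(2) j t x by (simp add: h_def mod_hom_smult[OF g(1)])
    also have "\<dots> = \<iota> j (single (coord_T t) \<one> \<odot>\<^bsub>T\<^esub> unit_T 1)"
      using mod_hom_smult[OF \<iota>(1)[rule_format, OF j]] by simp
    also have "\<dots> = \<iota> j t" by (simp add: unit_T_smult unit_coord_T[OF t])
    finally show ?thesis .
  qed
  then have "\<forall>j\<in>B. \<forall>t\<in>carrier T. g (s (\<iota> j t)) = \<iota> j t" by blast
  note \<iota>(3)[THEN spec, THEN spec, THEN spec, THEN mp, OF N(1), THEN mp, OF mod_hom_comp'[OF s(1) g(1)],
      THEN mp, OF mod_hom_ident(2), THEN mp, OF this]
  then show thesis using that[OF s(1)] by simp
qed

lemma klin_section:
  assumes X: "module R X" and N: "module R N" and g: "g \<in> klin X N" "g ` carrier X = carrier N"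
  obtains s where "s \<in> klin N X" "\<forall>n\<in>carrier N. g (s n) = n"
proof -
  have g': "g \<in> mod_hom R (underlying X) (underlying N)" "g ` carrier (underlying X) = carrier (underlying N)"
    using g by (simp_all add: klin_def)
  obtain s where "s \<in> mod_hom R (underlying N) (underlying X)" "\<forall>n\<in>carrier (underlying N). g (s n) = n"
    using trivial_action_section[OF module_underlying[OF X] trivial_action_underlying
        module_underlying[OF N] trivial_action_underlying g'] .
  then show thesis using that by (simp add: klin_def)
qed

text \<open>A section of the quotient map from \<open>Y\<close> to the cokernel of \<open>i\<close> gives a linear retraction of \<open>Y\<close> onto \<open>X\<close>.\<close>

lemma klin_extend:
  assumes X: "module R X" and Y: "module R Y" and V: "module R V"
    and i: "i \<in> klin X Y" "inj_on i (carrier X)" and f: "f \<in> klin X V"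
  obtains h where "h \<in> klin Y V" "\<forall>x\<in>carrier X. h (i x) = f x"
proof -
  let ?X = "underlying X" and ?Y = "underlying Y"
  note uX = module_underlying[OF X] and uY = module_underlying[OF Y]
  have i': "i \<in> mod_hom R ?X ?Y" "inj_on i (carrier ?X)" using i by (simp_all add: klin_def)
  obtain Q and \<pi> where se: "short_exact R ?X i ?Y \<pi> Q" using short_exact_quotient[OF uX uY i'] .
  note D = short_exactD[OF se]
  interpret Y: module R ?Y by (rule uY)
  have "trivial_action Q" unfolding trivial_action_def
  proof (intro ballI)
    fix a v assume a: "a \<in> carrier R" and "v \<in> carrier Q"
    then have "v \<in> \<pi> ` carrier ?Y" unfolding D(8) by simp
    then obtain y where y: "v = \<pi> y" "y \<in> carrier ?Y" by (rule imageE)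
    have "\<pi> (a \<odot>\<^bsub>?Y\<^esub> y) = \<pi> (single (aug a) \<one> \<odot>\<^bsub>?Y\<^esub> y)" by simp
    then show "a \<odot>\<^bsub>Q\<^esub> v = single (aug a) \<one> \<odot>\<^bsub>Q\<^esub> v"
      unfolding y(1) using mod_hom_smult[OF D(5) a y(2)]
        mod_hom_smult[OF D(5) single_closed[OF one_closed, of "aug a"] y(2)] by (rule box_equals)
  qed
  from trivial_action_section[OF uY trivial_action_underlying D(3) this D(5,8)]
  obtain s where s: "s \<in> mod_hom R Q ?Y" "\<forall>n\<in>carrier Q. \<pi> (s n) = n" .
  note s\<pi> = mod_hom_comp'[OF D(5) s(1)]
  define d where "d y = y \<ominus>\<^bsub>?Y\<^esub> s (\<pi> y)" for y
  have d: "d \<in> mod_hom R ?Y ?Y" unfolding d_def by (rule mod_hom_diff_map[OF uY mod_hom_ident(2) s\<pi>])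
  interpret Q: module R Q by (rule D(3))
  have im: "d y \<in> i ` carrier ?X" if y: "y \<in> carrier ?Y" for y
  proof -
    have "\<pi> (d y) = \<pi> y \<ominus>\<^bsub>Q\<^esub> \<pi> (s (\<pi> y))"
      unfolding d_def by (rule mod_hom_minus[OF uY D(3,5) y mod_hom_closed[OF s\<pi> y]])
    also have "\<dots> = \<zero>\<^bsub>Q\<^esub>"
      using s(2) mod_hom_closed[OF D(5) y] by (simp add: Q.M.minus_eq_zero_iff)
    finally show ?thesis unfolding D(7) using mod_hom_closed[OF d y] by blast
  qed
  obtain r where r: "r \<in> mod_hom R ?Y ?X" "\<forall>y\<in>carrier ?Y. i (r y) = d y"
    using mod_hom_factor_through_injection[OF uY uX uY i' d im] .
  have ri: "r (i x) = x" if x: "x \<in> carrier X" for x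
  proof (rule inj_onD[OF i(2)])
    have ix: "i x \<in> carrier ?Y" using mod_hom_closed[OF i'(1)] x by simp
    have "d (i x) = i x \<ominus>\<^bsub>?Y\<^esub> \<zero>\<^bsub>?Y\<^esub>" using D(9) x by (simp add: d_def mod_hom_zero[OF D(3) uY s(1)])
    then show "i (r (i x)) = i x" using r(2) ix by (simp only: Y.M.minus_zero_right)
    show "r (i x) \<in> carrier X" using mod_hom_closed[OF r(1) ix] by simp
  qed (rule x)
  have "r \<in> klin Y X" using r(1) by (simp add: klin_def)
  from that[OF klin_comp[OF this f]] show thesis using ri by simp
qed

section \<open>Coinduced modules\<close>

text \<open>The functions from \<open>A\<close> to a vector space \<open>V\<close> form the coinduced module, which is also induced
  since \<open>A\<close> is finite. Functions are encoded as elements of the universe.\<close>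

definition encode :: "('g \<Rightarrow> 'u) \<Rightarrow> 'u" where
  "encode = (SOME c. inj_on c (carrier A \<rightarrow>\<^sub>E UNIV))"

lemma inj_on_encode: "inj_on encode (carrier A \<rightarrow>\<^sub>E UNIV)"
proof -
  have "(card_of (UNIV \<times> UNIV :: ('u \<times> 'u) set), card_of (UNIV :: 'u set)) \<in> ordLeq"
    using card_of_Times_same_infinite[OF infinite_U] by (rule ordIso_imp_ordLeq)
  then obtain p :: "'u \<times> 'u \<Rightarrow> 'u" where p: "inj_on p (UNIV \<times> UNIV)"
    unfolding card_of_ordLeq[symmetric] by blast
  have "\<exists>c :: ('g \<Rightarrow> 'u) \<Rightarrow> 'u. inj_on c (S \<rightarrow>\<^sub>E UNIV)" if "finite S" for S :: "'g set"
    using that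
  proof (induction rule: finite_induct)
    case empty
    then show ?case by (simp add: PiE_empty_domain)
  next
    case (insert a S)
    then obtain c :: "('g \<Rightarrow> 'u) \<Rightarrow> 'u" where c: "inj_on c (S \<rightarrow>\<^sub>E UNIV)" by blast
    have "inj_on (\<lambda>F. p (F a, c (restrict F S))) (insert a S \<rightarrow>\<^sub>E UNIV)"
    proof (rule inj_onI)
      fix F G assume FG: "F \<in> insert a S \<rightarrow>\<^sub>E UNIV" "G \<in> insert a S \<rightarrow>\<^sub>E UNIV"
        "p (F a, c (restrict F S)) = p (G a, c (restrict G S))"
      then have "F a = G a" "c (restrict F S) = c (restrict G S)"
        using inj_onD[OF p FG(3)] by simp_all
      moreover from this(2) have "restrict F S = restrict G S"
        by (rule inj_onD[OF c]) simp_all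
      then have "F x = G x" if "x \<in> S" for x using that by (metis restrict_apply')
      ultimately show "F = G" using FG(1,2) by (intro PiE_ext[of F _ _ G]) auto
    qed
    then show ?case by blast
  qed
  from this[OF finite_A] show ?thesis unfolding encode_def by (rule someI_ex)
qed

definition decode :: "'u \<Rightarrow> 'g \<Rightarrow> 'u" where
  "decode = inv_into (carrier A \<rightarrow>\<^sub>E UNIV) encode"

lemma decode_encode:
  assumes "F \<in> carrier A \<rightarrow>\<^sub>E V" shows "decode (encode F) = F"
proof -
  have "F \<in> carrier A \<rightarrow>\<^sub>E UNIV" using assms by auto
  then show ?thesis unfolding decode_def by (rule inv_into_f_f[OF inj_on_encode])
qed

text \<open>The action is \<open>(a F)(x) = \<Sum>\<^bsub>y\<^esub> a(y) F(x y)\<close>, so group elements act by translation.\<close>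

definition function_module :: "('g \<Rightarrow> 'k, 'u) module \<Rightarrow> ('g \<Rightarrow> 'k, 'g \<Rightarrow> 'u) module" where
  "function_module V = \<lparr>carrier = carrier A \<rightarrow>\<^sub>E carrier V, monoid.mult = (\<lambda>F G. F),
     one = (\<lambda>x\<in>carrier A. \<zero>\<^bsub>V\<^esub>), zero = (\<lambda>x\<in>carrier A. \<zero>\<^bsub>V\<^esub>),
     add = (\<lambda>F G. \<lambda>x\<in>carrier A. F x \<oplus>\<^bsub>V\<^esub> G x),
     module.smult = (\<lambda>a F. \<lambda>x\<in>carrier A. finsum V (\<lambda>y. single (a y) \<one> \<odot>\<^bsub>V\<^esub> F (x \<otimes> y)) (carrier A))\<rparr>"

lemma function_module_simps:
  "carrier (function_module V) = carrier A \<rightarrow>\<^sub>E carrier V"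
  "\<zero>\<^bsub>function_module V\<^esub> = (\<lambda>x\<in>carrier A. \<zero>\<^bsub>V\<^esub>)"
  "F \<oplus>\<^bsub>function_module V\<^esub> G = (\<lambda>x\<in>carrier A. F x \<oplus>\<^bsub>V\<^esub> G x)"
  "a \<odot>\<^bsub>function_module V\<^esub> F =
     (\<lambda>x\<in>carrier A. finsum V (\<lambda>y. single (a y) \<one> \<odot>\<^bsub>V\<^esub> F (x \<otimes> y)) (carrier A))"
  by (simp_all add: function_module_def)

lemma finsum_translate:
  assumes M: "abelian_monoid M" and g: "g \<in> carrier A" and f: "f \<in> carrier A \<rightarrow> carrier M"
  shows "finsum M f (carrier A) = finsum M (\<lambda>y. f (g \<otimes> y)) (carrier A)"
proof -
  interpret M: abelian_monoid M by fact
  have "finsum M f ((\<lambda>y. g \<otimes> y) ` carrier A) = finsum M (\<lambda>y. f (g \<otimes> y)) (carrier A)"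
    using g f surj_const_mult[OF g] by (intro M.finsum_reindex inj_on_cmult) simp_all
  then show ?thesis by (simp only: surj_const_mult[OF g])
qed

lemma function_module_single:
  assumes V: "module R V" and g: "g \<in> carrier A" and F: "F \<in> carrier A \<rightarrow>\<^sub>E carrier V" and x: "x \<in> carrier A"
  shows "(single c g \<odot>\<^bsub>function_module V\<^esub> F) x = single c \<one> \<odot>\<^bsub>V\<^esub> F (x \<otimes> g)"
proof -
  interpret V: module R V by (rule V)
  have FV: "F y \<in> carrier V" if "y \<in> carrier A" for y using F that by (rule PiE_mem)
  have sg: "single c g y = (if g = y then c else 0)" for y by (simp add: single_def)
  have "finsum V (\<lambda>y. single (single c g y) \<one> \<odot>\<^bsub>V\<^esub> F (x \<otimes> y)) (carrier A)
      = finsum V (\<lambda>y. if g = y then single c \<one> \<odot>\<^bsub>V\<^esub> F (x \<otimes> y) else \<zero>\<^bsub>V\<^esub>) (carrier A)"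
    using x FV by (intro V.M.finsum_cong') (simp_all add: sg single_zero)
  also have "\<dots> = single c \<one> \<odot>\<^bsub>V\<^esub> F (x \<otimes> g)"
    using g x finite_A FV by (intro V.M.finsum_singleton) auto
  finally show ?thesis using x by (simp add: function_module_simps)
qed

lemma module_function_module:
  assumes V: "module R V" shows "module R (function_module V)"
proof -
  interpret V: module R V by (rule V)
  let ?M = "function_module V"
  note s = function_module_simps[of V]
  have FV: "F y \<in> carrier V" if "F \<in> carrier A \<rightarrow>\<^sub>E carrier V" "y \<in> carrier A" for F y
    using that by (rule PiE_mem)
  show ?thesis
  proof (rule moduleI)
    show "cring R" by (rule R.cring_axioms)
    show "abelian_group ?M"
    proof (rule abelian_groupI; unfold s)
      fix F assume F: "F \<in> carrier A \<rightarrow>\<^sub>E carrier V"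
      show "\<exists>G\<in>carrier A \<rightarrow>\<^sub>E carrier V. (\<lambda>x\<in>carrier A. G x \<oplus>\<^bsub>V\<^esub> F x) = (\<lambda>x\<in>carrier A. \<zero>\<^bsub>V\<^esub>)"
      proof (rule bexI)
        show "(\<lambda>x\<in>carrier A. (\<lambda>x\<in>carrier A. \<ominus>\<^bsub>V\<^esub> F x) x \<oplus>\<^bsub>V\<^esub> F x) = (\<lambda>x\<in>carrier A. \<zero>\<^bsub>V\<^esub>)"
          by (rule restrict_ext) (simp add: V.M.l_neg FV[OF F])
        show "(\<lambda>x\<in>carrier A. \<ominus>\<^bsub>V\<^esub> F x) \<in> carrier A \<rightarrow>\<^sub>E carrier V" by (simp add: FV[OF F])
      qed
      show "(\<lambda>x\<in>carrier A. (\<lambda>x\<in>carrier A. \<zero>\<^bsub>V\<^esub>) x \<oplus>\<^bsub>V\<^esub> F x) = F"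
        by (rule PiE_ext[OF _ F]) (simp_all add: FV[OF F])
    next
      fix F G H
      assume F: "F \<in> carrier A \<rightarrow>\<^sub>E carrier V" and G: "G \<in> carrier A \<rightarrow>\<^sub>E carrier V"
        and H: "H \<in> carrier A \<rightarrow>\<^sub>E carrier V"
      show "(\<lambda>x\<in>carrier A. (\<lambda>x\<in>carrier A. F x \<oplus>\<^bsub>V\<^esub> G x) x \<oplus>\<^bsub>V\<^esub> H x)
          = (\<lambda>x\<in>carrier A. F x \<oplus>\<^bsub>V\<^esub> (\<lambda>x\<in>carrier A. G x \<oplus>\<^bsub>V\<^esub> H x) x)"
        using FV[OF F] FV[OF G] FV[OF H] by (intro restrict_ext) (simp add: V.M.a_assoc)
    next
      fix F G assume F: "F \<in> carrier A \<rightarrow>\<^sub>E carrier V" and G: "G \<in> carrier A \<rightarrow>\<^sub>E carrier V"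
      show "(\<lambda>x\<in>carrier A. F x \<oplus>\<^bsub>V\<^esub> G x) \<in> carrier A \<rightarrow>\<^sub>E carrier V"
        by (simp add: FV[OF F] FV[OF G])
      show "(\<lambda>x\<in>carrier A. F x \<oplus>\<^bsub>V\<^esub> G x) = (\<lambda>x\<in>carrier A. G x \<oplus>\<^bsub>V\<^esub> F x)"
        using FV[OF F] FV[OF G] by (intro restrict_ext) (simp add: V.M.a_comm)
    qed simp_all
  next
    fix a F assume a: "a \<in> carrier R" and "F \<in> carrier ?M"
    then have F: "F \<in> carrier A \<rightarrow>\<^sub>E carrier V" by (simp add: s)
    show "a \<odot>\<^bsub>?M\<^esub> F \<in> carrier ?M"
      unfolding s using FV[OF F] by (simp add: Pi_def V.M.finsum_closed)
  next
    fix a b F assume a: "a \<in> carrier R" and b: "b \<in> carrier R" and "F \<in> carrier ?M"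
    then have F: "F \<in> carrier A \<rightarrow>\<^sub>E carrier V" by (simp add: s)
    show "(a \<oplus>\<^bsub>R\<^esub> b) \<odot>\<^bsub>?M\<^esub> F = a \<odot>\<^bsub>?M\<^esub> F \<oplus>\<^bsub>?M\<^esub> b \<odot>\<^bsub>?M\<^esub> F"
      unfolding s
    proof (rule restrict_ext)
      fix x assume x: "x \<in> carrier A"
      have ab: "(a \<oplus>\<^bsub>R\<^esub> b) y = a y + b y" for y by (simp add: add_R)
      have "finsum V (\<lambda>y. single ((a \<oplus>\<^bsub>R\<^esub> b) y) \<one> \<odot>\<^bsub>V\<^esub> F (x \<otimes> y)) (carrier A)
          = finsum V (\<lambda>y. single (a y) \<one> \<odot>\<^bsub>V\<^esub> F (x \<otimes> y) \<oplus>\<^bsub>V\<^esub> single (b y) \<one> \<odot>\<^bsub>V\<^esub> F (x \<otimes> y)) (carrier A)"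
        using FV[OF F] x
        by (intro V.M.finsum_cong') (simp_all add: ab single_add[symmetric] V.smult_l_distr)
      also have "\<dots> = finsum V (\<lambda>y. single (a y) \<one> \<odot>\<^bsub>V\<^esub> F (x \<otimes> y)) (carrier A)
          \<oplus>\<^bsub>V\<^esub> finsum V (\<lambda>y. single (b y) \<one> \<odot>\<^bsub>V\<^esub> F (x \<otimes> y)) (carrier A)"
        using FV[OF F] x by (intro V.M.finsum_addf) auto
      finally show "finsum V (\<lambda>y. single ((a \<oplus>\<^bsub>R\<^esub> b) y) \<one> \<odot>\<^bsub>V\<^esub> F (x \<otimes> y)) (carrier A) =
         (\<lambda>x\<in>carrier A. finsum V (\<lambda>y. single (a y) \<one> \<odot>\<^bsub>V\<^esub> F (x \<otimes> y)) (carrier A)) x \<oplus>\<^bsub>V\<^esub>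
         (\<lambda>x\<in>carrier A. finsum V (\<lambda>y. single (b y) \<one> \<odot>\<^bsub>V\<^esub> F (x \<otimes> y)) (carrier A)) x"
        using x by simp
    qed
    show "(a \<otimes>\<^bsub>R\<^esub> b) \<odot>\<^bsub>?M\<^esub> F = a \<odot>\<^bsub>?M\<^esub> (b \<odot>\<^bsub>?M\<^esub> F)"
      unfolding s
    proof (rule restrict_ext)
      fix x assume x: "x \<in> carrier A"
      have 1: "single ((a \<otimes>\<^bsub>R\<^esub> b) z) \<one> \<odot>\<^bsub>V\<^esub> F (x \<otimes> z)
          = finsum V (\<lambda>y. single (a y * b (inv y \<otimes> z)) \<one> \<odot>\<^bsub>V\<^esub> F (x \<otimes> z)) (carrier A)"
        if "z \<in> carrier A" for z
        using that FV[OF F] x by (simp add: mult_R smult_sum_coeff[OF V _ finite_A])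
      have 2: "finsum V (\<lambda>z. single (a y * b (inv y \<otimes> z)) \<one> \<odot>\<^bsub>V\<^esub> F (x \<otimes> z)) (carrier A)
          = single (a y) \<one> \<odot>\<^bsub>V\<^esub> finsum V (\<lambda>w. single (b w) \<one> \<odot>\<^bsub>V\<^esub> F (x \<otimes> y \<otimes> w)) (carrier A)"
        if y: "y \<in> carrier A" for y
      proof -
        have inv: "inv y \<otimes> (y \<otimes> w) = w" if "w \<in> carrier A" for w
          using y that by (simp add: m_assoc[symmetric])
        have "finsum V (\<lambda>z. single (a y * b (inv y \<otimes> z)) \<one> \<odot>\<^bsub>V\<^esub> F (x \<otimes> z)) (carrier A)
            = finsum V (\<lambda>w. single (a y * b (inv y \<otimes> (y \<otimes> w))) \<one> \<odot>\<^bsub>V\<^esub> F (x \<otimes> (y \<otimes> w))) (carrier A)"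
          using FV[OF F] x y by (intro finsum_translate[OF V.M.abelian_monoid_axioms y]) auto
        also have "\<dots> = finsum V (\<lambda>w. single (a y) \<one> \<odot>\<^bsub>V\<^esub> (single (b w) \<one> \<odot>\<^bsub>V\<^esub> F (x \<otimes> y \<otimes> w))) (carrier A)"
          using FV[OF F] x y
          by (intro V.M.finsum_cong') (auto simp: inv m_assoc V.smult_assoc1[symmetric] single_mult)
        also have "\<dots> = single (a y) \<one> \<odot>\<^bsub>V\<^esub> finsum V (\<lambda>w. single (b w) \<one> \<odot>\<^bsub>V\<^esub> F (x \<otimes> y \<otimes> w)) (carrier A)"
          using FV[OF F] x y finite_A by (intro V.finsum_smult_ldistr[symmetric]) auto
        finally show ?thesis .
      qed
      have "finsum V (\<lambda>z. single ((a \<otimes>\<^bsub>R\<^esub> b) z) \<one> \<odot>\<^bsub>V\<^esub> F (x \<otimes> z)) (carrier A)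
          = finsum V (\<lambda>z. finsum V (\<lambda>y. single (a y * b (inv y \<otimes> z)) \<one> \<odot>\<^bsub>V\<^esub> F (x \<otimes> z)) (carrier A)) (carrier A)"
        using FV[OF F] x by (intro V.M.finsum_cong') (auto simp: 1 intro!: V.M.finsum_closed)
      also have "\<dots> = finsum V (\<lambda>y. finsum V (\<lambda>z. single (a y * b (inv y \<otimes> z)) \<one> \<odot>\<^bsub>V\<^esub> F (x \<otimes> z)) (carrier A)) (carrier A)"
        using FV[OF F] x by (intro V.M.finsum_swap finite_A) auto
      also have "\<dots> = finsum V (\<lambda>y. single (a y) \<one> \<odot>\<^bsub>V\<^esub>
           (\<lambda>x\<in>carrier A. finsum V (\<lambda>w. single (b w) \<one> \<odot>\<^bsub>V\<^esub> F (x \<otimes> w)) (carrier A)) (x \<otimes> y)) (carrier A)"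
        using FV[OF F] x by (intro V.M.finsum_cong') (auto simp: 2 intro!: V.M.finsum_closed)
      finally show "finsum V (\<lambda>y. single ((a \<otimes>\<^bsub>R\<^esub> b) y) \<one> \<odot>\<^bsub>V\<^esub> F (x \<otimes> y)) (carrier A)
          = finsum V (\<lambda>y. single (a y) \<one> \<odot>\<^bsub>V\<^esub>
           (\<lambda>x\<in>carrier A. finsum V (\<lambda>y. single (b y) \<one> \<odot>\<^bsub>V\<^esub> F (x \<otimes> y)) (carrier A)) (x \<otimes> y)) (carrier A)" .
    qed
  next
    fix a F G assume a: "a \<in> carrier R" and "F \<in> carrier ?M" "G \<in> carrier ?M"
    then have F: "F \<in> carrier A \<rightarrow>\<^sub>E carrier V" and G: "G \<in> carrier A \<rightarrow>\<^sub>E carrier V" by (simp_all add: s)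
    show "a \<odot>\<^bsub>?M\<^esub> (F \<oplus>\<^bsub>?M\<^esub> G) = a \<odot>\<^bsub>?M\<^esub> F \<oplus>\<^bsub>?M\<^esub> a \<odot>\<^bsub>?M\<^esub> G"
      unfolding s
    proof (rule restrict_ext)
      fix x assume x: "x \<in> carrier A"
      have "finsum V (\<lambda>y. single (a y) \<one> \<odot>\<^bsub>V\<^esub> (\<lambda>x\<in>carrier A. F x \<oplus>\<^bsub>V\<^esub> G x) (x \<otimes> y)) (carrier A)
          = finsum V (\<lambda>y. single (a y) \<one> \<odot>\<^bsub>V\<^esub> F (x \<otimes> y) \<oplus>\<^bsub>V\<^esub> single (a y) \<one> \<odot>\<^bsub>V\<^esub> G (x \<otimes> y)) (carrier A)"
        using FV[OF F] FV[OF G] x by (intro V.M.finsum_cong') (auto simp: V.smult_r_distr)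
      also have "\<dots> = finsum V (\<lambda>y. single (a y) \<one> \<odot>\<^bsub>V\<^esub> F (x \<otimes> y)) (carrier A)
          \<oplus>\<^bsub>V\<^esub> finsum V (\<lambda>y. single (a y) \<one> \<odot>\<^bsub>V\<^esub> G (x \<otimes> y)) (carrier A)"
        using FV[OF F] FV[OF G] x by (intro V.M.finsum_addf) auto
      finally show "finsum V (\<lambda>y. single (a y) \<one> \<odot>\<^bsub>V\<^esub> (\<lambda>x\<in>carrier A. F x \<oplus>\<^bsub>V\<^esub> G x) (x \<otimes> y)) (carrier A) =
         (\<lambda>x\<in>carrier A. finsum V (\<lambda>y. single (a y) \<one> \<odot>\<^bsub>V\<^esub> F (x \<otimes> y)) (carrier A)) x \<oplus>\<^bsub>V\<^esub>
         (\<lambda>x\<in>carrier A. finsum V (\<lambda>y. single (a y) \<one> \<odot>\<^bsub>V\<^esub> G (x \<otimes> y)) (carrier A)) x"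
        using x by simp
    qed
  next
    fix F assume "F \<in> carrier ?M"
    then have F: "F \<in> carrier A \<rightarrow>\<^sub>E carrier V" by (simp add: s)
    show "\<one>\<^bsub>R\<^esub> \<odot>\<^bsub>?M\<^esub> F = F"
    proof
      fix x
      show "(\<one>\<^bsub>R\<^esub> \<odot>\<^bsub>?M\<^esub> F) x = F x"
      proof (cases "x \<in> carrier A")
        case True
        then show ?thesis
          using function_module_single[OF V one_closed F True, of 1] V.smult_one[OF FV[OF F True]]
          by (simp add: one_R)
      next
        case False
        then show ?thesis using PiE_arb[OF F False] by (simp add: s)
      qed
    qed
  qed
qed

definition coind :: "('g \<Rightarrow> 'k, 'u) module \<Rightarrow> ('g \<Rightarrow> 'k, 'u) module" where
  "coind V = \<lparr>carrier = encode ` carrier (function_module V), monoid.mult = (\<lambda>a b. a),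
     one = encode \<zero>\<^bsub>function_module V\<^esub>, zero = encode \<zero>\<^bsub>function_module V\<^esub>,
     add = (\<lambda>v w. encode (decode v \<oplus>\<^bsub>function_module V\<^esub> decode w)),
     module.smult = (\<lambda>a v. encode (a \<odot>\<^bsub>function_module V\<^esub> decode v))\<rparr>"

lemma carrier_coind: "carrier (coind V) = encode ` (carrier A \<rightarrow>\<^sub>E carrier V)"
  by (simp add: coind_def function_module_simps)

lemma coind_encode_closed: "F \<in> carrier A \<rightarrow>\<^sub>E carrier V \<Longrightarrow> encode F \<in> carrier (coind V)"
  by (simp add: carrier_coind)

lemma coind_decode:
  assumes "w \<in> carrier (coind V)"
  shows "decode w \<in> carrier A \<rightarrow>\<^sub>E carrier V" "encode (decode w) = w"
proof -
  obtain F where F: "w = encode F" "F \<in> carrier A \<rightarrow>\<^sub>E carrier V"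
    using assms unfolding carrier_coind by (rule imageE)
  show "decode w \<in> carrier A \<rightarrow>\<^sub>E carrier V" "encode (decode w) = w"
    using F(2) unfolding F(1) decode_encode[OF F(2)] by simp_all
qed

lemma coind_decode_closed: "w \<in> carrier (coind V) \<Longrightarrow> g \<in> carrier A \<Longrightarrow> decode w g \<in> carrier V"
  by (rule PiE_mem[OF coind_decode(1)])

lemma module_coind:
  assumes V: "module R V" shows "module R (coind V)"
proof (rule module_image[OF module_function_module[OF V]])
  fix x y assume "x \<in> carrier (function_module V)" "y \<in> carrier (function_module V)"
  then show "encode x \<oplus>\<^bsub>coind V\<^esub> encode y = encode (x \<oplus>\<^bsub>function_module V\<^esub> y)"
    using decode_encode[of x "carrier V"] decode_encode[of y "carrier V"]
    by (simp add: coind_def function_module_simps(1))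
next
  fix a x assume "x \<in> carrier (function_module V)"
  then show "a \<odot>\<^bsub>coind V\<^esub> encode x = encode (a \<odot>\<^bsub>function_module V\<^esub> x)"
    using decode_encode[of x "carrier V"] by (simp add: coind_def function_module_simps(1))
qed (simp_all add: coind_def)

lemma coind_eqI:
  assumes v: "v \<in> carrier (coind V)" and w: "w \<in> carrier (coind V)"
    and eq: "\<And>g. g \<in> carrier A \<Longrightarrow> decode v g = decode w g"
  shows "v = w"
proof -
  have "decode v = decode w"
    by (rule PiE_ext[OF coind_decode(1)[OF v] coind_decode(1)[OF w] eq])
  then have "encode (decode v) = encode (decode w)" by simp
  then show ?thesis unfolding coind_decode(2)[OF v] coind_decode(2)[OF w] .
qed

lemma decode_plus:
  assumes V: "module R V" and v: "v \<in> carrier (coind V)" and w: "w \<in> carrier (coind V)"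
    and g: "g \<in> carrier A"
  shows "decode (v \<oplus>\<^bsub>coind V\<^esub> w) g = decode v g \<oplus>\<^bsub>V\<^esub> decode w g"
proof -
  interpret V: module R V by (rule V)
  have "(\<lambda>x\<in>carrier A. decode v x \<oplus>\<^bsub>V\<^esub> decode w x) \<in> carrier A \<rightarrow>\<^sub>E carrier V"
    by (simp add: coind_decode_closed[OF v] coind_decode_closed[OF w])
  from decode_encode[OF this] show ?thesis using g
    by (simp add: coind_def function_module_simps(3))
qed

lemma decode_zero:
  assumes V: "module R V" and g: "g \<in> carrier A"
  shows "decode \<zero>\<^bsub>coind V\<^esub> g = \<zero>\<^bsub>V\<^esub>"
proof -
  interpret V: module R V by (rule V)
  have "(\<lambda>x\<in>carrier A. \<zero>\<^bsub>V\<^esub>) \<in> carrier A \<rightarrow>\<^sub>E carrier V" by simp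
  from decode_encode[OF this] show ?thesis using g
    by (simp add: coind_def function_module_simps(2))
qed

lemma decode_single:
  assumes V: "module R V" and v: "v \<in> carrier (coind V)" and h: "h \<in> carrier A" and g: "g \<in> carrier A"
  shows "decode (single c h \<odot>\<^bsub>coind V\<^esub> v) g = single c \<one> \<odot>\<^bsub>V\<^esub> decode v (g \<otimes> h)"
proof -
  interpret F: module R "function_module V" by (rule module_function_module[OF V])
  have "decode v \<in> carrier (function_module V)"
    using coind_decode(1)[OF v] by (simp add: function_module_simps(1))
  then have "single c h \<odot>\<^bsub>function_module V\<^esub> decode v \<in> carrier A \<rightarrow>\<^sub>E carrier V"
    using F.smult_closed[OF single_closed[OF h, of c]] by (simp add: function_module_simps(1))
  from decode_encode[OF this]
  have "decode (single c h \<odot>\<^bsub>coind V\<^esub> v) = single c h \<odot>\<^bsub>function_module V\<^esub> decode v"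
    by (simp add: coind_def)
  then show ?thesis using function_module_single[OF V h coind_decode(1)[OF v] g] by simp
qed

text \<open>Both Frobenius reciprocities: \<open>to_coind\<close> turns a linear map \<open>Y \<rightarrow> V\<close> into an equivariant map
  \<open>Y \<rightarrow> coind V\<close>, and \<open>from_coind\<close> turns a linear map \<open>V \<rightarrow> X\<close> into an equivariant map \<open>coind V \<rightarrow> X\<close>.\<close>

definition to_coind :: "('g \<Rightarrow> 'k, 'u) module \<Rightarrow> ('u \<Rightarrow> 'u) \<Rightarrow> 'u \<Rightarrow> 'u" where
  "to_coind Y f v = encode (\<lambda>g\<in>carrier A. f (single 1 g \<odot>\<^bsub>Y\<^esub> v))"

definition from_coind :: "('g \<Rightarrow> 'k, 'u) module \<Rightarrow> ('u \<Rightarrow> 'u) \<Rightarrow> 'u \<Rightarrow> 'u" where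
  "from_coind X f w = finsum X (\<lambda>y. single 1 (inv y) \<odot>\<^bsub>X\<^esub> f (decode w y)) (carrier A)"

lemma to_coind:
  assumes Y: "module R Y" and V: "module R V" and f: "f \<in> klin Y V"
  shows to_coind_hom: "to_coind Y f \<in> mod_hom R Y (coind V)"
    and decode_to_coind: "v \<in> carrier Y \<Longrightarrow> g \<in> carrier A \<Longrightarrow> decode (to_coind Y f v) g = f (single 1 g \<odot>\<^bsub>Y\<^esub> v)"
proof -
  interpret Y: module R Y by (rule Y)
  interpret C: module R "coind V" by (rule module_coind[OF V])
  have PiE: "(\<lambda>g\<in>carrier A. f (single 1 g \<odot>\<^bsub>Y\<^esub> v)) \<in> carrier A \<rightarrow>\<^sub>E carrier V" if "v \<in> carrier Y" for v
    using that by (simp add: klin_closed[OF f])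
  have cl: "to_coind Y f v \<in> carrier (coind V)" if "v \<in> carrier Y" for v
    unfolding to_coind_def by (rule coind_encode_closed[OF PiE[OF that]])
  have dec: "decode (to_coind Y f v) g = f (single 1 g \<odot>\<^bsub>Y\<^esub> v)" if "v \<in> carrier Y" "g \<in> carrier A" for v g
    unfolding to_coind_def decode_encode[OF PiE[OF that(1)]] using that(2) by simp
  show "v \<in> carrier Y \<Longrightarrow> g \<in> carrier A \<Longrightarrow> decode (to_coind Y f v) g = f (single 1 g \<odot>\<^bsub>Y\<^esub> v)"
    by (rule dec)
  show "to_coind Y f \<in> mod_hom R Y (coind V)"
  proof (rule mod_homI_group[OF Y module_coind[OF V] cl])
    fix v w assume v: "v \<in> carrier Y" and w: "w \<in> carrier Y"
    show "to_coind Y f (v \<oplus>\<^bsub>Y\<^esub> w) = to_coind Y f v \<oplus>\<^bsub>coind V\<^esub> to_coind Y f w"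
    proof (rule coind_eqI[where V = V])
      fix g assume g: "g \<in> carrier A"
      show "decode (to_coind Y f (v \<oplus>\<^bsub>Y\<^esub> w)) g = decode (to_coind Y f v \<oplus>\<^bsub>coind V\<^esub> to_coind Y f w) g"
        using v w g by (simp add: decode_plus[OF V cl cl] dec Y.smult_r_distr klin_plus[OF f])
    qed (use v w cl in simp_all)
  next
    fix c h v assume h: "h \<in> carrier A" and v: "v \<in> carrier Y"
    show "to_coind Y f (single c h \<odot>\<^bsub>Y\<^esub> v) = single c h \<odot>\<^bsub>coind V\<^esub> to_coind Y f v"
    proof (rule coind_eqI[where V = V])
      fix g assume g: "g \<in> carrier A"
      have "single 1 g \<odot>\<^bsub>Y\<^esub> (single c h \<odot>\<^bsub>Y\<^esub> v) = single c \<one> \<odot>\<^bsub>Y\<^esub> (single 1 (g \<otimes> h) \<odot>\<^bsub>Y\<^esub> v)"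
        using v g h by (simp add: Y.smult_assoc1[symmetric] single_mult)
      then show "decode (to_coind Y f (single c h \<odot>\<^bsub>Y\<^esub> v)) g = decode (single c h \<odot>\<^bsub>coind V\<^esub> to_coind Y f v) g"
        using v g h by (simp add: decode_single[OF V cl] dec klin_scale[OF f])
    qed (use v h cl in simp_all)
  qed
qed

lemma from_coind_hom:
  assumes X: "module R X" and V: "module R V" and f: "f \<in> klin V X"
  shows "from_coind X f \<in> mod_hom R (coind V) X"
proof -
  interpret X: module R X by (rule X)
  interpret C: module R "coind V" by (rule module_coind[OF V])
  have fX: "f (decode w y) \<in> carrier X" if "w \<in> carrier (coind V)" "y \<in> carrier A" for w y
    by (rule klin_closed[OF f coind_decode_closed[OF that]])
  show ?thesis
  proof (rule mod_homI_group[OF module_coind[OF V] X])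
    fix w assume w: "w \<in> carrier (coind V)"
    show "from_coind X f w \<in> carrier X"
      unfolding from_coind_def by (rule X.M.finsum_closed) (simp add: fX[OF w])
  next
    fix v w assume v: "v \<in> carrier (coind V)" and w: "w \<in> carrier (coind V)"
    have "from_coind X f (v \<oplus>\<^bsub>coind V\<^esub> w)
        = finsum X (\<lambda>y. single 1 (inv y) \<odot>\<^bsub>X\<^esub> f (decode v y) \<oplus>\<^bsub>X\<^esub> single 1 (inv y) \<odot>\<^bsub>X\<^esub> f (decode w y)) (carrier A)"
      unfolding from_coind_def
      by (rule X.M.finsum_cong') (simp_all add: fX[OF v] fX[OF w] decode_plus[OF V v w]
          klin_plus[OF f] coind_decode_closed[OF v] coind_decode_closed[OF w] X.smult_r_distr)
    also have "\<dots> = from_coind X f v \<oplus>\<^bsub>X\<^esub> from_coind X f w"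
      unfolding from_coind_def by (rule X.M.finsum_addf) (simp_all add: fX[OF v] fX[OF w])
    finally show "from_coind X f (v \<oplus>\<^bsub>coind V\<^esub> w) = from_coind X f v \<oplus>\<^bsub>X\<^esub> from_coind X f w" .
  next
    fix c h w assume h: "h \<in> carrier A" and w: "w \<in> carrier (coind V)"
    have inv_eq: "h \<otimes> inv (h \<otimes> y) = inv y" if "y \<in> carrier A" for y
    proof -
      have "h \<otimes> inv (h \<otimes> y) = h \<otimes> (inv h \<otimes> inv y)" using h that by (simp add: inv_mult)
      also have "\<dots> = inv y" using h that by (simp add: m_assoc[symmetric])
      finally show ?thesis .
    qed
    have "single c h \<odot>\<^bsub>X\<^esub> from_coind X f w
        = finsum X (\<lambda>z. single c h \<odot>\<^bsub>X\<^esub> (single 1 (inv z) \<odot>\<^bsub>X\<^esub> f (decode w z))) (carrier A)"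
      unfolding from_coind_def
      by (rule X.finsum_smult_ldistr[OF finite_A single_closed[OF h]]) (simp add: fX[OF w])
    also have "\<dots> = finsum X (\<lambda>y. single c h \<odot>\<^bsub>X\<^esub> (single 1 (inv (h \<otimes> y)) \<odot>\<^bsub>X\<^esub> f (decode w (h \<otimes> y)))) (carrier A)"
      by (rule finsum_translate[OF X.M.abelian_monoid_axioms h]) (simp add: fX[OF w] h)
    also have "\<dots> = finsum X (\<lambda>y. single 1 (inv y) \<odot>\<^bsub>X\<^esub> f (decode (single c h \<odot>\<^bsub>coind V\<^esub> w) y)) (carrier A)"
    proof (rule X.M.finsum_cong')
      fix y assume y: "y \<in> carrier A"
      show "single c h \<odot>\<^bsub>X\<^esub> (single 1 (inv (h \<otimes> y)) \<odot>\<^bsub>X\<^esub> f (decode w (h \<otimes> y)))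
          = single 1 (inv y) \<odot>\<^bsub>X\<^esub> f (decode (single c h \<odot>\<^bsub>coind V\<^esub> w) y)"
        using h y fX[OF w] by (simp add: decode_single[OF V w] klin_scale[OF f coind_decode_closed[OF w]]
            X.smult_assoc1[symmetric] single_mult inv_eq m_comm[of y h])
    qed (use h fX[OF C.smult_closed[OF single_closed[OF h] w]] in simp_all)
    finally show "from_coind X f (single c h \<odot>\<^bsub>coind V\<^esub> w) = single c h \<odot>\<^bsub>X\<^esub> from_coind X f w"
      unfolding from_coind_def by (rule sym)
  qed
qed

definition at_one :: "('g \<Rightarrow> 'k, 'u) module \<Rightarrow> 'u \<Rightarrow> 'u" where
  "at_one V v = encode (\<lambda>x\<in>carrier A. if x = \<one> then v else \<zero>\<^bsub>V\<^esub>)"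

lemma at_one:
  assumes V: "module R V"
  shows at_one_klin: "at_one V \<in> klin V (coind V)"
    and decode_at_one: "v \<in> carrier V \<Longrightarrow> g \<in> carrier A \<Longrightarrow> decode (at_one V v) g = (if g = \<one> then v else \<zero>\<^bsub>V\<^esub>)"
proof -
  interpret V: module R V by (rule V)
  interpret C: module R "coind V" by (rule module_coind[OF V])
  have PiE: "(\<lambda>x\<in>carrier A. if x = \<one> then v else \<zero>\<^bsub>V\<^esub>) \<in> carrier A \<rightarrow>\<^sub>E carrier V" if "v \<in> carrier V" for v
    using that by simp
  have cl: "at_one V v \<in> carrier (coind V)" if "v \<in> carrier V" for v
    unfolding at_one_def by (rule coind_encode_closed[OF PiE[OF that]])
  have dec: "decode (at_one V v) g = (if g = \<one> then v else \<zero>\<^bsub>V\<^esub>)" if "v \<in> carrier V" "g \<in> carrier A" for v g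
    unfolding at_one_def decode_encode[OF PiE[OF that(1)]] using that(2) by simp
  show "v \<in> carrier V \<Longrightarrow> g \<in> carrier A \<Longrightarrow> decode (at_one V v) g = (if g = \<one> then v else \<zero>\<^bsub>V\<^esub>)"
    by (rule dec)
  show "at_one V \<in> klin V (coind V)"
  proof (rule klinI[OF cl])
    fix v w assume v: "v \<in> carrier V" and w: "w \<in> carrier V"
    show "at_one V (v \<oplus>\<^bsub>V\<^esub> w) = at_one V v \<oplus>\<^bsub>coind V\<^esub> at_one V w"
      by (rule coind_eqI[where V = V]) (use v w cl in \<open>simp_all add: decode_plus[OF V cl cl] dec\<close>)
  next
    fix c v assume v: "v \<in> carrier V"
    show "at_one V (single c \<one> \<odot>\<^bsub>V\<^esub> v) = single c \<one> \<odot>\<^bsub>coind V\<^esub> at_one V v"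
      by (rule coind_eqI[where V = V]) (use v cl in \<open>simp_all add: decode_single[OF V cl] dec\<close>)
  qed
qed

lemma from_coind_at_one:
  assumes X: "module R X" and V: "module R V" and f: "f \<in> klin V X" and v: "v \<in> carrier V"
  shows "from_coind X f (at_one V v) = f v"
proof -
  interpret X: module R X by (rule X)
  interpret V: module R V by (rule V)
  have fv: "f v \<in> carrier X" by (rule klin_closed[OF f v])
  have "from_coind X f (at_one V v) = finsum X (\<lambda>y. if \<one> = y then single 1 (inv y) \<odot>\<^bsub>X\<^esub> f v else \<zero>\<^bsub>X\<^esub>) (carrier A)"
    unfolding from_coind_def
  proof (rule X.M.finsum_cong')
    fix y assume y: "y \<in> carrier A"
    show "single 1 (inv y) \<odot>\<^bsub>X\<^esub> f (decode (at_one V v) y) = (if \<one> = y then single 1 (inv y) \<odot>\<^bsub>X\<^esub> f v else \<zero>\<^bsub>X\<^esub>)"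
      using y by (simp add: decode_at_one[OF V v] klin_zero[OF V X f])
  qed (use fv in simp_all)
  also have "\<dots> = single 1 (inv \<one>) \<odot>\<^bsub>X\<^esub> f v"
    using fv finite_A by (intro X.M.finsum_singleton) simp_all
  finally show ?thesis using X.smult_one[OF fv] by (simp add: one_R)
qed

text \<open>Every function is a sum of translates of functions concentrated at the identity.\<close>

lemma coind_sum:
  assumes V: "module R V" and w: "w \<in> carrier (coind V)"
  shows "from_coind (coind V) (at_one V) w = w"
proof (rule coind_eqI[where V = V])
  interpret V: module R V by (rule V)
  interpret C: module R "coind V" by (rule module_coind[OF V])
  have al: "at_one V v \<in> carrier (coind V)" if "v \<in> carrier V" for v
    by (rule klin_closed[OF at_one_klin[OF V] that])
  show "from_coind (coind V) (at_one V) w \<in> carrier (coind V)"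
    by (rule mod_hom_closed[OF from_coind_hom[OF module_coind[OF V] V at_one_klin[OF V]] w])
  fix g assume g: "g \<in> carrier A"
  have t: "(\<lambda>y. single 1 (inv y) \<odot>\<^bsub>coind V\<^esub> at_one V (decode w y)) \<in> carrier A \<rightarrow> carrier (coind V)"
    by (simp add: al coind_decode_closed[OF w])
  have "decode (from_coind (coind V) (at_one V) w) g
      = finsum V (\<lambda>y. decode (single 1 (inv y) \<odot>\<^bsub>coind V\<^esub> at_one V (decode w y)) g) (carrier A)"
    unfolding from_coind_def
    by (rule additive_map_finsum[where f = "\<lambda>u. decode u g", OF C.M.abelian_monoid_axioms V.M.abelian_monoid_axioms
          coind_decode_closed[OF _ g] decode_zero[OF V g] decode_plus[OF V _ _ g] finite_A t])
  also have "\<dots> = finsum V (\<lambda>y. if g = y then decode w y else \<zero>\<^bsub>V\<^esub>) (carrier A)"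
  proof (rule V.M.finsum_cong')
    fix y assume y: "y \<in> carrier A"
    have "g \<otimes> inv y = \<one> \<longleftrightarrow> g = y" using g y by (metis inv_closed inv_equality inv_inv r_inv)
    then show "decode (single 1 (inv y) \<odot>\<^bsub>coind V\<^esub> at_one V (decode w y)) g = (if g = y then decode w y else \<zero>\<^bsub>V\<^esub>)"
      using V.smult_one[OF coind_decode_closed[OF w y]] y g coind_decode_closed[OF w y]
      by (simp add: decode_single[OF V al] decode_at_one[OF V] one_R)
  qed (simp_all add: coind_decode_closed[OF w])
  also have "\<dots> = decode w g"
    by (rule V.M.finsum_singleton[OF g finite_A]) (simp add: coind_decode_closed[OF w])
  finally show "decode (from_coind (coind V) (at_one V) w) g = decode w g" .
qed (rule w)

text \<open>The restriction of a map to the functions concentrated at the identity lifts linearly, and the lift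
  extends equivariantly to \<open>coind V\<close>.\<close>

lemma projective_coind:
  assumes V: "module R V" shows "projective R (coind V)"
  unfolding projective_def
proof (intro conjI allI impI ballI)
  show C: "module R (coind V)" by (rule module_coind[OF V])
  fix M N :: "('g \<Rightarrow> 'k, 'u) module" and g f
  assume MN: "module R M \<and> module R N" and g: "g \<in> mod_hom R M N" and f: "f \<in> mod_hom R (coind V) N"
    and surj: "g ` carrier M = carrier N"
  have M: "module R M" and N: "module R N" using MN by simp_all
  interpret M: module R M by (rule M)
  interpret C: module R "coind V" by (rule C)
  obtain s where s: "s \<in> klin N M" "\<forall>n\<in>carrier N. g (s n) = n"
    using klin_section[OF M N hom_klin[OF g] surj] .
  have fe: "(\<lambda>v. f (at_one V v)) \<in> klin V N" by (rule klin_comp[OF at_one_klin[OF V] hom_klin[OF f]])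
  have sfe: "(\<lambda>v. s (f (at_one V v))) \<in> klin V M" by (rule klin_comp[OF fe s(1)])
  let ?h = "from_coind M (\<lambda>v. s (f (at_one V v)))"
  show "\<exists>h\<in>mod_hom R (coind V) M. \<forall>x\<in>carrier (coind V). g (h x) = f x"
  proof (intro bexI ballI)
    show "?h \<in> mod_hom R (coind V) M" by (rule from_coind_hom[OF M V sfe])
    fix w assume w: "w \<in> carrier (coind V)"
    have cl: "s (f (at_one V (decode w y))) \<in> carrier M" "f (at_one V (decode w y)) \<in> carrier N"
      "at_one V (decode w y) \<in> carrier (coind V)" if "y \<in> carrier A" for y
      using klin_closed[OF sfe coind_decode_closed[OF w that]] klin_closed[OF fe coind_decode_closed[OF w that]]
        klin_closed[OF at_one_klin[OF V] coind_decode_closed[OF w that]] by simp_all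
    have "g (?h w) = finsum N (\<lambda>y. g (single 1 (inv y) \<odot>\<^bsub>M\<^esub> s (f (at_one V (decode w y))))) (carrier A)"
      unfolding from_coind_def by (rule mod_hom_finsum[OF M N g finite_A]) (simp add: cl)
    also have "\<dots> = finsum N (\<lambda>y. f (single 1 (inv y) \<odot>\<^bsub>coind V\<^esub> at_one V (decode w y))) (carrier A)"
    proof (rule abelian_monoid.finsum_cong'[OF abelian_group.axioms(1)[OF module.axioms(2)[OF N]] refl])
      fix y assume y: "y \<in> carrier A"
      show "g (single 1 (inv y) \<odot>\<^bsub>M\<^esub> s (f (at_one V (decode w y)))) = f (single 1 (inv y) \<odot>\<^bsub>coind V\<^esub> at_one V (decode w y))"
        using y cl[OF y] s(2) by (simp add: mod_hom_smult[OF g] mod_hom_smult[OF f])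
    qed (use cl(3) mod_hom_closed[OF f] in simp)
    also have "\<dots> = f (from_coind (coind V) (at_one V) w)"
      unfolding from_coind_def by (rule mod_hom_finsum[OF C N f finite_A, symmetric]) (simp add: cl)
    finally show "g (?h w) = f w" by (simp only: coind_sum[OF V w])
  qed
qed

text \<open>The composite of \<open>f\<close> with evaluation at the identity extends linearly from \<open>X\<close> to \<open>Y\<close>, and \<open>f\<close> is
  recovered from it by reciprocity.\<close>

lemma coind_extend:
  assumes V: "module R V" and X: "module R X" and Y: "module R Y"
    and i: "i \<in> mod_hom R X Y" "inj_on i (carrier X)" and f: "f \<in> mod_hom R X (coind V)"
  obtains h where "h \<in> mod_hom R Y (coind V)" "\<forall>x\<in>carrier X. h (i x) = f x"
proof -
  interpret X: module R X by (rule X)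
  interpret V: module R V by (rule V)
  have ev: "(\<lambda>w. decode w \<one>) \<in> klin (coind V) V"
    by (rule klinI) (simp_all add: coind_decode_closed decode_plus[OF V] decode_single[OF V])
  obtain k where k: "k \<in> klin Y V" "\<forall>x\<in>carrier X. k (i x) = decode (f x) \<one>"
    using klin_extend[OF X Y V hom_klin[OF i(1)] i(2) klin_comp[OF hom_klin[OF f] ev]] .
  have "to_coind Y k (i x) = f x" if x: "x \<in> carrier X" for x
  proof (rule coind_eqI[where V = V])
    have ix: "i x \<in> carrier Y" by (rule mod_hom_closed[OF i(1) x])
    have fx: "f x \<in> carrier (coind V)" by (rule mod_hom_closed[OF f x])
    show "to_coind Y k (i x) \<in> carrier (coind V)" by (rule mod_hom_closed[OF to_coind_hom[OF Y V k(1)] ix])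
    fix g assume g: "g \<in> carrier A"
    have "decode (to_coind Y k (i x)) g = k (i (single 1 g \<odot>\<^bsub>X\<^esub> x))"
      using g x by (simp add: decode_to_coind[OF Y V k(1) ix] mod_hom_smult[OF i(1)])
    also have "\<dots> = decode (single 1 g \<odot>\<^bsub>coind V\<^esub> f x) \<one>"
      using g x k(2) by (simp add: mod_hom_smult[OF f])
    also have "\<dots> = decode (f x) g"
      using g V.smult_one[OF coind_decode_closed[OF fx g]] by (simp add: decode_single[OF V fx] one_R)
    finally show "decode (to_coind Y k (i x)) g = decode (f x) g" .
  qed (use mod_hom_closed[OF f x] in simp)
  then show thesis using that[OF to_coind_hom[OF Y V k(1)]] by simp
qed

lemma klin_ident: "(\<lambda>v. v) \<in> klin V V"
  by (rule klinI) simp_all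

lemma from_coind_surj:
  assumes V: "module R V"
  shows "from_coind V (\<lambda>v. v) ` carrier (coind V) = carrier V"
proof
  show "from_coind V (\<lambda>v. v) ` carrier (coind V) \<subseteq> carrier V"
    using mod_hom_closed[OF from_coind_hom[OF V V klin_ident]] by blast
  show "carrier V \<subseteq> from_coind V (\<lambda>v. v) ` carrier (coind V)"
  proof
    fix v assume v: "v \<in> carrier V"
    have "from_coind V (\<lambda>v. v) (at_one V v) \<in> from_coind V (\<lambda>v. v) ` carrier (coind V)"
      by (rule imageI) (rule klin_closed[OF at_one_klin[OF V] v])
    then show "v \<in> from_coind V (\<lambda>v. v) ` carrier (coind V)"
      unfolding from_coind_at_one[OF V V klin_ident v] .
  qed
qed

text \<open>A module is a quotient and a submodule of its coinduced module, by reciprocity for the identity map.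
  A projective module is even a retract of it and so inherits injectivity.\<close>

sublocale frobenius_modules R "TYPE('u)"
proof
  fix M :: "('g \<Rightarrow> 'k, 'u) module"
  assume M: "module R M"
  interpret M: module R M by (rule M)
  let ?q = "from_coind M (\<lambda>v. v)" and ?i = "to_coind M (\<lambda>v. v)"
  have q: "?q \<in> mod_hom R (coind M) M" by (rule from_coind_hom[OF M M klin_ident])
  show "\<exists>P q. projective R P \<and> q \<in> mod_hom R P M \<and> q ` carrier P = carrier M"
    by (intro exI conjI, rule projective_coind[OF M], rule q, rule from_coind_surj[OF M])
  have i: "?i \<in> mod_hom R M (coind M)" by (rule to_coind_hom[OF M M klin_ident])
  have inj: "inj_on ?i (carrier M)"
  proof (rule inj_onI)
    fix v w assume v: "v \<in> carrier M" and w: "w \<in> carrier M" and eq: "?i v = ?i w"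
    have "decode (?i v) \<one> = decode (?i w) \<one>" using eq by simp
    then show "v = w"
      using v w M.smult_one[OF v] M.smult_one[OF w]
      by (simp add: decode_to_coind[OF M M klin_ident] one_R)
  qed
  show "\<exists>P i. projective R P \<and> i \<in> mod_hom R M P \<and> inj_on i (carrier M)"
    by (intro exI conjI, rule projective_coind[OF M], rule i, rule inj)
next
  fix P X Y :: "('g \<Rightarrow> 'k, 'u) module" and i f
  assume P: "projective R P" and X: "module R X" and Y: "module R Y"
    and i: "i \<in> mod_hom R X Y" "inj_on i (carrier X)" and f: "f \<in> mod_hom R X P"
  note mP = projective_module[OF P]
  let ?q = "from_coind P (\<lambda>v. v)"
  have q: "?q \<in> mod_hom R (coind P) P" by (rule from_coind_hom[OF mP mP klin_ident])
  note surj = from_coind_surj[OF mP]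
  obtain s where s: "s \<in> mod_hom R P (coind P)" "\<And>x. x \<in> carrier P \<Longrightarrow> ?q (s x) = x"
    using projective_lift[OF P module_coind[OF mP] mP q surj mod_hom_ident(2)] by blast
  obtain h where h: "h \<in> mod_hom R Y (coind P)" "\<forall>x\<in>carrier X. h (i x) = s (f x)"
    using coind_extend[OF mP X Y i mod_hom_comp'[OF f s(1)]] .
  show "\<exists>h\<in>mod_hom R Y P. \<forall>x\<in>carrier X. h (i x) = f x"
    by (rule bexI[OF _ mod_hom_comp'[OF h(1) q]]) (simp add: h(2) s(2) mod_hom_closed[OF f])
qed

section \<open>The augmentation ideal\<close>

definition aug_ideal :: "('g \<Rightarrow> 'k) set" where
  "aug_ideal = {a \<in> carrier R. aug a = 0}"

lemma aug_zero: "aug \<zero>\<^bsub>R\<^esub> = 0" by (simp add: aug_def zero_R)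

lemma aug_minus:
  "a \<in> carrier R \<Longrightarrow> b \<in> carrier R \<Longrightarrow> aug (a \<ominus>\<^bsub>R\<^esub> b) = aug a - aug b"
  by (simp add: minus_R aug_def sum_subtractf)

lemma aug_uminus: "a \<in> carrier R \<Longrightarrow> aug (\<ominus>\<^bsub>R\<^esub> a) = - aug a"
  by (simp add: uminus_R aug_def sum_negf)

lemma ideal_aug_ideal: "ideal aug_ideal R"
proof (rule idealI[OF R.ring_axioms])
  show "subgroup aug_ideal (add_monoid R)"
  proof (rule R.add.subgroupI)
    show "aug_ideal \<subseteq> carrier R" by (auto simp: aug_ideal_def)
    show "aug_ideal \<noteq> {}" using aug_zero R.zero_closed by (auto simp: aug_ideal_def)
    show "\<ominus>\<^bsub>R\<^esub> a \<in> aug_ideal" if "a \<in> aug_ideal" for a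
      using that by (simp add: aug_ideal_def aug_uminus)
    show "a \<oplus>\<^bsub>R\<^esub> b \<in> aug_ideal" if "a \<in> aug_ideal" "b \<in> aug_ideal" for a b
      using that by (simp add: aug_ideal_def aug_add)
  qed
qed (simp_all add: aug_ideal_def aug_mult)

lemma ideal_ideal_power:
  assumes "ideal I R" shows "ideal (ideal_power R I n) R"
  by (induction n) (simp_all add: R.oneideal R.ideal_prod_is_ideal assms)

lemma aug_ideal_closed: "a \<in> aug_ideal \<Longrightarrow> a \<in> carrier R"
  by (simp add: aug_ideal_def)

lemma aug_power_closed: "r \<in> ideal_power R aug_ideal n \<Longrightarrow> r \<in> carrier R"
  by (rule ideal.Icarr[OF ideal_ideal_power[OF ideal_aug_ideal]])

lemma aug_power_Suc: "a \<in> aug_ideal \<Longrightarrow> r \<in> ideal_power R aug_ideal n \<Longrightarrow> a \<otimes>\<^bsub>R\<^esub> r \<in> ideal_power R aug_ideal (Suc n)"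
  by (simp add: ideal_prod.prod)

lemma minus_aug_in_aug_ideal:
  assumes "a \<in> carrier R" shows "a \<ominus>\<^bsub>R\<^esub> single (aug a) \<one> \<in> aug_ideal"
  using assms by (simp add: aug_ideal_def aug_minus)

lemma fixed_smult:
  assumes M: "module R M" and v: "v \<in> carrier M" and fixed: "\<forall>a\<in>aug_ideal. a \<odot>\<^bsub>M\<^esub> v = \<zero>\<^bsub>M\<^esub>"
    and a: "a \<in> carrier R"
  shows "a \<odot>\<^bsub>M\<^esub> v = single (aug a) \<one> \<odot>\<^bsub>M\<^esub> v"
proof -
  interpret M: module R M by (rule M)
  have s: "single (aug a) \<one> \<in> carrier R" by simp
  have "a = (a \<ominus>\<^bsub>R\<^esub> single (aug a) \<one>) \<oplus>\<^bsub>R\<^esub> single (aug a) \<one>"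
    using a s by (simp add: a_minus_def R.a_assoc R.l_neg)
  then have "a \<odot>\<^bsub>M\<^esub> v = (a \<ominus>\<^bsub>R\<^esub> single (aug a) \<one>) \<odot>\<^bsub>M\<^esub> v \<oplus>\<^bsub>M\<^esub> single (aug a) \<one> \<odot>\<^bsub>M\<^esub> v"
    using M.smult_l_distr[OF R.minus_closed[OF a s] s v] by simp
  then show ?thesis using fixed minus_aug_in_aug_ideal[OF a] M.smult_closed[OF s v] by simp
qed

lemma fixed_trivial_action:
  assumes M: "module R M" and "\<And>a v. a \<in> aug_ideal \<Longrightarrow> v \<in> carrier M \<Longrightarrow> a \<odot>\<^bsub>M\<^esub> v = \<zero>\<^bsub>M\<^esub>"
  shows "trivial_action M"
  unfolding trivial_action_def using fixed_smult[OF M] assms(2) by blast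

text \<open>Multiplication by an element of the augmentation ideal is natural and kills \<open>k\<close>, so it is a ghost
  on every module.\<close>

lemma proj_null_scale_T:
  assumes r: "r \<in> aug_ideal"
  shows "proj_null R T T (\<lambda>x. r \<odot>\<^bsub>T\<^esub> x)"
proof (rule proj_null_cong[OF proj_null_zero[OF module_T module_T]])
  fix t assume "t \<in> carrier T"
  then show "r \<odot>\<^bsub>T\<^esub> t = \<zero>\<^bsub>T\<^esub>"
    using unit_T_smult[OF aug_ideal_closed[OF r], of "coord_T t"] r
    by (simp add: unit_coord_T aug_ideal_def unit_T_zero)
qed

text \<open>Multiply a nonzero vector by a longest product of elements of the augmentation ideal that does
  not kill it.\<close>

lemma socle_multiple:
  assumes nil: "ideal_power R aug_ideal n = {\<zero>\<^bsub>R\<^esub>}"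
    and M: "module R M" and v: "v \<in> carrier M" "v \<noteq> \<zero>\<^bsub>M\<^esub>"
  obtains r where "r \<in> carrier R" "r \<odot>\<^bsub>M\<^esub> v \<noteq> \<zero>\<^bsub>M\<^esub>" "\<forall>a\<in>aug_ideal. a \<odot>\<^bsub>M\<^esub> (r \<odot>\<^bsub>M\<^esub> v) = \<zero>\<^bsub>M\<^esub>"
proof -
  interpret M: module R M by (rule M)
  let ?P = "\<lambda>i. \<forall>r\<in>ideal_power R aug_ideal i. r \<odot>\<^bsub>M\<^esub> v = \<zero>\<^bsub>M\<^esub>"
  have P0: "\<not> ?P 0"
  proof
    assume "?P 0"
    then have "\<one>\<^bsub>R\<^esub> \<odot>\<^bsub>M\<^esub> v = \<zero>\<^bsub>M\<^esub>" using R.one_closed unfolding ideal_power.simps by (rule bspec)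
    then show False using v by simp
  qed
  have Pn: "?P n" using v by (simp add: nil)
  define i where "i = (LEAST i. ?P i)"
  have Pi: "?P i" unfolding i_def by (rule LeastI[of ?P, OF Pn])
  with P0 obtain j where j: "i = Suc j" by (cases i) auto
  have "\<not> ?P j" using not_less_Least[of j ?P] j unfolding i_def by simp
  then obtain r where r: "r \<in> ideal_power R aug_ideal j" "r \<odot>\<^bsub>M\<^esub> v \<noteq> \<zero>\<^bsub>M\<^esub>" by blast
  note rR = aug_power_closed[OF r(1)]
  have "a \<odot>\<^bsub>M\<^esub> (r \<odot>\<^bsub>M\<^esub> v) = \<zero>\<^bsub>M\<^esub>" if "a \<in> aug_ideal" for a
    using Pi aug_power_Suc[OF that r(1)] M.smult_assoc1[OF aug_ideal_closed[OF that] rR v(1)] unfolding j by simp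
  then show thesis using that rR r(2) by blast
qed

text \<open>The norm element: multiplication by group elements fixes it, and it spans the socle.\<close>

definition norm_elt :: "'g \<Rightarrow> 'k" where
  "norm_elt = (\<lambda>x. if x \<in> carrier A then 1 else 0)"

lemma norm_elt_closed: "norm_elt \<in> carrier R"
  by (simp add: norm_elt_def carrier_R)

lemma norm_smult:
  assumes M: "module R M" and v: "v \<in> carrier M"
  shows "norm_elt \<odot>\<^bsub>M\<^esub> v = finsum M (\<lambda>y. single 1 (inv y) \<odot>\<^bsub>M\<^esub> v) (carrier A)"
proof -
  interpret M: module R M by (rule M)
  have surj: "(\<lambda>y. inv y) ` carrier A = carrier A"
  proof
    show "carrier A \<subseteq> (\<lambda>y. inv y) ` carrier A"
    proof
      fix x assume "x \<in> carrier A"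
      then show "x \<in> (\<lambda>y. inv y) ` carrier A" by (intro image_eqI[of _ _ "inv x"]) simp_all
    qed
  qed auto
  have "norm_elt \<odot>\<^bsub>M\<^esub> v = finsum M (\<lambda>y. single (norm_elt y) y \<odot>\<^bsub>M\<^esub> v) (carrier A)"
    by (rule module_sum_of_singles[OF M norm_elt_closed v])
  also have "\<dots> = finsum M (\<lambda>y. single 1 y \<odot>\<^bsub>M\<^esub> v) (carrier A)"
    by (rule M.M.finsum_cong') (simp_all add: norm_elt_def v)
  also have "\<dots> = finsum M (\<lambda>y. single 1 y \<odot>\<^bsub>M\<^esub> v) ((\<lambda>y. inv y) ` carrier A)" by (simp only: surj)
  also have "\<dots> = finsum M (\<lambda>y. single 1 (inv y) \<odot>\<^bsub>M\<^esub> v) (carrier A)"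
    by (rule M.M.finsum_reindex) (auto simp: v inj_on_def)
  finally show ?thesis .
qed

text \<open>An element killed by all \<open>g - 1\<close> is constant on \<open>A\<close>.\<close>

lemma socle_of_R:
  assumes a: "a \<in> carrier R" and killed: "\<And>b. b \<in> aug_ideal \<Longrightarrow> b \<otimes>\<^bsub>R\<^esub> a = \<zero>\<^bsub>R\<^esub>"
  shows "a = single (a \<one>) \<one> \<otimes>\<^bsub>R\<^esub> norm_elt"
proof
  fix z
  show "a z = (single (a \<one>) \<one> \<otimes>\<^bsub>R\<^esub> norm_elt) z"
  proof (cases "z \<in> carrier A")
    case z: True
    have "single 1 z \<ominus>\<^bsub>R\<^esub> single 1 \<one> \<in> aug_ideal" using z by (simp add: aug_ideal_def aug_minus)
    from killed[OF this] have "single 1 z \<otimes>\<^bsub>R\<^esub> a \<ominus>\<^bsub>R\<^esub> single 1 \<one> \<otimes>\<^bsub>R\<^esub> a = \<zero>\<^bsub>R\<^esub>"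
      using z a by (simp add: a_minus_def R.l_distr R.l_minus)
    then have "single 1 z \<otimes>\<^bsub>R\<^esub> a = single 1 \<one> \<otimes>\<^bsub>R\<^esub> a"
      using z a R.minus_eq_zero_iff[of "single 1 z \<otimes>\<^bsub>R\<^esub> a" "single 1 \<one> \<otimes>\<^bsub>R\<^esub> a"] by simp
    from fun_cong[OF this, of z] show ?thesis
      using z by (simp add: single_mult_left norm_elt_def)
  next
    case False
    then show ?thesis using a by (simp add: carrier_R single_mult_left)
  qed
qed

section \<open>The upper bound\<close>

lemma gen_class_trivial_action:
  assumes M: "module R M" "trivial_action M"
  shows "M \<in> gen_class R T (Suc 0)"
proof -
  obtain B :: "'u set" where "direct_sum R B (\<lambda>_. T) M" using trivial_action_direct_sum[OF M] .
  then have "direct_sum R B (\<lambda>j. Omega_power R ((\<lambda>_. 0) j) T) M" by (simp add: Omega_power_def)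
  then show ?thesis using stab_retract_refl[OF M(1)]
    unfolding gen_class.simps(2) by (intro CollectI exI conjI)
qed

text \<open>The vectors killed by the augmentation ideal form a sum of copies of the trivial module, and the
  quotient by them is killed by one power less.\<close>

lemma gen_class_of_annihilated:
  assumes "module R M"
    and "\<And>r v. r \<in> ideal_power R aug_ideal (Suc n) \<Longrightarrow> v \<in> carrier M \<Longrightarrow> r \<odot>\<^bsub>M\<^esub> v = \<zero>\<^bsub>M\<^esub>"
  shows "M \<in> gen_class R T (Suc n)"
  using assms
proof (induction n arbitrary: M)
  case 0
  have "a \<odot>\<^bsub>M\<^esub> v = \<zero>\<^bsub>M\<^esub>" if "a \<in> aug_ideal" "v \<in> carrier M" for a v
    using 0(2)[OF _ that(2)] aug_power_Suc[OF that(1), of "\<one>\<^bsub>R\<^esub>" 0] aug_ideal_closed[OF that(1)] by simp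
  then show ?case by (intro gen_class_trivial_action fixed_trivial_action 0(1))
next
  case (Suc n)
  note M = Suc.prems(1)
  interpret M: module R M by (rule M)
  define P where "P = {v \<in> carrier M. \<forall>a\<in>aug_ideal. a \<odot>\<^bsub>M\<^esub> v = \<zero>\<^bsub>M\<^esub>}"
  have P: "submodule P R M"
  proof (rule M.submoduleI)
    fix r v assume r: "r \<in> carrier R" and v: "v \<in> P"
    have "a \<odot>\<^bsub>M\<^esub> (r \<odot>\<^bsub>M\<^esub> v) = r \<odot>\<^bsub>M\<^esub> (a \<odot>\<^bsub>M\<^esub> v)" if "a \<in> aug_ideal" for a
      using r v aug_ideal_closed[OF that] by (simp add: P_def M.smult_assoc1[symmetric] R.m_comm)
    then show "r \<odot>\<^bsub>M\<^esub> v \<in> P" using r v by (simp add: P_def)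
  qed (auto simp: P_def aug_ideal_closed M.smult_r_distr M.smult_r_minus)
  let ?P = "M\<lparr>carrier := P\<rparr>"
  have mP: "module R ?P" by (rule module_restrict[OF M P])
  have "trivial_action ?P"
    by (rule fixed_trivial_action[OF mP]) (simp add: P_def)
  then have PF: "?P \<in> gen_class R T (Suc 0)" by (rule gen_class_trivial_action[OF mP])
  have inj: "inj_on (\<lambda>x. x) (carrier ?P)" by (rule inj_onI)
  obtain Q and \<pi> where se: "short_exact R ?P (\<lambda>x. x) M \<pi> Q"
    using short_exact_quotient[OF mP M mod_hom_inclusion[OF M P] inj] .
  note D = short_exactD[OF se]
  have "Q \<in> gen_class R T (Suc n)"
  proof (rule Suc.IH[OF D(3)])
    fix r w assume r: "r \<in> ideal_power R aug_ideal (Suc n)" and "w \<in> carrier Q"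
    then have "w \<in> \<pi> ` carrier M" by (simp only: D(8))
    then obtain v where v: "w = \<pi> v" "v \<in> carrier M" by (rule imageE)
    note rR = aug_power_closed[OF r]
    have "a \<odot>\<^bsub>M\<^esub> (r \<odot>\<^bsub>M\<^esub> v) = \<zero>\<^bsub>M\<^esub>" if "a \<in> aug_ideal" for a
      using Suc.prems(2)[OF aug_power_Suc[OF that r] v(2)] M.smult_assoc1[OF aug_ideal_closed[OF that] rR v(2)]
      by simp
    then have "r \<odot>\<^bsub>M\<^esub> v \<in> carrier ?P" using rR v(2) by (simp add: P_def)
    from D(9)[OF this] show "r \<odot>\<^bsub>Q\<^esub> w = \<zero>\<^bsub>Q\<^esub>"
      unfolding v(1) using mod_hom_smult[OF D(5) rR v(2)] by simp
  qed
  then show ?case by (rule gen_class_extension[OF se PF])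
qed

text \<open>Every module is stably a retract of one killed by the norm element. Split the \<open>k\<close>-linear surjection
  of \<open>M\<close> onto \<open>M / ker N\<close>, where \<open>N\<close> is the norm element; the induced map from the coinduced module is
  injective, because a nonzero kernel would contain a nonzero fixed vector, hence splits off a projective
  summand of \<open>M\<close>. The complement is killed by \<open>N\<close>.\<close>

lemma retract_of_norm_killed:
  fixes M :: "('g \<Rightarrow> 'k, 'u) module"
  assumes nil: "ideal_power R aug_ideal n = {\<zero>\<^bsub>R\<^esub>}" and M: "module R M"
  obtains M' where "stab_retract R M M'" "\<forall>v\<in>carrier M'. norm_elt \<odot>\<^bsub>M'\<^esub> v = \<zero>\<^bsub>M'\<^esub>"
proof -
  interpret M: module R M by (rule M)
  let ?U = "underlying M"
  note uM = module_underlying[OF M]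
  interpret U: module R ?U by (rule uM)
  have Nhom: "(\<lambda>v. norm_elt \<odot>\<^bsub>M\<^esub> v) \<in> mod_hom R ?U ?U"
    using hom_klin[OF mod_hom_scale[OF M norm_elt_closed]] by (simp add: klin_def)
  let ?N = "{x \<in> carrier ?U. norm_elt \<odot>\<^bsub>M\<^esub> x = \<zero>\<^bsub>?U\<^esub>}"
  note subN = submodule_kernel[OF uM uM Nhom]
  have "inj_on (\<lambda>x. x) (carrier (?U\<lparr>carrier := ?N\<rparr>))" by (rule inj_onI)
  from short_exact_quotient[OF module_restrict[OF uM subN] uM mod_hom_inclusion[OF uM subN] this]
  obtain Q and \<pi> where se: "short_exact R (?U\<lparr>carrier := ?N\<rparr>) (\<lambda>x. x) ?U \<pi> Q" .
  note Q = short_exactD(3,5,8)[OF se]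
  have "?N = {y \<in> carrier ?U. \<pi> y = \<zero>\<^bsub>Q\<^esub>}" using short_exactD(7)[OF se] by simp
  then have ker': "\<pi> x = \<zero>\<^bsub>Q\<^esub> \<longleftrightarrow> norm_elt \<odot>\<^bsub>M\<^esub> x = \<zero>\<^bsub>M\<^esub>" if "x \<in> carrier M" for x
    using that by (simp add: set_eq_iff) metis
  interpret Q: module R Q by (rule Q(1))
  have \<pi>k: "\<pi> \<in> klin M Q"
  proof (rule klinI)
    show "\<pi> v \<in> carrier Q" if "v \<in> carrier M" for v using mod_hom_closed[OF Q(2)] that by simp
    show "\<pi> (v \<oplus>\<^bsub>M\<^esub> w) = \<pi> v \<oplus>\<^bsub>Q\<^esub> \<pi> w" if "v \<in> carrier M" "w \<in> carrier M" for v w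
      using mod_hom_plus[OF Q(2)] that by simp
    show "\<pi> (single c \<one> \<odot>\<^bsub>M\<^esub> v) = single c \<one> \<odot>\<^bsub>Q\<^esub> \<pi> v" if "v \<in> carrier M" for c v
      using mod_hom_smult[OF Q(2) single_closed[OF one_closed, of c]] that by simp
  qed
  have \<pi>s: "\<pi> ` carrier M = carrier Q" using Q(3) by simp
  obtain s where s: "s \<in> klin Q M" "\<forall>q\<in>carrier Q. \<pi> (s q) = q"
    using klin_section[OF M Q(1) \<pi>k \<pi>s] .
  let ?C = "coind Q" and ?\<theta> = "from_coind M s"
  note mC = module_coind[OF Q(1)]
  interpret C: module R ?C by (rule mC)
  have \<theta>: "?\<theta> \<in> mod_hom R ?C M" by (rule from_coind_hom[OF M Q(1) s(1)])
  have inj: "inj_on ?\<theta> (carrier ?C)"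
  proof (rule mod_hom_inj_onI[OF mC M \<theta>])
    fix w assume w: "w \<in> carrier ?C" and \<theta>w: "?\<theta> w = \<zero>\<^bsub>M\<^esub>"
    show "w = \<zero>\<^bsub>?C\<^esub>"
    proof (rule ccontr)
      assume "w \<noteq> \<zero>\<^bsub>?C\<^esub>"
      then obtain r where r: "r \<in> carrier R" "r \<odot>\<^bsub>?C\<^esub> w \<noteq> \<zero>\<^bsub>?C\<^esub>"
        "\<forall>a\<in>aug_ideal. a \<odot>\<^bsub>?C\<^esub> (r \<odot>\<^bsub>?C\<^esub> w) = \<zero>\<^bsub>?C\<^esub>" using socle_multiple[OF nil mC w] by blast
      define u where "u = r \<odot>\<^bsub>?C\<^esub> w"
      have u: "u \<in> carrier ?C" unfolding u_def by (rule C.smult_closed[OF r(1) w])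
      have fixed: "\<forall>a\<in>aug_ideal. a \<odot>\<^bsub>?C\<^esub> u = \<zero>\<^bsub>?C\<^esub>" using r(3) unfolding u_def .
      \<comment> \<open>Fixed vectors of the coinduced module are constant functions, and \<open>\<theta>\<close> maps the function with constant value \<open>c\<close> to \<open>N (s c)\<close>.\<close>
      have const: "decode u g = decode u \<one>" if g: "g \<in> carrier A" for g
      proof -
        have "single 1 g \<odot>\<^bsub>?C\<^esub> u = u"
          using fixed_smult[OF mC u fixed single_closed[OF g, of 1]] C.smult_one[OF u] g by (simp add: one_R)
        then have "decode u \<one> = decode (single 1 g \<odot>\<^bsub>?C\<^esub> u) \<one>" by simp
        also have "\<dots> = decode u g"
          using decode_single[OF Q(1) u g one_closed, of 1] Q.smult_one[OF coind_decode_closed[OF u g]] g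
          by (simp add: one_R)
        finally show ?thesis by (rule sym)
      qed
      note c = coind_decode_closed[OF u one_closed]
      note sc = klin_closed[OF s(1) c]
      have "\<zero>\<^bsub>M\<^esub> = ?\<theta> u"
        unfolding u_def mod_hom_smult[OF \<theta> r(1) w] \<theta>w using r(1) by simp
      also have "\<dots> = finsum M (\<lambda>y. single 1 (inv y) \<odot>\<^bsub>M\<^esub> s (decode u \<one>)) (carrier A)"
        unfolding from_coind_def
      proof (rule M.M.finsum_cong')
        fix y assume y: "y \<in> carrier A"
        show "single 1 (inv y) \<odot>\<^bsub>M\<^esub> s (decode u y) = single 1 (inv y) \<odot>\<^bsub>M\<^esub> s (decode u \<one>)"
          by (simp only: const[OF y])
      qed (simp_all add: sc)
      also have "\<dots> = norm_elt \<odot>\<^bsub>M\<^esub> s (decode u \<one>)" by (rule norm_smult[OF M sc, symmetric])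
      finally have u1: "decode u \<one> = \<zero>\<^bsub>Q\<^esub>" using ker'[OF sc] s(2) c by simp
      have "u = \<zero>\<^bsub>?C\<^esub>"
        by (rule coind_eqI[OF u C.M.zero_closed]) (simp add: decode_zero[OF Q(1)] trans[OF const u1])
      then show False using r(2) unfolding u_def by simp
    qed
  qed
  obtain \<rho> where \<rho>: "\<rho> \<in> mod_hom R M ?C" "\<forall>w\<in>carrier ?C. \<rho> (?\<theta> w) = w"
    using projective_extend[OF projective_coind[OF Q(1)] mC M \<theta> inj mod_hom_ident(2)] by (elim bexE)
  let ?K = "{x \<in> carrier M. \<rho> x = \<zero>\<^bsub>?C\<^esub>}"
  let ?M' = "M\<lparr>carrier := ?K\<rparr>"
  have K: "submodule ?K R M" by (rule submodule_kernel[OF M mC \<rho>(1)])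
  have mM': "module R ?M'" by (rule module_restrict[OF M K])
  \<comment> \<open>\<open>N v = N s(\<pi> v)\<close> lies in the image of \<open>\<theta>\<close>, which meets the kernel of \<open>\<rho>\<close> trivially.\<close>
  have killed: "norm_elt \<odot>\<^bsub>M\<^esub> v = \<zero>\<^bsub>M\<^esub>" if v: "v \<in> carrier M" "\<rho> v = \<zero>\<^bsub>?C\<^esub>" for v
  proof -
    have qv: "\<pi> v \<in> carrier Q" by (rule klin_closed[OF \<pi>k v(1)])
    have sv: "s (\<pi> v) \<in> carrier M" by (rule klin_closed[OF s(1) qv])
    have ev: "at_one Q (\<pi> v) \<in> carrier ?C" by (rule klin_closed[OF at_one_klin[OF Q(1)] qv])
    have "\<pi> (s (\<pi> v)) = \<pi> v" using s(2) qv by simp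
    then have "\<pi> (v \<ominus>\<^bsub>?U\<^esub> s (\<pi> v)) = \<zero>\<^bsub>Q\<^esub>"
      using mod_hom_eq_iff_minus[OF uM Q(1,2), of v "s (\<pi> v)"] v(1) sv by simp
    then have "norm_elt \<odot>\<^bsub>M\<^esub> (v \<ominus>\<^bsub>?U\<^esub> s (\<pi> v)) = \<zero>\<^bsub>?U\<^esub>"
      using ker'[of "v \<ominus>\<^bsub>?U\<^esub> s (\<pi> v)"] U.M.minus_closed[of v "s (\<pi> v)"] v(1) sv by simp
    then have "norm_elt \<odot>\<^bsub>M\<^esub> v = norm_elt \<odot>\<^bsub>M\<^esub> s (\<pi> v)"
      using mod_hom_eq_iff_minus[OF uM uM Nhom, of v "s (\<pi> v)"] v(1) sv by simp
    also have "\<dots> = norm_elt \<odot>\<^bsub>M\<^esub> ?\<theta> (at_one Q (\<pi> v))"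
      by (simp only: from_coind_at_one[OF M Q(1) s(1) qv])
    also have "\<dots> = ?\<theta> (norm_elt \<odot>\<^bsub>?C\<^esub> at_one Q (\<pi> v))"
      by (rule mod_hom_smult[OF \<theta> norm_elt_closed ev, symmetric])
    finally have eq: "norm_elt \<odot>\<^bsub>M\<^esub> v = ?\<theta> (norm_elt \<odot>\<^bsub>?C\<^esub> at_one Q (\<pi> v))" .
    have "norm_elt \<odot>\<^bsub>?C\<^esub> at_one Q (\<pi> v) = \<rho> (norm_elt \<odot>\<^bsub>M\<^esub> v)"
      unfolding eq using \<rho>(2) C.smult_closed[OF norm_elt_closed ev] by simp
    also have "\<dots> = \<zero>\<^bsub>?C\<^esub>"
      using v norm_elt_closed by (simp add: mod_hom_smult[OF \<rho>(1)])
    finally show ?thesis unfolding eq by (simp add: mod_hom_zero[OF mC M \<theta>])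
  qed
  note \<theta>\<rho> = mod_hom_comp'[OF \<rho>(1) \<theta>]
  let ?s = "\<lambda>x. x \<ominus>\<^bsub>M\<^esub> ?\<theta> (\<rho> x)"
  have shom: "?s \<in> mod_hom R M M" by (rule mod_hom_diff_map[OF M mod_hom_ident(2) \<theta>\<rho>])
  have "\<rho> (?s x) = \<zero>\<^bsub>?C\<^esub>" if x: "x \<in> carrier M" for x
    using mod_hom_minus[OF M mC \<rho>(1) x mod_hom_closed[OF \<theta>\<rho> x]] \<rho>(2) mod_hom_closed[OF \<rho>(1) x]
    by (simp add: C.M.minus_eq_zero_iff)
  then have shom': "?s \<in> mod_hom R M ?M'"
    using mod_hom_closed[OF shom] by (intro mod_hom_into_restrict[OF shom]) auto
  have id: "x \<ominus>\<^bsub>M\<^esub> ((\<lambda>x. x) \<circ> ?s) x = ?\<theta> (\<rho> x)" if x: "x \<in> carrier M" for x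
    using x mod_hom_closed[OF \<theta>\<rho> x] by (simp add: a_minus_def M.M.minus_add M.M.r_neg2)
  have "stab_eq R M M id ((\<lambda>x. x) \<circ> ?s)"
    unfolding stab_eq_def
    by (rule exI[of _ ?C], rule conjI[OF projective_coind[OF Q(1)]], rule bexI[OF _ \<rho>(1)], rule bexI[OF _ \<theta>])
      (simp add: id[simplified])
  then have "stab_eq R M M ((\<lambda>x. x) \<circ> ?s) id"
    by (rule stab_eq_sym[OF M mod_hom_ident(1) mod_hom_comp[OF shom' mod_hom_inclusion[OF M K]]])
  then have "stab_retract R M ?M'"
    unfolding stab_retract_def
    by (intro conjI M mM' bexI[OF _ shom'] bexI[OF _ mod_hom_inclusion[OF M K]])
  then show thesis by (rule that) (simp add: killed)
qed

lemma gen_class_all: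
  fixes M :: "('g \<Rightarrow> 'k, 'u) module"
  assumes nil: "ideal_power R aug_ideal (Suc (Suc n)) = {\<zero>\<^bsub>R\<^esub>}" and M: "module R M"
  shows "M \<in> gen_class R T (Suc n)"
proof -
  obtain M' where ret: "stab_retract R M M'" and N: "\<forall>v\<in>carrier M'. norm_elt \<odot>\<^bsub>M'\<^esub> v = \<zero>\<^bsub>M'\<^esub>"
    using retract_of_norm_killed[OF nil M] .
  have M': "module R M'" using ret unfolding stab_retract_def by simp
  interpret M': module R M' by (rule M')
  have "M' \<in> gen_class R T (Suc n)"
  proof (rule gen_class_of_annihilated[OF M'])
    fix r v assume r: "r \<in> ideal_power R aug_ideal (Suc n)" and v: "v \<in> carrier M'"
    have "b \<otimes>\<^bsub>R\<^esub> r = \<zero>\<^bsub>R\<^esub>" if "b \<in> aug_ideal" for b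
      using aug_power_Suc[OF that r] unfolding nil by simp
    from socle_of_R[OF aug_power_closed[OF r] this]
    have "r \<odot>\<^bsub>M'\<^esub> v = single (r \<one>) \<one> \<odot>\<^bsub>M'\<^esub> (norm_elt \<odot>\<^bsub>M'\<^esub> v)"
      using M'.smult_assoc1[OF single_closed[OF one_closed, of "r \<one>"] norm_elt_closed v] by simp
    then show "r \<odot>\<^bsub>M'\<^esub> v = \<zero>\<^bsub>M'\<^esub>" using N v by simp
  qed
  then show ?thesis by (rule gen_class_retract[OF _ ret])
qed

lemma generating_number_le:
  assumes nil: "ideal_power R aug_ideal (Suc (Suc n)) = {\<zero>\<^bsub>R\<^esub>}"
  shows "generating_number R T \<le> enat (Suc n)"
  unfolding generating_number_def
proof (rule SUP_least)
  fix M assume "M \<in> Thick R T"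
  from gen_class_all[OF nil Thick_module[OF this module_T]]
  show "generating_length R T M \<le> enat (Suc n)"
    unfolding generating_length_def by (intro Inf_lower) blast
qed

section \<open>Finite-dimensional modules lie in the thick subcategory of the trivial module\<close>

text \<open>Spanned over \<open>k\<close> by an indexed family; a family may repeat vectors, and so its images remain families
  over the same index set.\<close>

definition kspanned :: "('g \<Rightarrow> 'k, 'u) module \<Rightarrow> 'i set \<Rightarrow> ('i \<Rightarrow> 'u) \<Rightarrow> bool" where
  "kspanned M I v \<longleftrightarrow> finite I \<and> v \<in> I \<rightarrow> carrier M \<and>
     (\<forall>x\<in>carrier M. \<exists>c. x = finsum M (\<lambda>i. single (c i) \<one> \<odot>\<^bsub>M\<^esub> v i) I)"

lemma kspanned_image:
  assumes E: "module R E" and M: "module R M" and f: "f \<in> mod_hom R E M" "f ` carrier E = carrier M"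
    and sp: "kspanned E I v"
  shows "kspanned M I (\<lambda>i. f (v i))"
proof -
  interpret E: module R E by (rule E)
  have v: "v i \<in> carrier E" if "i \<in> I" for i using sp that by (auto simp: kspanned_def)
  have fin: "finite I" using sp by (simp add: kspanned_def)
  have "\<exists>c. x = finsum M (\<lambda>i. single (c i) \<one> \<odot>\<^bsub>M\<^esub> f (v i)) I" if "x \<in> carrier M" for x
  proof -
    have "x \<in> f ` carrier E" unfolding f(2) by (rule that)
    then obtain e where e: "x = f e" "e \<in> carrier E" by (rule imageE)
    obtain c where c: "e = finsum E (\<lambda>i. single (c i) \<one> \<odot>\<^bsub>E\<^esub> v i) I"
      using sp e(2) unfolding kspanned_def by blast
    have "x = finsum M (\<lambda>i. f (single (c i) \<one> \<odot>\<^bsub>E\<^esub> v i)) I"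
      unfolding e(1) c by (rule mod_hom_finsum[OF E M f(1) fin]) (simp add: v)
    also have "\<dots> = finsum M (\<lambda>i. single (c i) \<one> \<odot>\<^bsub>M\<^esub> f (v i)) I"
    proof (rule abelian_monoid.finsum_cong'[OF abelian_group.axioms(1)[OF module.axioms(2)[OF M]] refl])
      show "(\<lambda>i. single (c i) \<one> \<odot>\<^bsub>M\<^esub> f (v i)) \<in> I \<rightarrow> carrier M"
        using mod_hom_closed[OF f(1) v] module.smult_closed[OF M] by simp
      show "f (single (c i) \<one> \<odot>\<^bsub>E\<^esub> v i) = single (c i) \<one> \<odot>\<^bsub>M\<^esub> f (v i)" if "i \<in> I" for i
        by (rule mod_hom_smult[OF f(1) single_closed[OF one_closed] v[OF that]])
    qed
    finally show ?thesis by blast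
  qed
  then show ?thesis unfolding kspanned_def using fin mod_hom_closed[OF f(1) v] by simp
qed

text \<open>Induction on the size of a spanning family: a nonzero module contains a copy of \<open>k\<close>, and one
  member of the family becomes redundant modulo it.\<close>

lemma thick_kspanned:
  assumes nil: "ideal_power R aug_ideal n = {\<zero>\<^bsub>R\<^esub>}"
    and C: "thick_subcategory R C" and TC: "T \<in> C"
  shows "module R M \<Longrightarrow> kspanned M I v \<Longrightarrow> M \<in> C"
proof (induction "card I" arbitrary: M I v rule: less_induct)
  case less
  note M = less.prems(1)
  interpret M: module R M by (rule M)
  interpret T: module R T by (rule module_T)
  have fin: "finite I" and v: "\<And>i. i \<in> I \<Longrightarrow> v i \<in> carrier M"
    using less.prems(2) by (auto simp: kspanned_def)
  show ?case
  proof (cases "carrier M = {\<zero>\<^bsub>M\<^esub>}")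
    case True
    then show ?thesis by (intro thick_zero_object[OF C] zero_object_trivial_carrier[OF M])
  next
    case False
    then obtain w0 where w0: "w0 \<in> carrier M" "w0 \<noteq> \<zero>\<^bsub>M\<^esub>" using M.M.zero_closed by blast
    obtain r where r: "r \<in> carrier R" "r \<odot>\<^bsub>M\<^esub> w0 \<noteq> \<zero>\<^bsub>M\<^esub>" "\<forall>a\<in>aug_ideal. a \<odot>\<^bsub>M\<^esub> (r \<odot>\<^bsub>M\<^esub> w0) = \<zero>\<^bsub>M\<^esub>"
      using socle_multiple[OF nil M w0] .
    define w where "w = r \<odot>\<^bsub>M\<^esub> w0"
    have w: "w \<in> carrier M" "w \<noteq> \<zero>\<^bsub>M\<^esub>" "\<forall>a\<in>aug_ideal. a \<odot>\<^bsub>M\<^esub> w = \<zero>\<^bsub>M\<^esub>"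
      using r M.smult_closed[OF r(1) w0(1)] unfolding w_def by simp_all
    let ?\<kappa> = "\<lambda>t. single (coord_T t) \<one> \<odot>\<^bsub>M\<^esub> w"
    have \<kappa>: "?\<kappa> \<in> mod_hom R T M" by (rule hom_from_T[OF M w(1) fixed_smult[OF M w(1,3)]])
    have inj: "inj_on ?\<kappa> (carrier T)"
    proof (rule mod_hom_inj_onI[OF module_T M \<kappa>])
      fix t assume t: "t \<in> carrier T" and z: "single (coord_T t) \<one> \<odot>\<^bsub>M\<^esub> w = \<zero>\<^bsub>M\<^esub>"
      have "coord_T t = 0"
      proof (rule ccontr)
        assume c: "coord_T t \<noteq> 0"
        have "single (inverse (coord_T t)) \<one> \<odot>\<^bsub>M\<^esub> (single (coord_T t) \<one> \<odot>\<^bsub>M\<^esub> w) = w"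
          using c M.smult_one[OF w(1)] w(1) by (simp add: M.smult_assoc1[symmetric] single_mult one_R)
        then show False unfolding z using w(2) by simp
      qed
      then show "t = \<zero>\<^bsub>T\<^esub>" using unit_coord_T[OF t] unit_T_zero by simp
    qed
    obtain Q and \<pi> where se: "short_exact R T ?\<kappa> M \<pi> Q"
      using short_exact_quotient[OF module_T M \<kappa> inj] .
    note D = short_exactD[OF se]
    interpret Q: module R Q by (rule D(3))
    have \<pi>w: "\<pi> w = \<zero>\<^bsub>Q\<^esub>" using D(9)[OF unit_T_closed, of 1] M.smult_one[OF w(1)] by (simp add: one_R)
    obtain c where c: "w = finsum M (\<lambda>i. single (c i) \<one> \<odot>\<^bsub>M\<^esub> v i) I"
      using less.prems(2) w(1) unfolding kspanned_def by blast
    have "\<exists>j\<in>I. c j \<noteq> 0"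
    proof (rule ccontr)
      assume "\<not> ?thesis"
      then have "w = \<zero>\<^bsub>M\<^esub>" unfolding c
        by (intro M.M.add.finprod_one_eqI) (simp add: single_zero v)
      then show False using w(2) by contradiction
    qed
    then obtain j where j: "j \<in> I" "c j \<noteq> 0" by blast
    have "kspanned Q (I - {j}) (\<lambda>i. \<pi> (v i))"
      unfolding kspanned_def
    proof (intro conjI ballI)
      show "finite (I - {j})" using fin by simp
      show "(\<lambda>i. \<pi> (v i)) \<in> I - {j} \<rightarrow> carrier Q" using mod_hom_closed[OF D(5) v] by simp
      fix q assume "q \<in> carrier Q"
      then have "q \<in> \<pi> ` carrier M" by (simp only: D(8))
      then obtain x where x: "q = \<pi> x" "x \<in> carrier M" by (rule imageE)
      obtain d where d: "x = finsum M (\<lambda>i. single (d i) \<one> \<odot>\<^bsub>M\<^esub> v i) I"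
        using less.prems(2) x(2) unfolding kspanned_def by blast
      \<comment> \<open>Subtracting \<open>e w\<close> from \<open>x\<close> removes the \<open>j\<close>-th coefficient and does not change the image in \<open>Q\<close>.\<close>
      define e where "e = d j / c j"
      define f where "f i = d i - e * c i" for i
      have fj: "f j = 0" using j(2) by (simp add: f_def e_def)
      let ?s = "finsum M (\<lambda>i. single (f i) \<one> \<odot>\<^bsub>M\<^esub> v i) I"
      have sM: "?s \<in> carrier M" by (rule M.M.finsum_closed) (simp add: v)
      have ew: "single e \<one> \<odot>\<^bsub>M\<^esub> w = finsum M (\<lambda>i. single (e * c i) \<one> \<odot>\<^bsub>M\<^esub> v i) I"
      proof -
        have "single e \<one> \<odot>\<^bsub>M\<^esub> w = finsum M (\<lambda>i. single e \<one> \<odot>\<^bsub>M\<^esub> (single (c i) \<one> \<odot>\<^bsub>M\<^esub> v i)) I"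
          unfolding c by (rule M.finsum_smult_ldistr[OF fin single_closed[OF one_closed]]) (simp add: v)
        also have "\<dots> = finsum M (\<lambda>i. single (e * c i) \<one> \<odot>\<^bsub>M\<^esub> v i) I"
          by (rule M.M.finsum_cong') (simp_all add: v M.smult_assoc1[symmetric] single_mult)
        finally show ?thesis .
      qed
      have "?s \<oplus>\<^bsub>M\<^esub> single e \<one> \<odot>\<^bsub>M\<^esub> w
          = finsum M (\<lambda>i. single (f i) \<one> \<odot>\<^bsub>M\<^esub> v i \<oplus>\<^bsub>M\<^esub> single (e * c i) \<one> \<odot>\<^bsub>M\<^esub> v i) I"
        unfolding ew by (rule M.M.finsum_addf[symmetric]) (simp_all add: v)
      also have "\<dots> = x" unfolding d
        by (rule M.M.finsum_cong') (simp_all add: v M.smult_l_distr[symmetric] single_add f_def)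
      finally have "\<pi> x = \<pi> (?s \<oplus>\<^bsub>M\<^esub> single e \<one> \<odot>\<^bsub>M\<^esub> w)" by simp
      also have "\<dots> = \<pi> ?s"
        using sM w(1) mod_hom_closed[OF D(5) sM]
        by (simp add: mod_hom_plus[OF D(5)] mod_hom_smult[OF D(5)] \<pi>w)
      also have "\<dots> = finsum Q (\<lambda>i. \<pi> (single (f i) \<one> \<odot>\<^bsub>M\<^esub> v i)) I"
        by (rule mod_hom_finsum[OF M D(3,5) fin]) (simp add: v)
      also have "\<dots> = finsum Q (\<lambda>i. single (f i) \<one> \<odot>\<^bsub>Q\<^esub> \<pi> (v i)) I"
        by (rule Q.M.finsum_cong')
          (simp_all add: v mod_hom_smult[OF D(5)] mod_hom_closed[OF D(5) v])
      also have "\<dots> = finsum Q (\<lambda>i. single (f i) \<one> \<odot>\<^bsub>Q\<^esub> \<pi> (v i)) (insert j (I - {j}))"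
        using j(1) by (simp add: insert_absorb)
      also have "\<dots> = single (f j) \<one> \<odot>\<^bsub>Q\<^esub> \<pi> (v j) \<oplus>\<^bsub>Q\<^esub> finsum Q (\<lambda>i. single (f i) \<one> \<odot>\<^bsub>Q\<^esub> \<pi> (v i)) (I - {j})"
        using fin j(1) mod_hom_closed[OF D(5) v] by (intro Q.M.finsum_insert) simp_all
      also have "\<dots> = finsum Q (\<lambda>i. single (f i) \<one> \<odot>\<^bsub>Q\<^esub> \<pi> (v i)) (I - {j})"
        using mod_hom_closed[OF D(5) v[OF j(1)]] mod_hom_closed[OF D(5) v]
        by (simp add: fj single_zero Pi_def)
      finally show "\<exists>c. q = finsum Q (\<lambda>i. single (c i) \<one> \<odot>\<^bsub>Q\<^esub> \<pi> (v i)) (I - {j})"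
        unfolding x(1) by blast
    qed
    moreover have "card (I - {j}) < card I" using fin j(1) by (rule card_Diff1_less)
    ultimately have "Q \<in> C" using less.hyps[OF _ D(3)] by blast
    then show ?thesis by (rule thick_extension[OF C se TC])
  qed
qed

lemma kspanned_coind_T:
  "kspanned (coind T) (carrier A) (\<lambda>y. single 1 (inv y) \<odot>\<^bsub>coind T\<^esub> at_one T (unit_T 1))"
proof -
  interpret E: module R "coind T" by (rule module_coind[OF module_T])
  have e: "at_one T (unit_T 1) \<in> carrier (coind T)"
    by (rule klin_closed[OF at_one_klin[OF module_T] unit_T_closed])
  have sum: "w = finsum (coind T) (\<lambda>y. single (coord_T (decode w y)) \<one> \<odot>\<^bsub>coind T\<^esub>
      (single 1 (inv y) \<odot>\<^bsub>coind T\<^esub> at_one T (unit_T 1))) (carrier A)" if w: "w \<in> carrier (coind T)" for w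
  proof -
    have "w = from_coind (coind T) (at_one T) w" by (rule coind_sum[OF module_T w, symmetric])
    also have "\<dots> = finsum (coind T) (\<lambda>y. single (coord_T (decode w y)) \<one> \<odot>\<^bsub>coind T\<^esub>
      (single 1 (inv y) \<odot>\<^bsub>coind T\<^esub> at_one T (unit_T 1))) (carrier A)"
      unfolding from_coind_def
    proof (rule E.M.finsum_cong')
      fix y assume y: "y \<in> carrier A"
      let ?c = "single (coord_T (decode w y)) \<one>"
      have "decode w y = ?c \<odot>\<^bsub>T\<^esub> unit_T 1"
        by (simp add: unit_T_smult unit_coord_T[OF coind_decode_closed[OF w y]])
      then have "at_one T (decode w y) = at_one T (?c \<odot>\<^bsub>T\<^esub> unit_T 1)" by (rule arg_cong)
      also have "\<dots> = ?c \<odot>\<^bsub>coind T\<^esub> at_one T (unit_T 1)"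
        by (rule klin_scale[OF at_one_klin[OF module_T] unit_T_closed])
      finally show "single 1 (inv y) \<odot>\<^bsub>coind T\<^esub> at_one T (decode w y)
          = ?c \<odot>\<^bsub>coind T\<^esub> (single 1 (inv y) \<odot>\<^bsub>coind T\<^esub> at_one T (unit_T 1))"
        using y e by (simp add: E.smult_assoc1[symmetric] single_mult)
    qed (simp_all add: e)
    finally show ?thesis .
  qed
  show ?thesis unfolding kspanned_def
  proof (intro conjI ballI finite_A)
    fix w assume w: "w \<in> carrier (coind T)"
    show "\<exists>c. w = finsum (coind T) (\<lambda>y. single (c y) \<one> \<odot>\<^bsub>coind T\<^esub>
      (single 1 (inv y) \<odot>\<^bsub>coind T\<^esub> at_one T (unit_T 1))) (carrier A)"
      by (rule exI[of _ "\<lambda>y. coord_T (decode w y)"]) (rule sum[OF w])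
  qed (simp add: e)
qed

section \<open>The lower bound\<close>

definition prod_word :: "('g \<Rightarrow> 'k) list \<Rightarrow> ('g \<Rightarrow> 'k)" where
  "prod_word rs = foldr (\<lambda>r a. r \<otimes>\<^bsub>R\<^esub> a) rs \<one>\<^bsub>R\<^esub>"

lemma prod_word_simps [simp]:
  "prod_word [] = \<one>\<^bsub>R\<^esub>" "prod_word (r # rs) = r \<otimes>\<^bsub>R\<^esub> prod_word rs"
  by (simp_all add: prod_word_def)

lemma prod_word_closed: "set rs \<subseteq> carrier R \<Longrightarrow> prod_word rs \<in> carrier R"
  by (induction rs) simp_all

lemma prod_word_append:
  "set rs \<subseteq> carrier R \<Longrightarrow> set ss \<subseteq> carrier R \<Longrightarrow> prod_word (rs @ ss) = prod_word rs \<otimes>\<^bsub>R\<^esub> prod_word ss"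
  by (induction rs) (simp_all add: prod_word_closed R.m_assoc)

lemma prod_word_replicate: "r \<in> carrier R \<Longrightarrow> prod_word (replicate n r) = r [^]\<^bsub>R\<^esub> n"
  by (induction n) (simp_all add: R.m_comm)

lemma scale_word_eq:
  assumes M: "module R M" and "set rs \<subseteq> carrier R" "v \<in> carrier M"
  shows "scale_word M rs v = prod_word rs \<odot>\<^bsub>M\<^esub> v"
  using assms(2,3)
proof (induction rs arbitrary: v)
  case Nil
  then show ?case using module.smult_one[OF M] by simp
next
  case (Cons r rs)
  interpret M: module R M by (rule M)
  have "scale_word M (r # rs) v = prod_word rs \<odot>\<^bsub>M\<^esub> (r \<odot>\<^bsub>M\<^esub> v)"
    using Cons by simp
  then show ?case
    using Cons.prems prod_word_closed[of rs] by (simp add: M.smult_assoc1[symmetric] R.m_comm)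
qed

text \<open>The module \<open>coind T\<close> is free on \<open>at_one T (unit_T 1)\<close>; the coefficient of \<open>r\<close> at \<open>x\<close> is the value of the
  multiple at the inverse of \<open>x\<close>.\<close>

lemma coind_T_faithful:
  assumes r: "r \<in> carrier R" and z: "r \<odot>\<^bsub>coind T\<^esub> at_one T (unit_T 1) = \<zero>\<^bsub>coind T\<^esub>"
  shows "r = \<zero>\<^bsub>R\<^esub>"
proof
  fix x
  interpret E: module R "coind T" by (rule module_coind[OF module_T])
  interpret T: module R T by (rule module_T)
  let ?e = "at_one T (unit_T 1)"
  have e: "?e \<in> carrier (coind T)"
    by (rule klin_closed[OF at_one_klin[OF module_T] unit_T_closed])
  show "r x = \<zero>\<^bsub>R\<^esub> x"
  proof (cases "x \<in> carrier A")
    case x: True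
    then have ix: "inv x \<in> carrier A" by simp
    have t: "(\<lambda>y. single (r y) y \<odot>\<^bsub>coind T\<^esub> ?e) \<in> carrier A \<rightarrow> carrier (coind T)" by (simp add: e)
    have "\<zero>\<^bsub>T\<^esub> = decode (finsum (coind T) (\<lambda>y. single (r y) y \<odot>\<^bsub>coind T\<^esub> ?e) (carrier A)) (inv x)"
      unfolding module_sum_of_singles[OF module_coind[OF module_T] r e, symmetric] z
      by (rule decode_zero[OF module_T ix, symmetric])
    also have "\<dots> = finsum T (\<lambda>y. decode (single (r y) y \<odot>\<^bsub>coind T\<^esub> ?e) (inv x)) (carrier A)"
      by (rule additive_map_finsum[where f = "\<lambda>u. decode u (inv x)", OF E.M.abelian_monoid_axioms
            T.M.abelian_monoid_axioms coind_decode_closed[OF _ ix] decode_zero[OF module_T ix]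
            decode_plus[OF module_T _ _ ix] finite_A t])
    also have "\<dots> = finsum T (\<lambda>y. if x = y then unit_T (r y) else \<zero>\<^bsub>T\<^esub>) (carrier A)"
    proof (rule T.M.finsum_cong')
      fix y assume y: "y \<in> carrier A"
      have "inv x \<otimes> y = \<one> \<longleftrightarrow> x = y" using x y by (metis inv_equality inv_inv inv_closed l_inv)
      then show "decode (single (r y) y \<odot>\<^bsub>coind T\<^esub> ?e) (inv x) = (if x = y then unit_T (r y) else \<zero>\<^bsub>T\<^esub>)"
        using y ix by (simp add: decode_single[OF module_T e] decode_at_one[OF module_T] unit_T_smult)
    qed simp_all
    also have "\<dots> = unit_T (r x)"
      by (rule T.M.finsum_singleton[OF x finite_A]) simp
    finally have "coord_T (unit_T (r x)) = coord_T (unit_T 0)" by (simp only: unit_T_zero)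
    then show ?thesis by (simp add: zero_R)
  next
    case False
    then show ?thesis using r by (simp add: carrier_R zero_R)
  qed
qed

text \<open>On the ideal \<open>y E\<close> of the free module \<open>E\<close> of rank one, multiplication by \<open>w\<close> is a composite of
  ghosts. If it were stably zero it would extend to a map \<open>E \<rightarrow> y E\<close>, because projectives are injective,
  and \<open>w y\<close> would be a multiple of \<open>y\<^sup>2 = 0\<close>.\<close>

lemma ghost_number_ge:
  assumes nil: "ideal_power R aug_ideal n = {\<zero>\<^bsub>R\<^esub>}"
    and y: "y \<in> carrier R" "y \<otimes>\<^bsub>R\<^esub> y = \<zero>\<^bsub>R\<^esub>"
    and rs: "set rs \<subseteq> aug_ideal" "prod_word rs \<otimes>\<^bsub>R\<^esub> y \<noteq> \<zero>\<^bsub>R\<^esub>"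
  shows "enat (Suc (length rs)) \<le> ghost_number R T"
proof -
  let ?E = "coind T" and ?e = "at_one T (unit_T 1)"
  have E: "module R ?E" by (rule module_coind[OF module_T])
  interpret E: module R ?E by (rule E)
  have e: "?e \<in> carrier ?E" by (rule klin_closed[OF at_one_klin[OF module_T] unit_T_closed])
  have rsR: "set rs \<subseteq> carrier R" using rs(1) by (auto simp: aug_ideal_def)
  note wR = prod_word_closed[OF rsR]
  let ?f = "\<lambda>v. y \<odot>\<^bsub>?E\<^esub> v"
  have f: "?f \<in> mod_hom R ?E ?E" by (rule mod_hom_scale[OF E y(1)])
  define M where "M = ?E\<lparr>carrier := ?f ` carrier ?E\<rparr>"
  have sub: "submodule (?f ` carrier ?E) R ?E" by (rule submodule_image[OF E E f])
  have M: "module R M" unfolding M_def by (rule module_restrict[OF E sub])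
  have carM: "carrier M = ?f ` carrier ?E" by (simp add: M_def)
  have incl: "(\<lambda>x. x) \<in> mod_hom R M ?E" unfolding M_def by (rule mod_hom_inclusion[OF E sub])
  have fM: "?f \<in> mod_hom R ?E M" unfolding M_def by (rule mod_hom_into_restrict[OF f order_refl])
  have sp: "kspanned M (carrier A) (\<lambda>z. ?f (single 1 (inv z) \<odot>\<^bsub>?E\<^esub> ?e))"
    by (rule kspanned_image[OF E M fM carM[symmetric] kspanned_coind_T])
  have thick: "M \<in> Thick R T" unfolding Thick_def
    using thick_kspanned[OF nil _ _ M sp] by blast
  have nonzero: "\<not> proj_null R M M (scale_word M rs)"
  proof
    assume "proj_null R M M (scale_word M rs)"
    then obtain P :: "('g \<Rightarrow> 'k, 'u) module" and a b where P: "projective R P" "a \<in> mod_hom R M P"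
      "b \<in> mod_hom R P M" "\<forall>x\<in>carrier M. scale_word M rs x = b (a x)"
      unfolding proj_null_def by (elim exE conjE bexE)
    have inj: "inj_on (\<lambda>x. x) (carrier M)" by (rule inj_onI)
    obtain a' where a': "a' \<in> mod_hom R ?E P" "\<forall>x\<in>carrier M. a' x = a x"
      using projective_extend[OF P(1) M E incl inj P(2)] by (elim bexE)
    note F = mod_hom_comp'[OF a'(1) P(3)]
    have yeM: "y \<odot>\<^bsub>?E\<^esub> ?e \<in> carrier M" unfolding carM by (rule imageI[OF e])
    have "b (a' ?e) \<in> ?f ` carrier ?E" using mod_hom_closed[OF F e] by (simp only: carM)
    then obtain u where u: "b (a' ?e) = y \<odot>\<^bsub>?E\<^esub> u" "u \<in> carrier ?E" by (rule imageE)
    have sm: "r \<odot>\<^bsub>M\<^esub> x = r \<odot>\<^bsub>?E\<^esub> x" for r x by (simp add: M_def)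
    have "(prod_word rs \<otimes>\<^bsub>R\<^esub> y) \<odot>\<^bsub>?E\<^esub> ?e = prod_word rs \<odot>\<^bsub>M\<^esub> (y \<odot>\<^bsub>?E\<^esub> ?e)"
      unfolding sm by (rule E.smult_assoc1[OF wR y(1) e])
    also have "\<dots> = b (a' (y \<odot>\<^bsub>?E\<^esub> ?e))"
      using scale_word_eq[OF M rsR yeM] P(4) a'(2) yeM by simp
    also have "\<dots> = y \<odot>\<^bsub>?E\<^esub> (y \<odot>\<^bsub>?E\<^esub> u)"
      by (simp only: mod_hom_smult[OF F y(1) e] sm u(1))
    also have "\<dots> = \<zero>\<^bsub>?E\<^esub>"
      using u(2) by (simp add: E.smult_assoc1[OF y(1) y(1) u(2), symmetric] y(2))
    finally show False
      using coind_T_faithful[OF R.m_closed[OF wR y(1)]] rs(2) by blast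
  qed
  have "enat (Suc (length rs)) \<le> ghost_length R T M"
  proof (rule ghost_length_ge[OF module_T thick rsR _ nonzero])
    fix r assume "r \<in> set rs"
    then have "r \<in> aug_ideal" using rs(1) by blast
    then show "proj_null R T T (\<lambda>x. r \<odot>\<^bsub>T\<^esub> x)" by (rule proj_null_scale_T)
  qed
  also have "\<dots> \<le> ghost_number R T" unfolding ghost_number_def by (rule SUP_upper[OF thick])
  finally show ?thesis .
qed

end

section \<open>The group algebra of an abelian \<open>p\<close>-group\<close>

lemma mod_add_eq_self:
  fixes x n q :: nat
  assumes eq: "n = (x + n) mod q" and x: "x < q" and n: "n < q"
  shows "x = 0"
proof (cases "x + n < q")
  case True
  then show ?thesis using eq mod_less[OF True] by linarith
next
  case False
  then have "(x + n) mod q = (x + n - q) mod q" by (intro le_mod_geq) simp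
  also have "\<dots> = x + n - q" using x n by (intro mod_less) linarith
  finally show ?thesis using eq x False by linarith
qed

text \<open>Coordinates \<open>co i a\<close> identify \<open>A\<close> with a product of cyclic groups of orders \<open>q i\<close>, for \<open>i < L\<close>;
  the elements \<open>gen i\<close> are the standard generators.\<close>

locale abelian_p_group_algebra = group_algebra_modules A T for A :: "'g monoid" (structure)
    and T :: "('g \<Rightarrow> 'k::field, 'u) module" +
  fixes L :: nat and gen :: "nat \<Rightarrow> 'g" and q :: "nat \<Rightarrow> nat" and co :: "nat \<Rightarrow> 'g \<Rightarrow> nat"
  assumes prime_char: "prime CHAR('k)" and L: "0 < L"
    and q_power: "i < L \<Longrightarrow> \<exists>f\<ge>1. q i = CHAR('k) ^ f"
    and gen_closed: "i < L \<Longrightarrow> gen i \<in> carrier A"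
    and co_less: "i < L \<Longrightarrow> a \<in> carrier A \<Longrightarrow> co i a < q i"
    and co_mult: "i < L \<Longrightarrow> a \<in> carrier A \<Longrightarrow> b \<in> carrier A \<Longrightarrow> co i (a \<otimes> b) = (co i a + co i b) mod q i"
    and co_inj: "a \<in> carrier A \<Longrightarrow> b \<in> carrier A \<Longrightarrow> (\<And>i. i < L \<Longrightarrow> co i a = co i b) \<Longrightarrow> a = b"
    and co_gen: "i < L \<Longrightarrow> j < L \<Longrightarrow> co j (gen i) = (if i = j then 1 else 0)"
begin

lemma q_ge_2: "i < L \<Longrightarrow> 2 \<le> q i"
proof -
  assume "i < L"
  then obtain f where f: "f \<ge> 1" "q i = CHAR('k) ^ f" using q_power by blast
  have "CHAR('k) ^ 1 \<le> CHAR('k) ^ f"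
    using f(1) prime_ge_2_nat[OF prime_char] by (intro power_increasing) simp_all
  then show ?thesis using f(2) prime_ge_2_nat[OF prime_char] by simp
qed

lemma co_one: "i < L \<Longrightarrow> co i \<one> = 0"
proof -
  assume i: "i < L"
  have "co i \<one> = (co i \<one> + co i \<one>) mod q i" using co_mult[OF i one_closed one_closed] by simp
  moreover have "co i \<one> < q i" by (rule co_less[OF i one_closed])
  ultimately show ?thesis by (simp add: mod_if split: if_splits)
qed

lemma co_gen_pow: "i < L \<Longrightarrow> j < L \<Longrightarrow> co j (gen i [^] (n::nat)) = (if i = j then n mod q i else 0)"
proof (induction n)
  case 0
  then show ?case by (simp add: co_one)
next
  case (Suc n)
  then show ?case
    using co_mult[of j "gen i [^] n" "gen i"] gen_closed[of i] by (simp add: co_gen mod_simps)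
qed

lemma gen_pow_q: "i < L \<Longrightarrow> gen i [^] q i = \<one>"
  by (rule co_inj) (simp_all add: gen_closed co_gen_pow co_one)

text \<open>The subgroup generated by the \<open>gen j\<close> with \<open>j < i\<close>, described by coordinates. Statements about \<open>A\<close> are
  proved by ascending from the trivial group at \<open>0\<close> to \<open>A\<close> at \<open>L\<close>.\<close>

definition layer :: "nat \<Rightarrow> 'g set" where
  "layer i = {a \<in> carrier A. \<forall>j. i \<le> j \<longrightarrow> j < L \<longrightarrow> co j a = 0}"

lemma layer_closed: "a \<in> layer i \<Longrightarrow> a \<in> carrier A"
  by (simp add: layer_def)

lemma layer_0: "a \<in> layer 0 \<Longrightarrow> a = \<one>"
  by (rule co_inj) (simp_all add: layer_def co_one)

lemma layer_L: "layer L = carrier A"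
  by (auto simp: layer_def)

lemma layer_Suc_cases:
  assumes i: "i < L" and a: "a \<in> layer (Suc i)"
  obtains h where "h \<in> layer i" "a = h \<otimes> gen i [^] co i a"
proof -
  let ?g = "gen i [^] co i a"
  have aA: "a \<in> carrier A" and g: "?g \<in> carrier A" using layer_closed[OF a] gen_closed[OF i] by simp_all
  define h where "h = a \<otimes> inv ?g"
  have h: "h \<in> carrier A" using aA g by (simp add: h_def)
  have ah: "a = h \<otimes> ?g" using aA g by (simp add: h_def m_assoc)
  have "co j h = 0" if j: "i \<le> j" "j < L" for j
  proof -
    have "co j a = co j (h \<otimes> ?g)" by (rule arg_cong[OF ah])
    also have "\<dots> = (co j h + co j ?g) mod q j" by (rule co_mult[OF j(2) h g])
    finally have *: "co j a = (co j h + (if i = j then co i a mod q i else 0)) mod q j"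
      unfolding co_gen_pow[OF i j(2)] .
    have less: "co j h < q j" by (rule co_less[OF j(2) h])
    show ?thesis
    proof (cases "i = j")
      case True
      have "co j a < q j" by (rule co_less[OF j(2) aA])
      have "(co j h + (if i = j then co i a mod q i else 0)) mod q j = (co j h + co j a) mod q j"
        by (simp add: True mod_simps)
      from trans[OF * this] show ?thesis by (rule mod_add_eq_self) (use less \<open>co j a < q j\<close> in simp_all)
    next
      case False
      then have "co j a = 0" using a j by (simp add: layer_def)
      then show ?thesis using * less False by simp
    qed
  qed
  then have "h \<in> layer i" using h by (simp add: layer_def)
  then show thesis using ah by (rule that)
qed

lemma layer_mult_gen:
  assumes i: "i < L" and h: "h \<in> layer i"
  shows "h \<otimes> gen i [^] (n::nat) \<in> layer (Suc i)"
proof -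
  have g: "gen i [^] n \<in> carrier A" using gen_closed[OF i] by simp
  have "co j (h \<otimes> gen i [^] n) = 0" if "Suc i \<le> j" "j < L" for j
    using co_mult[OF that(2) layer_closed[OF h] g] co_gen_pow[OF i that(2), of n] h that
    by (simp add: layer_def)
  then show ?thesis using layer_closed[OF h] g by (simp add: layer_def)
qed

lemma layer_exponent:
  assumes i: "i < L" and h: "h \<in> layer i" "h' \<in> layer i" and n: "n < q i" "n' < q i"
    and eq: "h \<otimes> gen i [^] n = h' \<otimes> gen i [^] n'"
  shows "n = n'"
proof -
  have g: "gen i [^] k \<in> carrier A" for k :: nat using gen_closed[OF i] by simp
  have "co i (x \<otimes> gen i [^] k) = k" if "x \<in> layer i" "k < q i" for x and k :: nat
    using co_mult[OF i layer_closed[OF that(1)] g, of k] co_gen_pow[OF i i, of k] that i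
    by (simp add: layer_def)
  then show ?thesis using h n eq by metis
qed

definition diff1 :: "'g \<Rightarrow> 'g \<Rightarrow> 'k" where
  "diff1 a = single 1 a \<ominus>\<^bsub>R\<^esub> single 1 \<one>"

abbreviation X :: "nat \<Rightarrow> 'g \<Rightarrow> 'k" where "X i \<equiv> diff1 (gen i)"

lemma diff1_aug: "a \<in> carrier A \<Longrightarrow> diff1 a \<in> aug_ideal"
  by (simp add: diff1_def aug_ideal_def aug_minus)

lemma diff1_closed: "a \<in> carrier A \<Longrightarrow> diff1 a \<in> carrier R"
  by (rule aug_ideal_closed[OF diff1_aug])

lemma X_closed: "i < L \<Longrightarrow> X i \<in> carrier R"
  by (rule diff1_closed[OF gen_closed])

lemma diff1_mult_left:
  assumes g: "g \<in> carrier A" and b: "b \<in> carrier R"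
  shows "diff1 g \<otimes>\<^bsub>R\<^esub> b = (\<lambda>z. if z \<in> carrier A then b (inv g \<otimes> z) - b z else 0)"
proof -
  have "diff1 g \<otimes>\<^bsub>R\<^esub> b = single 1 g \<otimes>\<^bsub>R\<^esub> b \<ominus>\<^bsub>R\<^esub> single 1 \<one> \<otimes>\<^bsub>R\<^esub> b"
    using g b by (simp add: diff1_def a_minus_def R.l_distr R.l_minus)
  also have "\<dots> = (\<lambda>z. (single 1 g \<otimes>\<^bsub>R\<^esub> b) z - (single 1 \<one> \<otimes>\<^bsub>R\<^esub> b) z)"
    using g b by (intro minus_R) simp_all
  finally show ?thesis by (auto simp: single_mult_left[OF g] single_mult_left[OF one_closed])
qed

lemma diff1_mult:
  assumes a: "a \<in> carrier A" and b: "b \<in> carrier A"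
  shows "diff1 (a \<otimes> b) = single 1 a \<otimes>\<^bsub>R\<^esub> diff1 b \<oplus>\<^bsub>R\<^esub> diff1 a"
proof -
  have c: "single 1 a \<in> carrier R" "single 1 b \<in> carrier R" "single 1 \<one> \<in> carrier R"
    "single 1 (a \<otimes> b) \<in> carrier R" using a b by simp_all
  have "single 1 a \<otimes>\<^bsub>R\<^esub> diff1 b = single 1 (a \<otimes> b) \<ominus>\<^bsub>R\<^esub> single 1 a"
    using a b c by (simp add: diff1_def a_minus_def R.r_distr R.r_minus single_mult)
  then show ?thesis using c by (simp add: diff1_def minus_R add_R)
qed

text \<open>The group elements \<open>a\<close> with \<open>a - 1\<close> in an ideal form a subgroup, because
  \<open>a b - 1 = a (b - 1) + (a - 1)\<close>; it is all of \<open>A\<close> as soon as it contains the generators.\<close>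

lemma aug_ideal_least:
  assumes I: "ideal I R" and X: "\<And>i. i < L \<Longrightarrow> X i \<in> I"
  shows "aug_ideal \<subseteq> I"
proof
  interpret I: ideal I R by (rule I)
  have zero: "diff1 \<one> \<in> I"
    using I.zero_closed by (simp add: diff1_def minus_R zero_R)
  have mult: "diff1 (a \<otimes> b) \<in> I" if "a \<in> carrier A" "b \<in> carrier A" "diff1 a \<in> I" "diff1 b \<in> I" for a b
    unfolding diff1_mult[OF that(1,2)]
    using that I.a_closed I.I_l_closed by simp
  have pow: "diff1 (gen i [^] n) \<in> I" if "i < L" for i and n :: nat
    by (induction n) (use that in \<open>simp_all add: zero mult gen_closed X\<close>)
  have lay: "i \<le> L \<Longrightarrow> a \<in> layer i \<Longrightarrow> diff1 a \<in> I" for i a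
  proof (induction i arbitrary: a)
    case 0
    then show ?case using layer_0 zero by simp
  next
    case (Suc i)
    then have i: "i < L" by simp
    obtain h where h: "h \<in> layer i" "a = h \<otimes> gen i [^] co i a" using layer_Suc_cases[OF i Suc.prems(2)] .
    have "diff1 (h \<otimes> gen i [^] co i a) \<in> I"
      using mult[of h "gen i [^] co i a"] layer_closed[OF h(1)] gen_closed[OF i] pow[OF i] Suc.IH[OF _ h(1)] i
      by simp
    then show ?case by (simp only: h(2)[symmetric])
  qed
  fix r assume "r \<in> aug_ideal"
  then have r: "r \<in> carrier R" "(\<Sum>y\<in>carrier A. r y) = 0" by (simp_all add: aug_ideal_def aug_def)
  let ?t = "\<lambda>y. single (r y) \<one> \<otimes>\<^bsub>R\<^esub> diff1 y"
  have tI: "?t y \<in> I" if "y \<in> carrier A" for y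
    using lay[of L y] that layer_L I.I_l_closed by simp
  have sumI: "finsum R ?t S \<in> I" if "finite S" "S \<subseteq> carrier A" for S
    using that
  proof (induction rule: finite_induct)
    case (insert y S)
    have "finsum R ?t (insert y S) = ?t y \<oplus>\<^bsub>R\<^esub> finsum R ?t S"
      using insert by (intro R.finsum_insert) (auto intro!: R.m_closed diff1_closed)
    then show ?case using insert tI I.a_closed by simp
  qed simp
  have tval: "?t y = (\<lambda>x. single (r y) y x - single (r y) \<one> x)" if y: "y \<in> carrier A" for y
  proof -
    have "?t y = single (r y) y \<ominus>\<^bsub>R\<^esub> single (r y) \<one>"
      using y by (simp add: diff1_def a_minus_def R.r_distr R.r_minus single_mult)
    then show ?thesis using y by (simp add: minus_R)
  qed
  have "finsum R ?t (carrier A) = (\<lambda>x. \<Sum>y\<in>carrier A. ?t y x)"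
    by (rule finsum_R[OF finite_A]) (simp add: diff1_closed)
  also have "\<dots> = r"
  proof
    fix x
    have "(\<Sum>y\<in>carrier A. ?t y x) = (\<Sum>y\<in>carrier A. single (r y) y x) - (\<Sum>y\<in>carrier A. single (r y) \<one> x)"
      by (simp add: tval sum_subtractf)
    also have "(\<Sum>y\<in>carrier A. single (r y) \<one> x) = 0"
      using r(2) by (cases "x = \<one>") (simp_all add: single_def)
    also have "(\<Sum>y\<in>carrier A. single (r y) y x) = finsum R (\<lambda>y. single (r y) y) (carrier A) x"
      by (subst finsum_R[OF finite_A]) simp_all
    also have "\<dots> = r x" by (rule fun_cong[OF sum_of_singles[OF r(1), symmetric]])
    finally show "(\<Sum>y\<in>carrier A. ?t y x) = r x" by simp
  qed
  finally show "r \<in> I" using sumI[OF finite_A order_refl] by simp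
qed

text \<open>Compare with the polynomial identity \<open>(t - 1)\<^sup>q = t\<^sup>q - 1\<close>, by evaluating polynomials of degree
  at most \<open>N\<close> at \<open>g\<close>.\<close>

lemma diff1_pow_poly:
  assumes g: "g \<in> carrier A"
  shows "n \<le> N \<Longrightarrow> diff1 g [^]\<^bsub>R\<^esub> n =
    (\<lambda>z. \<Sum>i\<le>N. if g [^] i = z then coeff ([:- 1, 1:] ^ n :: 'k poly) i else 0)"
proof (induction n)
  case 0
  have "(\<Sum>i\<le>N. if g [^] i = z then coeff (1 :: 'k poly) i else 0) = single 1 \<one> z" for z
  proof -
    have "(\<Sum>i\<le>N. if g [^] i = z then coeff (1 :: 'k poly) i else 0)
        = (\<Sum>i\<le>N. if i = 0 then single 1 \<one> z else 0)"
      by (rule sum.cong) (auto simp: single_def)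
    then show ?thesis by simp
  qed
  then show ?case by (simp only: power_0 R.nat_pow_0 one_R)
next
  case (Suc n)
  let ?f = "[:- 1, 1:] ^ n :: 'k poly"
  have deg: "degree ?f \<le> n" using degree_power_le[of "[:- 1, 1:] :: 'k poly" n] by simp
  have coN: "coeff ?f N = 0" using deg Suc.prems by (intro coeff_eq_0) simp
  have co: "coeff ([:- 1, 1:] ^ Suc n :: 'k poly) i = (case i of 0 \<Rightarrow> 0 | Suc j \<Rightarrow> coeff ?f j) - coeff ?f i" for i
    by (simp add: coeff_pCons split: nat.split)
  have IH: "diff1 g [^]\<^bsub>R\<^esub> n = (\<lambda>z. \<Sum>i\<le>N. if g [^] i = z then coeff ?f i else 0)" using Suc by simp
  have cl: "diff1 g [^]\<^bsub>R\<^esub> n \<in> carrier R" using diff1_closed[OF g] by simp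
  have "diff1 g [^]\<^bsub>R\<^esub> Suc n = diff1 g \<otimes>\<^bsub>R\<^esub> (diff1 g [^]\<^bsub>R\<^esub> n)"
    using diff1_closed[OF g] cl by (simp add: R.m_comm)
  also have "\<dots> = (\<lambda>z. \<Sum>i\<le>N. if g [^] i = z then coeff ([:- 1, 1:] ^ Suc n :: 'k poly) i else 0)"
  proof
    fix z
    show "(diff1 g \<otimes>\<^bsub>R\<^esub> (diff1 g [^]\<^bsub>R\<^esub> n)) z
        = (\<Sum>i\<le>N. if g [^] i = z then coeff ([:- 1, 1:] ^ Suc n :: 'k poly) i else 0)"
    proof (cases "z \<in> carrier A")
      case z: True
      obtain K where K: "N = Suc K" using Suc.prems by (cases N) auto
      have pw: "g [^] i = inv g \<otimes> z \<longleftrightarrow> g [^] Suc i = z" for i :: nat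
      proof -
        have "g [^] i = inv g \<otimes> z \<longleftrightarrow> g \<otimes> g [^] i = z"
          using g z inv_solve_left[of "g [^] i" g z] by (simp add: eq_commute[of z])
        then show ?thesis using g by (simp add: m_comm)
      qed
      have "(\<Sum>i\<le>N. if g [^] i = z then (case i of 0 \<Rightarrow> 0 | Suc j \<Rightarrow> coeff ?f j) else 0)
          = (\<Sum>i\<le>K. if g [^] Suc i = z then coeff ?f i else 0)"
        unfolding K by (subst sum.atMost_Suc_shift) (simp cong: if_cong)
      also have "\<dots> = (\<Sum>i\<le>N. if g [^] Suc i = z then coeff ?f i else 0)"
        unfolding K using coN K by simp
      finally have shift: "(\<Sum>i\<le>N. if g [^] i = z then (case i of 0 \<Rightarrow> 0 | Suc j \<Rightarrow> coeff ?f j) else 0)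
          = (\<Sum>i\<le>N. if g [^] Suc i = z then coeff ?f i else 0)" .
      have "(\<Sum>i\<le>N. if g [^] i = z then coeff ([:- 1, 1:] ^ Suc n :: 'k poly) i else 0)
          = (\<Sum>i\<le>N. (if g [^] i = z then (case i of 0 \<Rightarrow> 0 | Suc j \<Rightarrow> coeff ?f j) else 0)
              - (if g [^] i = z then coeff ?f i else 0))"
        unfolding co by (rule sum.cong) auto
      also have "\<dots> = (\<Sum>i\<le>N. if g [^] Suc i = z then coeff ?f i else 0)
          - (\<Sum>i\<le>N. if g [^] i = z then coeff ?f i else 0)"
        unfolding sum_subtractf shift ..
      also have "\<dots> = (diff1 g \<otimes>\<^bsub>R\<^esub> (diff1 g [^]\<^bsub>R\<^esub> n)) z"
        unfolding diff1_mult_left[OF g cl] unfolding IH pw using z by simp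
      finally show ?thesis by (rule sym)
    next
      case False
      have "g [^] i \<noteq> z" for i :: nat using g False by auto
      then show ?thesis using False diff1_mult_left[OF g cl] by simp
    qed
  qed
  finally show ?case .
qed

lemma X_pow_q:
  assumes i: "i < L" shows "X i [^]\<^bsub>R\<^esub> q i = \<zero>\<^bsub>R\<^esub>"
proof -
  obtain f where f: "q i = CHAR('k) ^ f" using q_power[OF i] by blast
  have p: "prime CHAR('k poly)" using prime_char by simp
  have f': "q i = CHAR('k poly) ^ f" using f by simp
  have q0: "q i \<noteq> 0" using q_ge_2[OF i] by simp
  have fr: "(x + y) ^ q i = x ^ q i + y ^ q i" for x y :: "'k poly"
    by (rule freshmans_dream'[OF p f'])
  have m1: "(- 1 :: 'k poly) ^ q i = - 1"
    using fr[of 1 "- 1"] q0 by (simp add: power_0_left eq_neg_iff_add_eq_0 add.commute)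
  have "[:- 1, 1:] = monom 1 1 + (- 1 :: 'k poly)" by (simp add: monom_altdef one_pCons)
  then have "[:- 1, 1:] ^ q i = monom 1 (q i) + (- 1 :: 'k poly)"
    by (simp only: fr m1 monom_power mult_1 power_one)
  then have co: "coeff ([:- 1, 1:] ^ q i :: 'k poly) j = (if j = q i then 1 else 0) - (if j = 0 then 1 else 0)" for j
    by simp
  have "(\<Sum>j\<le>q i. if gen i [^] j = z then coeff ([:- 1, 1:] ^ q i :: 'k poly) j else 0) = 0" for z
  proof -
    have "(\<Sum>j\<le>q i. if gen i [^] j = z then coeff ([:- 1, 1:] ^ q i :: 'k poly) j else 0)
        = (\<Sum>j\<le>q i. (if j = q i then single 1 z \<one> else 0) - (if j = 0 then single 1 z \<one> else 0))"
      unfolding co by (rule sum.cong) (auto simp: single_def gen_pow_q[OF i])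
    then show ?thesis by (simp add: sum_subtractf)
  qed
  then show ?thesis using diff1_pow_poly[OF gen_closed[OF i] order_refl, of "q i"] by (simp add: zero_R)
qed

text \<open>A word in the \<open>X i\<close> that is too long contains some letter \<open>q i\<close> times.\<close>

lemma word_split:
  assumes i: "i < L" and "set ws \<subseteq> {..<L}"
  shows "prod_word (map X ws) = X i [^]\<^bsub>R\<^esub> count_list ws i \<otimes>\<^bsub>R\<^esub> prod_word (map X (filter (\<lambda>j. j \<noteq> i) ws))"
  using assms(2)
proof (induction ws)
  case (Cons j ws)
  let ?p = "X i [^]\<^bsub>R\<^esub> count_list ws i" and ?w = "prod_word (map X (filter (\<lambda>j. j \<noteq> i) ws))"
  have w: "?w \<in> carrier R" using Cons.prems by (intro prod_word_closed) (auto intro!: X_closed)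
  have p: "?p \<in> carrier R" using X_closed[OF i] by simp
  have j: "X j \<in> carrier R" using Cons.prems by (intro X_closed) simp
  show ?case using Cons w p j X_closed[OF i] by (simp add: R.m_ac)
qed simp

text \<open>The degree of the longest nonzero monomial in the \<open>X i\<close>.\<close>

definition top_degree :: nat where "top_degree = (\<Sum>i<L. q i - 1)"

lemma long_word_zero:
  assumes ws: "set ws \<subseteq> {..<L}" and len: "top_degree < length ws"
  shows "prod_word (map X ws) = \<zero>\<^bsub>R\<^esub>"
proof -
  have "\<exists>i<L. q i \<le> count_list ws i"
  proof (rule ccontr)
    assume "\<not> ?thesis"
    then have "count_list ws i \<le> q i - 1" if "i < L" for i using that by force
    then have "(\<Sum>i<L. count_list ws i) \<le> top_degree" unfolding top_degree_def by (intro sum_mono) simp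
    moreover have "(\<Sum>i<L. count_list ws i) = length ws" by (rule sum_count_set[OF ws]) simp
    ultimately show False using len by simp
  qed
  then obtain i where i: "i < L" "q i \<le> count_list ws i" by blast
  have Xi: "X i \<in> carrier R" by (rule X_closed[OF i(1)])
  have "X i [^]\<^bsub>R\<^esub> count_list ws i = X i [^]\<^bsub>R\<^esub> q i \<otimes>\<^bsub>R\<^esub> X i [^]\<^bsub>R\<^esub> (count_list ws i - q i)"
    using R.nat_pow_mult[OF Xi, of "q i" "count_list ws i - q i"] i(2) by simp
  then have z: "X i [^]\<^bsub>R\<^esub> count_list ws i = \<zero>\<^bsub>R\<^esub>" using Xi X_pow_q[OF i(1)] by simp
  have "prod_word (map X (filter (\<lambda>j. j \<noteq> i) ws)) \<in> carrier R"
    using ws by (intro prod_word_closed) (auto intro!: X_closed)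
  then show ?thesis using word_split[OF i(1) ws] z by simp
qed

lemma ideal_annihilator:
  assumes W: "W \<subseteq> carrier R" shows "ideal {b \<in> carrier R. \<forall>c\<in>W. c \<otimes>\<^bsub>R\<^esub> b = \<zero>\<^bsub>R\<^esub>} R" (is "ideal ?I R")
proof (rule idealI[OF R.ring_axioms])
  have W': "c \<in> carrier R" if "c \<in> W" for c using W that by blast
  show "subgroup ?I (add_monoid R)"
  proof (rule R.add.subgroupI)
    show "?I \<noteq> {}" using R.zero_closed W' by (auto intro!: exI[of _ "\<zero>\<^bsub>R\<^esub>"])
  qed (auto simp: W' R.r_minus R.r_distr)
  fix a x assume a: "a \<in> ?I" and x: "x \<in> carrier R"
  have "c \<otimes>\<^bsub>R\<^esub> (x \<otimes>\<^bsub>R\<^esub> a) = x \<otimes>\<^bsub>R\<^esub> (c \<otimes>\<^bsub>R\<^esub> a)" if "c \<in> W" for c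
    using W'[OF that] a x by (simp add: R.m_lcomm)
  then show "x \<otimes>\<^bsub>R\<^esub> a \<in> ?I" using a x by simp
  then show "a \<otimes>\<^bsub>R\<^esub> x \<in> ?I" using a x R.m_comm[of a x] by simp
qed

text \<open>By induction on \<open>j\<close>, the power \<open>I\<^sup>j\<close> of the augmentation ideal is annihilated by all words of length
  \<open>n - j\<close>; hence \<open>I\<^sup>n\<close> is annihilated by the empty word.\<close>

lemma aug_power_zero: "ideal_power R aug_ideal (Suc top_degree) = {\<zero>\<^bsub>R\<^esub>}"
proof -
  let ?n = "Suc top_degree"
  have word: "prod_word (map X ws) \<in> carrier R" if "set ws \<subseteq> {..<L}" for ws
    using that by (intro prod_word_closed) (auto intro!: X_closed)
  have ann: "j \<le> ?n \<Longrightarrow> a \<in> ideal_power R aug_ideal j \<Longrightarrow> set ws \<subseteq> {..<L} \<Longrightarrow> length ws = ?n - j \<Longrightarrow>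
      prod_word (map X ws) \<otimes>\<^bsub>R\<^esub> a = \<zero>\<^bsub>R\<^esub>" for j a ws
  proof (induction j arbitrary: a ws)
    case 0
    then show ?case using long_word_zero[of ws] by simp
  next
    case (Suc j)
    note ws = word[OF Suc.prems(3)]
    have prod: "prod_word (map X ws) \<otimes>\<^bsub>R\<^esub> (b \<otimes>\<^bsub>R\<^esub> c) = \<zero>\<^bsub>R\<^esub>"
      if b: "b \<in> aug_ideal" and c: "c \<in> ideal_power R aug_ideal j" for b c
    proof -
      note cR = aug_power_closed[OF c]
      \<comment> \<open>The elements \<open>b\<close> killed by \<open>w c\<close> form an ideal, so the generators \<open>X i\<close> suffice, and \<open>X i w\<close> is a longer word.\<close>
      let ?W = "{prod_word (map X ws) \<otimes>\<^bsub>R\<^esub> c}"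
      have W: "?W \<subseteq> carrier R" using ws cR by simp
      have "X i \<in> {b \<in> carrier R. \<forall>c\<in>?W. c \<otimes>\<^bsub>R\<^esub> b = \<zero>\<^bsub>R\<^esub>}" if i: "i < L" for i
      proof -
        have "prod_word (map X (i # ws)) \<otimes>\<^bsub>R\<^esub> c = \<zero>\<^bsub>R\<^esub>"
          using Suc.prems i by (intro Suc.IH c) simp_all
        then show ?thesis using X_closed[OF i] ws cR by (simp add: R.m_ac)
      qed
      from subsetD[OF aug_ideal_least[OF ideal_annihilator[OF W] this] b]
      show ?thesis using aug_ideal_closed[OF b] ws cR by (simp add: R.m_ac)
    qed
    have "a \<in> ideal_prod R aug_ideal (ideal_power R aug_ideal j)" using Suc.prems(2) by simp
    then have "a \<in> carrier R \<and> prod_word (map X ws) \<otimes>\<^bsub>R\<^esub> a = \<zero>\<^bsub>R\<^esub>"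
    proof (induction rule: ideal_prod.induct)
      case (prod b c)
      then show ?case using aug_ideal_closed[OF prod(1)] aug_power_closed[OF prod(2)]
          \<open>\<And>c b. b \<in> aug_ideal \<Longrightarrow> c \<in> ideal_power R aug_ideal j \<Longrightarrow> prod_word (map X ws) \<otimes>\<^bsub>R\<^esub> (b \<otimes>\<^bsub>R\<^esub> c) = \<zero>\<^bsub>R\<^esub>\<close>
        by simp
    next
      case (sum s1 s2)
      then show ?case using ws by (simp add: R.r_distr)
    qed
    then show ?case by simp
  qed
  have "a = \<zero>\<^bsub>R\<^esub>" if "a \<in> ideal_power R aug_ideal ?n" for a
    using ann[OF order_refl that, of "[]"] aug_power_closed[OF that] by simp
  moreover have "\<zero>\<^bsub>R\<^esub> \<in> ideal_power R aug_ideal ?n"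
    by (rule additive_subgroup.zero_closed[OF ideal.axioms(1)[OF ideal_ideal_power[OF ideal_aug_ideal]]])
  ultimately show ?thesis by blast
qed

text \<open>Multiplying an element supported on \<open>layer i\<close> by a power of \<open>X i\<close> spreads it over the cosets of the
  powers of \<open>gen i\<close>. These cosets are distinct up to the exponent \<open>q i - 1\<close>, so on the last one the
  original coefficients survive.\<close>

lemma X_pow_leading:
  assumes i: "i < L" and b: "b \<in> carrier R" and supp: "\<And>z. b z \<noteq> 0 \<Longrightarrow> z \<in> layer i"
  shows "n < q i \<Longrightarrow> (\<forall>z. (X i [^]\<^bsub>R\<^esub> n \<otimes>\<^bsub>R\<^esub> b) z \<noteq> 0 \<longrightarrow> (\<exists>h\<in>layer i. \<exists>j\<le>n. z = h \<otimes> gen i [^] j)) \<and>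
    (\<forall>h\<in>layer i. (X i [^]\<^bsub>R\<^esub> n \<otimes>\<^bsub>R\<^esub> b) (h \<otimes> gen i [^] n) = b h)"
proof (induction n)
  case 0
  have "\<exists>h\<in>layer i. z = h \<otimes> \<one>" if "b z \<noteq> 0" for z
    using supp[OF that] layer_closed[OF supp[OF that]] by (intro bexI[of _ z]) simp_all
  then show ?case using b layer_closed by simp
next
  case (Suc n)
  let ?g = "gen i" and ?b = "X i [^]\<^bsub>R\<^esub> n \<otimes>\<^bsub>R\<^esub> b"
  have g: "?g \<in> carrier A" by (rule gen_closed[OF i])
  have Xi: "X i \<in> carrier R" by (rule X_closed[OF i])
  have bR: "?b \<in> carrier R" using Xi b by simp
  have n: "n < q i" using Suc.prems by simp
  have IH1: "\<exists>h\<in>layer i. \<exists>j\<le>n. z = h \<otimes> ?g [^] j" if "?b z \<noteq> 0" for z using Suc.IH[OF n] that by blast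
  have IH2: "?b (h \<otimes> ?g [^] n) = b h" if "h \<in> layer i" for h using Suc.IH[OF n] that by blast
  have "X i [^]\<^bsub>R\<^esub> Suc n \<otimes>\<^bsub>R\<^esub> b = X i \<otimes>\<^bsub>R\<^esub> ?b" using Xi b by (simp add: R.m_ac)
  also have "\<dots> = (\<lambda>z. if z \<in> carrier A then ?b (inv ?g \<otimes> z) - ?b z else 0)"
    by (rule diff1_mult_left[OF g bR])
  finally have val: "X i [^]\<^bsub>R\<^esub> Suc n \<otimes>\<^bsub>R\<^esub> b = (\<lambda>z. if z \<in> carrier A then ?b (inv ?g \<otimes> z) - ?b z else 0)" .
  show ?case unfolding val
  proof (intro conjI allI impI ballI)
    fix z assume "(if z \<in> carrier A then ?b (inv ?g \<otimes> z) - ?b z else 0) \<noteq> 0"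
    then have z: "z \<in> carrier A" "?b (inv ?g \<otimes> z) \<noteq> 0 \<or> ?b z \<noteq> 0" by (auto split: if_splits)
    from z(2) show "\<exists>h\<in>layer i. \<exists>j\<le>Suc n. z = h \<otimes> ?g [^] j"
    proof
      assume "?b z \<noteq> 0"
      then obtain h j where "h \<in> layer i" "j \<le> n" "z = h \<otimes> ?g [^] j" using IH1 by blast
      then show ?thesis by (intro bexI[of _ h] exI[of _ j]) simp_all
    next
      assume "?b (inv ?g \<otimes> z) \<noteq> 0"
      then obtain h j where hj: "h \<in> layer i" "j \<le> n" "inv ?g \<otimes> z = h \<otimes> ?g [^] j" using IH1 by blast
      have h: "h \<in> carrier A" by (rule layer_closed[OF hj(1)])
      have "z = ?g \<otimes> (inv ?g \<otimes> z)" using g z(1) by (simp add: m_assoc[symmetric])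
      also have "\<dots> = h \<otimes> ?g [^] Suc j" unfolding hj(3) using g h by (simp add: m_ac)
      finally show ?thesis using hj(1,2) by (intro bexI[of _ h] exI[of _ "Suc j"]) simp_all
    qed
  next
    fix h assume h: "h \<in> layer i"
    note hA = layer_closed[OF h]
    have top: "?b (h \<otimes> ?g [^] Suc n) = 0"
    proof (rule ccontr)
      assume "?b (h \<otimes> ?g [^] Suc n) \<noteq> 0"
      then obtain h' j where hj: "h' \<in> layer i" "j \<le> n" "h \<otimes> ?g [^] Suc n = h' \<otimes> ?g [^] j" using IH1 by blast
      have "Suc n = j" by (rule layer_exponent[OF i h hj(1) Suc.prems _ hj(3)]) (use hj(2) n in simp)
      then show False using hj(2) by simp
    qed
    have "inv ?g \<otimes> (h \<otimes> ?g [^] Suc n) = h \<otimes> ?g [^] n"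
    proof -
      have "h \<otimes> ?g [^] Suc n = ?g \<otimes> (h \<otimes> ?g [^] n)" using g hA by (simp add: m_ac)
      then show ?thesis using g hA by (simp add: m_assoc[symmetric])
    qed
    then show "(if h \<otimes> ?g [^] Suc n \<in> carrier A then ?b (inv ?g \<otimes> (h \<otimes> ?g [^] Suc n)) - ?b (h \<otimes> ?g [^] Suc n) else 0) = b h"
      using top IH2[OF h] g hA by simp
  qed
qed

primrec top_product :: "nat \<Rightarrow> 'g \<Rightarrow> 'k" where
  "top_product 0 = \<one>\<^bsub>R\<^esub>"
| "top_product (Suc i) = X i [^]\<^bsub>R\<^esub> (q i - 1) \<otimes>\<^bsub>R\<^esub> top_product i"

lemma top_product_closed: "i \<le> L \<Longrightarrow> top_product i \<in> carrier R"
  by (induction i) (simp_all add: X_closed)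

lemma top_product_nonzero:
  "i \<le> L \<Longrightarrow> (\<forall>z. top_product i z \<noteq> 0 \<longrightarrow> z \<in> layer i) \<and> (\<exists>h\<in>layer i. top_product i h \<noteq> 0)"
proof (induction i)
  case 0
  have "\<one> \<in> layer 0" by (simp add: layer_def co_one)
  then show ?case by (auto simp: one_R single_def)
next
  case (Suc i)
  then have i: "i < L" by simp
  have supp: "z \<in> layer i" if "top_product i z \<noteq> 0" for z using Suc.IH i that by simp
  obtain h where h: "h \<in> layer i" "top_product i h \<noteq> 0" using Suc.IH i by auto
  have n: "q i - 1 < q i" using q_ge_2[OF i] by simp
  note lead = X_pow_leading[OF i top_product_closed[OF less_imp_le[OF i]] supp n]
  show ?case
  proof (intro conjI allI impI)
    fix z assume "top_product (Suc i) z \<noteq> 0"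
    then obtain h j where "h \<in> layer i" "z = h \<otimes> gen i [^] (j::nat)" using lead by auto
    then show "z \<in> layer (Suc i)" using layer_mult_gen[OF i] by simp
  next
    show "\<exists>h\<in>layer (Suc i). top_product (Suc i) h \<noteq> 0"
      by (rule bexI[OF _ layer_mult_gen[OF i h(1), of "q i - 1"]]) (use lead h in simp)
  qed
qed

lemma top_product_L: "top_product L \<noteq> \<zero>\<^bsub>R\<^esub>"
  using top_product_nonzero[OF order_refl] by (auto simp: zero_R)

section \<open>The bounds\<close>

lemma aug_ideal_maximal: "maximalideal aug_ideal R"
proof (rule maximalidealI[OF ideal_aug_ideal])
  have "\<one>\<^bsub>R\<^esub> \<notin> aug_ideal" by (simp add: aug_ideal_def one_R)
  then show "carrier R \<noteq> aug_ideal" using R.one_closed by blast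
  fix J assume J: "ideal J R" "aug_ideal \<subseteq> J" "J \<subseteq> carrier R"
  interpret J: ideal J R by (rule J(1))
  show "J = aug_ideal \<or> J = carrier R"
  proof (cases "J \<subseteq> aug_ideal")
    case True
    then show ?thesis using J(2) by blast
  next
    case False
    then obtain a where a: "a \<in> J" "a \<notin> aug_ideal" by blast
    have aR: "a \<in> carrier R" using a(1) J(3) by blast
    have ne: "aug a \<noteq> 0" using a(2) aR by (simp add: aug_ideal_def)
    let ?s = "single (aug a) \<one>"
    have "a \<ominus>\<^bsub>R\<^esub> ?s \<in> J" using minus_aug_in_aug_ideal[OF aR] J(2) by blast
    then have "a \<ominus>\<^bsub>R\<^esub> (a \<ominus>\<^bsub>R\<^esub> ?s) \<in> J"
      unfolding a_minus_def[of R a "a \<ominus>\<^bsub>R\<^esub> ?s"] by (intro J.a_closed J.a_inv_closed a(1))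
    moreover have "a \<ominus>\<^bsub>R\<^esub> (a \<ominus>\<^bsub>R\<^esub> ?s) = ?s"
      unfolding minus_R[OF aR R.minus_closed[OF aR single_closed[OF one_closed]]]
      unfolding minus_R[OF aR single_closed[OF one_closed]] by simp
    ultimately have "single (inverse (aug a)) \<one> \<otimes>\<^bsub>R\<^esub> ?s \<in> J" by (intro J.I_l_closed) simp_all
    then have "\<one>\<^bsub>R\<^esub> \<in> J" using ne by (simp add: single_mult one_R)
    then show ?thesis using J.one_imp_carrier by simp
  qed
qed

text \<open>A maximal ideal is prime and therefore contains the nilpotent elements \<open>X i\<close>.\<close>

lemma jacobson_radical_eq: "jacobson_radical R = aug_ideal"
proof
  show "jacobson_radical R \<subseteq> aug_ideal"
    unfolding jacobson_radical_def using aug_ideal_maximal by blast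
  have "aug_ideal \<subseteq> I" if "maximalideal I R" for I
  proof -
    interpret I: primeideal I R by (rule R.maximalideal_prime[OF that])
    have pow: "x [^]\<^bsub>R\<^esub> n \<in> I \<Longrightarrow> x \<in> I" if x: "x \<in> carrier R" for x and n :: nat
    proof (induction n)
      case 0
      then show ?case using I.one_imp_carrier I.I_notcarr by simp
    next
      case (Suc n)
      then show ?case using I.I_prime[of "x [^]\<^bsub>R\<^esub> n" x] x by auto
    qed
    show ?thesis
    proof (rule aug_ideal_least[OF I.is_ideal])
      fix i assume i: "i < L"
      show "X i \<in> I" using pow[OF X_closed[OF i], of "q i"] X_pow_q[OF i] I.zero_closed by simp
    qed
  qed
  then show "aug_ideal \<subseteq> jacobson_radical R"
    unfolding jacobson_radical_def using aug_ideal_closed by blast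
qed

lemma nilpotency_index_aug:
  defines "m \<equiv> nilpotency_index R aug_ideal"
  shows "ideal_power R aug_ideal m = {\<zero>\<^bsub>R\<^esub>}" "m \<le> Suc top_degree" "2 \<le> m"
proof -
  show m: "ideal_power R aug_ideal m = {\<zero>\<^bsub>R\<^esub>}"
    unfolding m_def nilpotency_index_def by (rule LeastI[of _ "Suc top_degree"]) (rule aug_power_zero)
  show "m \<le> Suc top_degree"
    unfolding m_def nilpotency_index_def by (rule Least_le) (rule aug_power_zero)
  have one: "\<one>\<^bsub>R\<^esub> \<noteq> \<zero>\<^bsub>R\<^esub>"
  proof
    assume "\<one>\<^bsub>R\<^esub> = \<zero>\<^bsub>R\<^esub>"
    then have "aug \<one>\<^bsub>R\<^esub> = 0" by (simp only: aug_zero)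
    then show False by (simp add: one_R)
  qed
  have X0: "X 0 \<noteq> \<zero>\<^bsub>R\<^esub>"
  proof
    assume "X 0 = \<zero>\<^bsub>R\<^esub>"
    then have "X 0 [^]\<^bsub>R\<^esub> (q 0 - 1) = \<zero>\<^bsub>R\<^esub>" using q_ge_2[OF L] R.nat_pow_zero[of "q 0 - 1"] by simp
    have "top_product (Suc 0) = \<zero>\<^bsub>R\<^esub>" using \<open>X 0 [^]\<^bsub>R\<^esub> (q 0 - 1) = \<zero>\<^bsub>R\<^esub>\<close> by simp
    then show False using top_product_nonzero[of "Suc 0"] L by (simp add: zero_R)
  qed
  have "m \<noteq> 0"
  proof
    assume "m = 0"
    then have "carrier R = {\<zero>\<^bsub>R\<^esub>}" using m by simp
    then show False using one R.one_closed by blast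
  qed
  moreover have "m \<noteq> Suc 0"
  proof
    assume m1: "m = Suc 0"
    have "X 0 \<otimes>\<^bsub>R\<^esub> \<one>\<^bsub>R\<^esub> \<in> ideal_power R aug_ideal (Suc 0)"
      by (rule aug_power_Suc[OF diff1_aug[OF gen_closed[OF L]]]) simp
    then show False using m X0 X_closed[OF L] unfolding m1 by simp
  qed
  ultimately show "2 \<le> m" by simp
qed

lemma ghost_number_bound:
  "enat (q 0 div 2 + (\<Sum>i\<in>{1..<L}. q i - 1)) \<le> ghost_number R T"
proof -
  \<comment> \<open>The least \<open>s\<close> for which the square of the \<open>s\<close>-th power of \<open>X 0\<close> is forced to vanish; the \<open>q 0 div 2 - 1\<close> letters \<open>X 0\<close> in the word complete \<open>y\<close> to the exponent \<open>q 0 - 1\<close>.\<close>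
  define s where "s = q 0 - q 0 div 2"
  have q2: "2 \<le> q 0" by (rule q_ge_2[OF L])
  have X0: "X 0 \<in> carrier R" by (rule X_closed[OF L])
  define y where "y = X 0 [^]\<^bsub>R\<^esub> s"
  have yR: "y \<in> carrier R" using X0 by (simp add: y_def)
  have "s + s = q 0 + (s + s - q 0)" using q2 by (simp add: s_def)
  then have "y \<otimes>\<^bsub>R\<^esub> y = X 0 [^]\<^bsub>R\<^esub> q 0 \<otimes>\<^bsub>R\<^esub> X 0 [^]\<^bsub>R\<^esub> (s + s - q 0)"
    using X0 by (simp add: y_def R.nat_pow_mult)
  then have yy: "y \<otimes>\<^bsub>R\<^esub> y = \<zero>\<^bsub>R\<^esub>" using X0 X_pow_q[OF L] by simp
  define tail where "tail k = concat (map (\<lambda>i. replicate (q i - 1) (X i)) [1..<k])" for k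
  have tailR: "set (tail k) \<subseteq> carrier R" if "k \<le> L" for k
    using that by (auto simp: tail_def intro!: X_closed split: if_splits)
  have tail_prod: "Suc k \<le> L \<Longrightarrow> top_product (Suc k) = prod_word (tail (Suc k)) \<otimes>\<^bsub>R\<^esub> X 0 [^]\<^bsub>R\<^esub> (q 0 - 1)" for k
  proof (induction k)
    case 0
    then show ?case using X0 by (simp add: tail_def)
  next
    case (Suc k)
    let ?r = "replicate (q (Suc k) - 1) (X (Suc k))"
    have k: "X (Suc k) \<in> carrier R" using Suc.prems by (intro X_closed) simp
    have t: "prod_word (tail (Suc k)) \<in> carrier R" using Suc.prems by (intro prod_word_closed tailR) simp
    have "tail (Suc (Suc k)) = tail (Suc k) @ ?r" by (simp add: tail_def)
    then have "prod_word (tail (Suc (Suc k))) = prod_word (tail (Suc k)) \<otimes>\<^bsub>R\<^esub> X (Suc k) [^]\<^bsub>R\<^esub> (q (Suc k) - 1)"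
      using prod_word_append[of "tail (Suc k)" ?r] tailR[of "Suc k"] Suc.prems k
      by (simp add: prod_word_replicate set_replicate_conv_if)
    then show ?case using Suc k t X0 by (simp add: R.m_ac)
  qed
  define rs where "rs = tail L @ replicate (q 0 div 2 - 1) (X 0)"
  have rs_aug: "set rs \<subseteq> aug_ideal"
    by (auto simp: rs_def tail_def intro!: diff1_aug gen_closed L split: if_splits)
  have "prod_word rs \<otimes>\<^bsub>R\<^esub> y = prod_word (tail L) \<otimes>\<^bsub>R\<^esub> (X 0 [^]\<^bsub>R\<^esub> (q 0 div 2 - 1) \<otimes>\<^bsub>R\<^esub> y)"
    using prod_word_append[of "tail L" "replicate (q 0 div 2 - 1) (X 0)"] tailR[OF order_refl] X0 yR
      prod_word_closed[OF tailR[OF order_refl]]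
    by (simp add: rs_def prod_word_replicate set_replicate_conv_if R.m_assoc)
  also have "X 0 [^]\<^bsub>R\<^esub> (q 0 div 2 - 1) \<otimes>\<^bsub>R\<^esub> y = X 0 [^]\<^bsub>R\<^esub> (q 0 - 1)"
  proof -
    have "q 0 div 2 - 1 + s = q 0 - 1" using q2 by (simp add: s_def)
    then show ?thesis using X0 by (simp add: y_def R.nat_pow_mult)
  qed
  also have "prod_word (tail L) \<otimes>\<^bsub>R\<^esub> X 0 [^]\<^bsub>R\<^esub> (q 0 - 1) = top_product L"
    using tail_prod[of "L - 1"] L by simp
  finally have nz: "prod_word rs \<otimes>\<^bsub>R\<^esub> y \<noteq> \<zero>\<^bsub>R\<^esub>" using top_product_L by simp
  have "length (tail L) = (\<Sum>i\<in>{1..<L}. q i - 1)"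
    by (simp add: tail_def length_concat comp_def sum_list_distinct_conv_sum_set)
  then have "Suc (length rs) = q 0 div 2 + (\<Sum>i\<in>{1..<L}. q i - 1)"
    using q2 by (simp add: rs_def)
  then show ?thesis using ghost_number_ge[OF aug_power_zero yR yy rs_aug nz] by simp
qed

theorem ghost_and_generating_number_bounds:
  defines "m \<equiv> nilpotency_index R (jacobson_radical R)"
  shows "enat (nat (int m - int (q 0) + \<lceil>(real (q 0) - 1) / 2\<rceil>)) \<le> ghost_number R T"
    "ghost_number R T \<le> generating_number R T" "generating_number R T \<le> enat (m - 1)"
proof -
  have m: "m = nilpotency_index R aug_ideal" by (simp add: m_def jacobson_radical_eq)
  note M = nilpotency_index_aug[folded m]
  have q2: "2 \<le> q 0" by (rule q_ge_2[OF L])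
  have "top_degree = (q 0 - 1) + (\<Sum>i\<in>{1..<L}. q i - 1)"
    unfolding top_degree_def lessThan_atLeast0 using L by (simp add: sum.atLeast_Suc_lessThan)
  then have "int m - int (q 0) \<le> int (\<Sum>i\<in>{1..<L}. q i - 1)" using M(2) q2 by linarith
  moreover have "\<lceil>(real (q 0) - 1) / 2\<rceil> = int (q 0 div 2)"
  proof (rule ceiling_unique)
    have "q 0 = 2 * (q 0 div 2) + q 0 mod 2" by simp
    then have "real (q 0) = 2 * real (q 0 div 2) + real (q 0 mod 2)" by (metis of_nat_add of_nat_mult of_nat_numeral)
    moreover have "real (q 0 mod 2) \<ge> 0" "real (q 0 mod 2) \<le> 1" by simp_all
    ultimately show "real_of_int (int (q 0 div 2)) - 1 < (real (q 0) - 1) / 2"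
      "(real (q 0) - 1) / 2 \<le> real_of_int (int (q 0 div 2))" by simp_all
  qed
  ultimately have "nat (int m - int (q 0) + \<lceil>(real (q 0) - 1) / 2\<rceil>) \<le> q 0 div 2 + (\<Sum>i\<in>{1..<L}. q i - 1)"
    by linarith
  then have "enat (nat (int m - int (q 0) + \<lceil>(real (q 0) - 1) / 2\<rceil>)) \<le> enat (q 0 div 2 + (\<Sum>i\<in>{1..<L}. q i - 1))"
    by (simp only: enat_ord_simps)
  also note ghost_number_bound
  finally show "enat (nat (int m - int (q 0) + \<lceil>(real (q 0) - 1) / 2\<rceil>)) \<le> ghost_number R T" .
  show "ghost_number R T \<le> generating_number R T" by (rule ghost_number_le_generating_number[OF module_T])
  have k: "Suc (Suc (m - 2)) = m" "Suc (m - 2) = m - 1" using M(3) by linarith+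
  have "ideal_power R aug_ideal (Suc (Suc (m - 2))) = {\<zero>\<^bsub>R\<^esub>}" unfolding k(1) by (rule M(1))
  from generating_number_le[OF this] show "generating_number R T \<le> enat (m - 1)" unfolding k(2) .
qed

end

text \<open>Representatives in the range \<open>0, \<dots>, q i - 1\<close> of the components of an isomorphism serve as coordinates;
  index \<open>0\<close> belongs to the first factor.\<close>

lemma product_coordinates:
  fixes A :: "'g monoid" and l n :: nat and d :: "nat \<Rightarrow> nat"
  assumes iso: "A \<cong> integer_mod_group n \<times>\<times> product_group {1..l} (\<lambda>i. integer_mod_group (d i))"
    and n: "1 < n" and d: "\<And>i. i \<in> {1..l} \<Longrightarrow> 1 < d i"
  defines "q \<equiv> \<lambda>i. if i = 0 then n else d i"
  obtains gen :: "nat \<Rightarrow> 'g" and co :: "nat \<Rightarrow> 'g \<Rightarrow> nat" where "finite (carrier A)"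
    "\<And>i. i < Suc l \<Longrightarrow> gen i \<in> carrier A"
    "\<And>i a. i < Suc l \<Longrightarrow> a \<in> carrier A \<Longrightarrow> co i a < q i"
    "\<And>i a b. i < Suc l \<Longrightarrow> a \<in> carrier A \<Longrightarrow> b \<in> carrier A \<Longrightarrow>
        co i (a \<otimes>\<^bsub>A\<^esub> b) = (co i a + co i b) mod q i"
    "\<And>a b. a \<in> carrier A \<Longrightarrow> b \<in> carrier A \<Longrightarrow> (\<And>i. i < Suc l \<Longrightarrow> co i a = co i b) \<Longrightarrow> a = b"
    "\<And>i j. i < Suc l \<Longrightarrow> j < Suc l \<Longrightarrow> co j (gen i) = (if i = j then 1 else 0)"
proof -
  let ?H = "product_group {1..l} (\<lambda>i. integer_mod_group (d i))"
  let ?G = "integer_mod_group n \<times>\<times> ?H"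
  obtain \<psi> where \<psi>: "\<psi> \<in> hom A ?G" "bij_betw \<psi> (carrier A) (carrier ?G)"
    using iso unfolding is_iso_def iso_def by blast
  have carG: "carrier ?G = {0..<int n} \<times> (\<Pi>\<^sub>E i\<in>{1..l}. {0..<int (d i)})"
  proof -
    have "(\<Pi>\<^sub>E i\<in>{1..l}. carrier (integer_mod_group (d i))) = (\<Pi>\<^sub>E i\<in>{1..l}. {0..<int (d i)})"
      using d by (intro PiE_cong) (force simp: carrier_integer_mod_group)
    then show ?thesis using n by (simp add: carrier_integer_mod_group)
  qed
  define cz where "cz i a = (if i = 0 then fst (\<psi> a) else snd (\<psi> a) i)" for i a
  define co where "co i a = nat (cz i a)" for i a
  define unit where "unit i = (if i = 0 then 1 else (0 :: int), \<lambda>j\<in>{1..l}. if j = i then 1 else (0 :: int))" for i :: nat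
  define gen where "gen i = inv_into (carrier A) \<psi> (unit i)" for i
  have \<psi>c: "\<psi> a \<in> carrier ?G" if "a \<in> carrier A" for a using \<psi>(2) that by (auto simp: bij_betw_def)
  have snd_range: "snd (\<psi> a) \<in> (\<Pi>\<^sub>E i\<in>{1..l}. {0..<int (d i)})" if "a \<in> carrier A" for a
    using \<psi>c[OF that] unfolding carG mem_Times_iff by (rule conjunct2)
  have range: "0 \<le> cz i a" "cz i a < int (q i)" if i: "i < Suc l" and a: "a \<in> carrier A" for i a
  proof -
    have f: "fst (\<psi> a) \<in> {0..<int n}"
      using \<psi>c[OF a] unfolding carG mem_Times_iff by (rule conjunct1)
    have "cz i a \<in> {0..<int (q i)}"
    proof (cases "i = 0")
      case True
      then show ?thesis using f by (simp add: cz_def q_def)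
    next
      case False
      then have "i \<in> {1..l}" using i by simp
      from PiE_mem[OF snd_range[OF a] this] show ?thesis using False by (simp add: cz_def q_def)
    qed
    then show "0 \<le> cz i a" "cz i a < int (q i)" by simp_all
  qed
  have mult: "cz i (a \<otimes>\<^bsub>A\<^esub> b) = (cz i a + cz i b) mod int (q i)"
    if i: "i < Suc l" and a: "a \<in> carrier A" and b: "b \<in> carrier A" for i a b
  proof -
    have "\<psi> (a \<otimes>\<^bsub>A\<^esub> b) = \<psi> a \<otimes>\<^bsub>?G\<^esub> \<psi> b" using \<psi>(1) a b by (simp add: hom_def)
    then have "\<psi> (a \<otimes>\<^bsub>A\<^esub> b) = ((fst (\<psi> a) + fst (\<psi> b)) mod int n,
        \<lambda>j\<in>{1..l}. (snd (\<psi> a) j + snd (\<psi> b) j) mod int (d j))"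
      by (simp add: DirProd_def split_beta)
    then show ?thesis using i by (auto simp: cz_def q_def)
  qed
  have d': "Suc 0 < d j" "0 < d j" if "Suc 0 \<le> j" "j \<le> l" for j using d[of j] that by simp_all
  have unitG: "unit i \<in> carrier ?G" for i
    unfolding carG unit_def using n by (auto simp: PiE_iff d')
  have gen: "gen i \<in> carrier A" "\<psi> (gen i) = unit i" for i
    using \<psi>(2) unitG[of i] unfolding gen_def bij_betw_def
    by (auto intro: inv_into_into f_inv_into_f)
  show thesis
  proof (rule that[of gen co])
    have "finite (carrier ?G)" unfolding carG by (intro finite_cartesian_product finite_PiE) simp_all
    then show "finite (carrier A)" using bij_betw_finite[OF \<psi>(2)] by blast
    show "gen i \<in> carrier A" for i by (rule gen(1))
    show "co i a < q i" if "i < Suc l" "a \<in> carrier A" for i a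
      using range[OF that] by (simp add: co_def nat_less_iff)
    show "co i (a \<otimes>\<^bsub>A\<^esub> b) = (co i a + co i b) mod q i"
      if "i < Suc l" "a \<in> carrier A" "b \<in> carrier A" for i a b
      using range[OF that(1,2)] range[OF that(1,3)]
      by (simp add: co_def mult[OF that] nat_mod_distrib nat_add_distrib)
    show "a = b" if a: "a \<in> carrier A" and b: "b \<in> carrier A" and eq: "\<And>i. i < Suc l \<Longrightarrow> co i a = co i b" for a b
    proof -
      have cz: "cz i a = cz i b" if "i < Suc l" for i
        using eq[OF that] range(1)[OF that a] range(1)[OF that b] by (simp add: co_def eq_nat_nat_iff)
      from snd_range[OF a] snd_range[OF b] have "snd (\<psi> a) = snd (\<psi> b)"
      proof (rule PiE_ext)
        fix i assume i: "i \<in> {1..l}"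
        then show "snd (\<psi> a) i = snd (\<psi> b) i" using cz[of i] by (auto simp: cz_def)
      qed
      moreover have "fst (\<psi> a) = fst (\<psi> b)" using cz[of 0] by (simp add: cz_def)
      ultimately have "\<psi> a = \<psi> b" by (rule prod_eqI[rotated])
      then show "a = b" using \<psi>(2) a b by (auto simp: bij_betw_def dest: inj_onD)
    qed
    show "co j (gen i) = (if i = j then 1 else 0)" if "i < Suc l" "j < Suc l" for i j
      using that by (auto simp: co_def cz_def gen(2) unit_def)
  qed
qed

theorem theorem4p9:
  fixes p r l m :: nat and e :: "nat \<Rightarrow> nat"
    and A :: "'g monoid" and T :: "('g \<Rightarrow> 'k::field, 'u) module"
  assumes "prime p" and "CHAR('k) = p"
    and "r \<ge> 1" and "\<And>i. i \<in> {1..l} \<Longrightarrow> e i \<ge> 1" and "\<And>i. i \<in> {1..l} \<Longrightarrow> r \<le> e i"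
    and "comm_group A"
    and "A \<cong> integer_mod_group (p ^ r) \<times>\<times>
              product_group {1..l} (\<lambda>i. integer_mod_group (p ^ e i))"
    and "m = nilpotency_index (group_algebra A :: ('g \<Rightarrow> 'k) ring)
               (jacobson_radical (group_algebra A))"
    and "infinite (UNIV :: 'u set)"
    and "trivial_module A T"
  shows "enat (nat (int m - int (p ^ r) + \<lceil>(real (p ^ r) - 1) / 2\<rceil>))
           \<le> ghost_number (group_algebra A) T \<and>
         ghost_number (group_algebra A) T \<le> generating_number (group_algebra A) T \<and>
         generating_number (group_algebra A) T \<le> enat (m - 1)"
proof -
  have p2: "2 \<le> p" using assms(1) by (rule prime_ge_2_nat)
  have gt1: "1 < p ^ f" if "1 \<le> f" for f using p2 that by (intro one_less_power) simp_all
  define q where "q = (\<lambda>i. if i = 0 then p ^ r else p ^ e i)"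
  obtain gen :: "nat \<Rightarrow> 'g" and co :: "nat \<Rightarrow> 'g \<Rightarrow> nat" where fin: "finite (carrier A)"
    and gen: "\<And>i. i < Suc l \<Longrightarrow> gen i \<in> carrier A"
    and co: "\<And>i a. i < Suc l \<Longrightarrow> a \<in> carrier A \<Longrightarrow> co i a < q i"
    "\<And>i a b. i < Suc l \<Longrightarrow> a \<in> carrier A \<Longrightarrow> b \<in> carrier A \<Longrightarrow>
        co i (a \<otimes>\<^bsub>A\<^esub> b) = (co i a + co i b) mod q i"
    "\<And>a b. a \<in> carrier A \<Longrightarrow> b \<in> carrier A \<Longrightarrow> (\<And>i. i < Suc l \<Longrightarrow> co i a = co i b) \<Longrightarrow> a = b"
    "\<And>i j. i < Suc l \<Longrightarrow> j < Suc l \<Longrightarrow> co j (gen i) = (if i = j then 1 else 0)"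
    unfolding q_def
    using product_coordinates[OF assms(7) gt1[OF assms(3)] gt1[OF assms(4)]] by blast
  interpret abelian_p_group_algebra A T "Suc l" gen q co
  proof (intro abelian_p_group_algebra.intro group_algebra_modules.intro group_algebra_modules_axioms.intro
      abelian_p_group_algebra_axioms.intro assms(6,9,10) fin gen co)
    show "prime CHAR('k)" using assms(1,2) by simp
    show "\<exists>f\<ge>1. q i = CHAR('k) ^ f" if "i < Suc l" for i
      using that assms(3) assms(4)[of i] unfolding assms(2) q_def
      by (intro exI[of _ "if i = 0 then r else e i"]) simp
  qed simp_all
  show ?thesis
    using ghost_and_generating_number_bounds unfolding assms(8) by (simp add: q_def)
qed

end
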